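(* Let $K$ be algebraically closed of characteristic $p=g+1$, where $g>2$ and $g+1$ is prime, and let $\mathcal Z_{d,e,\ell}:\ Y^{g+1}-Y=X^3+dX^2+eX+\ell$ ($d,e,\ell\in K$), a wild non-hyperelliptic $(g+1)$-curve of genus $g$. Let $P_\infty$ be the unique common pole of the coordinate functions $x,y$ in $K(\mathcal Z_{d,e,\ell})$. Then $\mathrm{Aut}(\mathcal Z_{d,e,\ell})$ fixes $P_\infty$, unless $g+1\equiv-1\pmod 3$ and $\mathcal Z_{d,e,\ell}$ is isomorphic to the curve $\mathcal C:\ Y^{g+1}-Y=X^3$, in which case $|\mathrm{Aut}(\mathcal C)|=3g(g+1)(g+2)$. Moreover, if $g\equiv0\pmod3$, then $|\mathrm{Aut}(\mathcal C)|=3g(g+1)$. If $\mathcal Z_{d,e,\ell}$ is not isomorphic to $\mathcal C$, then $|\mathrm{Aut}(\mathcal Z_{d,e,\ell})|\in\{g+1,\,2(g+1),\,3(g+1)\}$.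
   Context: A $q$-curve ($q$ prime) is a curve whose automorphism group contains a subgroup of order $q$; it is wild if $q=p$. Isomorphism of curves means birational equivalence over $K$. *)

theory Defs
  imports "HOL-Algebra.QuotRing" "HOL-Algebra.Subrings"
    "HOL-Computational_Algebra.Fraction_Field" "HOL-Computational_Algebra.Polynomial"
begin

text \<open>K is a field (type 'a); K(x) is the rational function field 'a poly fract.
  The function field K(Z) of the Artin-Schreier curve Y^p - Y = f(X) is
  K(x)[Y] / (Y^p - Y - f(x)), represented by the canonical representatives:
  polynomials in Y over K(x) of degree < p, with multiplication modulo
  the defining polynomial.\<close>

definition alg_closed_field :: "'a::field itself \<Rightarrow> bool" where
  "alg_closed_field _ \<longleftrightarrow> (\<forall>q::'a poly. degree q > 0 \<longrightarrow> (\<exists>x. poly q x = 0))"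

definition cubic_rf :: "'a::field \<Rightarrow> 'a \<Rightarrow> 'a \<Rightarrow> 'a poly fract" where
  "cubic_rf d e l = Fract [:l, e, d, 1:] 1"

definition AS_modulus :: "nat \<Rightarrow> 'a::field \<Rightarrow> 'a \<Rightarrow> 'a \<Rightarrow> 'a poly fract poly" where
  "AS_modulus p d e l = monom 1 p - [:0, 1:] - [:cubic_rf d e l:]"

definition AS_field :: "nat \<Rightarrow> 'a::field \<Rightarrow> 'a \<Rightarrow> 'a \<Rightarrow> ('a poly fract poly) ring" where
  "AS_field p d e l =
     \<lparr>carrier = {q. degree q < p},
      monoid.mult = (\<lambda>a b. (a * b) mod AS_modulus p d e l),
      one = 1, zero = 0, add = (+)\<rparr>"

definition Kemb :: "'a::field \<Rightarrow> 'a poly fract poly" where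
  "Kemb c = [:Fract [:c:] 1:]"

definition xfun :: "'a::field poly fract poly" where
  "xfun = [:Fract [:0, 1:] 1:]"

definition yfun :: "'a::field poly fract poly" where
  "yfun = [:0, 1:]"

definition K_iso :: "('a::field poly fract poly) ring \<Rightarrow> ('a poly fract poly) ring
    \<Rightarrow> ('a poly fract poly \<Rightarrow> 'a poly fract poly) set" where
  "K_iso F1 F2 = {\<phi>. \<phi> \<in> ring_iso F1 F2 \<and> (\<forall>c. \<phi> (Kemb c) = Kemb c)}"

definition curves_isomorphic :: "('a::field poly fract poly) ring \<Rightarrow> ('a poly fract poly) ring \<Rightarrow> bool" where
  "curves_isomorphic F1 F2 \<longleftrightarrow> K_iso F1 F2 \<noteq> {}"

text \<open>Aut(Z): K-automorphisms of K(Z), taken extensional so that the set is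
  in bijection with the actual automorphism group.\<close>
definition AutK :: "('a::field poly fract poly) ring \<Rightarrow> ('a poly fract poly \<Rightarrow> 'a poly fract poly) set" where
  "AutK F = {\<sigma> \<in> K_iso F F. \<sigma> \<in> extensional (carrier F)}"

text \<open>Places of F/K, identified with their valuation rings.\<close>
definition is_place :: "('a::field poly fract poly) ring \<Rightarrow> 'a poly fract poly set \<Rightarrow> bool" where
  "is_place F V \<longleftrightarrow> subring V F \<and> V \<noteq> carrier F \<and> range Kemb \<subseteq> V \<and>
     (\<forall>z \<in> carrier F. z \<notin> V \<longrightarrow> (\<exists>w \<in> V. z \<otimes>\<^bsub>F\<^esub> w = \<one>\<^bsub>F\<^esub>))"

text \<open>A place V is a pole of z iff z is not in its valuation ring.
  Aut(F) fixes the (unique) common pole P_infinity of x and y.\<close>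
definition fixes_common_pole_xy :: "('a::field poly fract poly) ring \<Rightarrow> bool" where
  "fixes_common_pole_xy F \<longleftrightarrow>
     (\<forall>\<sigma> \<in> AutK F. \<forall>V. is_place F V \<and> xfun \<notin> V \<and> yfun \<notin> V \<longrightarrow> \<sigma> ` V = V)"

end

theory Submission
  imports Defs "HOL-Computational_Algebra.Formal_Laurent_Series"
begin

text \<open>After translating \<open>x\<close> and \<open>y\<close> the curve is \<open>Y^p - Y = X^3 + E X\<close>, which is
  isomorphic to \<open>Y^p - Y = X^3\<close> if \<open>E = 0\<close>. Expanding at the common pole of \<open>X\<close> and \<open>Y\<close> embeds the function field into the
  field of Laurent series, where \<open>X\<close> and \<open>Y\<close> have orders \<open>-p\<close> and \<open>-3\<close>; the other places are centred at the
  points \<open>(\<alpha>, \<eta>)\<close> of the affine curve, with \<open>X - \<alpha>\<close> as a local parameter.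

  An automorphism \<open>\<sigma>\<close> that fixes the place at infinity sends \<open>Y\<close> to \<open>c Y + b\<close> and \<open>X\<close> to \<open>a X + h(Y)\<close>, because these
  are the functions with poles of order at most \<open>3\<close> and \<open>p\<close> there, and the equation of the curve leaves only
  \<open>h = 0\<close>, \<open>c = a^3\<close>, \<open>c^(p-1) = 1\<close>, \<open>b^p = b\<close>, \<open>E (a^2 - 1) = 0\<close>. If \<open>\<sigma>\<close> moves the place at infinity to \<open>(\<alpha>, \<eta>)\<close>, then
  \<open>(X - \<alpha>)^3 \<sigma>(Y)\<close> is a polynomial in \<open>X\<close> and \<open>Y\<close> of bounded degree that vanishes to order 3 at the conjugate
  points \<open>(\<alpha>, \<eta> + i)\<close>. Interpolation modulo \<open>(X - \<alpha>)^3\<close> forces \<open>Y\<close> to be constant up to order 3 at the point,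
  hence \<open>\<alpha> = 0\<close> and \<open>E = 0\<close>. With \<open>u = Y - \<eta>\<close> the functions \<open>u \<sigma>(Y)\<close> and \<open>u^k \<sigma>(X)\<close>, \<open>k = \<lceil>p/3\<rceil>\<close>, have poles only at
  infinity, which determines \<open>\<sigma>\<close> and is possible only for \<open>p \<equiv> 2\<close> modulo 3.\<close>

section \<open>Evaluation of polynomials in Laurent series and order bounds\<close>

unbundle fps_syntax

text \<open>Orders of poles take the place of Riemann-Roch. Since p and 3 are coprime, the terms
  a(X) Y^i with i < p have distinct orders at infinity and nothing cancels: a bound on the order of
  an element bounds each of its terms. In addition, a function regular at all affine points has
  polynomial coefficients, because the p conjugates of an expansion differ by elements of the prime
  field, which are units. Together these determine all functions of small pole order, and with them
  the images of the coordinates.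

  Finite places are not classified. The image of the place at infinity is known only through its
  centre, and the pole of \<sigma>(Y) is located by excluding all other centres.

  The order in the exceptional case has a group behind it: if E = 0 and p is 2 modulo 3, the
  automorphisms act on Y as the full PGL(2,p), of order p(p-1)(p+1), and the kernel consists of the
  three maps X -> aX with a^3 = 1. The congruence enters because the substitution needs a power of Y
  - \<eta> whose cube is (Y - \<eta>)^(p+1).\<close>

definition unital_hom :: "('a::comm_ring_1 \<Rightarrow> 'b::comm_ring_1) \<Rightarrow> bool" where
  "unital_hom h \<longleftrightarrow> h 0 = 0 \<and> h 1 = 1 \<and> (\<forall>a b. h (a + b) = h a + h b) \<and> (\<forall>a b. h (a * b) = h a * h b)"

definition heval :: "('a::comm_ring_1 \<Rightarrow> 'b::comm_ring_1) \<Rightarrow> 'b \<Rightarrow> 'a poly \<Rightarrow> 'b" where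
  "heval h y q = poly (map_poly h q) y"

lemma heval_0 [simp]: "heval h y 0 = 0"
  by (simp add: heval_def)

lemma heval_pCons:
  assumes "unital_hom h"
  shows "heval h y (pCons a q) = h a + y * heval h y q"
  using assms by (cases "a = 0 \<and> q = 0") (auto simp: heval_def map_poly_pCons unital_hom_def)

lemma heval_const: "unital_hom h \<Longrightarrow> heval h y [:a:] = h a"
  by (simp add: heval_pCons)

lemma heval_1: "unital_hom h \<Longrightarrow> heval h y 1 = 1"
  using heval_const[of h y 1] by (simp add: unital_hom_def one_pCons)

lemma heval_add:
  assumes "unital_hom h"
  shows "heval h y (q + r) = heval h y q + heval h y r"
  using assms
  by (induction q r rule: poly_induct2)
     (auto simp: heval_pCons[OF assms] algebra_simps unital_hom_def)

lemma heval_smult: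
  assumes "unital_hom h"
  shows "heval h y (smult a q) = h a * heval h y q"
  using assms
  by (induction q) (auto simp: heval_pCons[OF assms] algebra_simps unital_hom_def)

lemma heval_mult:
  assumes "unital_hom h"
  shows "heval h y (q * r) = heval h y q * heval h y r"
proof (induction q)
  case (pCons a q)
  have h0: "h 0 = 0" using assms by (simp add: unital_hom_def)
  show ?case
    using pCons.IH by (simp add: heval_add[OF assms] heval_smult[OF assms] heval_pCons[OF assms] h0 algebra_simps)
qed simp

lemma unital_hom_heval: "unital_hom h \<Longrightarrow> unital_hom (heval h y)"
  by (simp add: unital_hom_def[of "heval h y"] heval_add heval_mult heval_1)

lemma unital_hom_uminus:
  assumes "unital_hom h" shows "h (- a) = - h a"
proof -
  have "h (a + - a) = h a + h (- a)" using assms unfolding unital_hom_def by blast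
  then show ?thesis using assms by (simp add: unital_hom_def eq_neg_iff_add_eq_0 add.commute)
qed

lemma unital_hom_diff:
  assumes "unital_hom h" shows "h (a - b) = h a - h b"
proof -
  have "h (a + - b) = h a + h (- b)" using assms unfolding unital_hom_def by blast
  then show ?thesis using unital_hom_uminus[OF assms] by simp
qed

lemma unital_hom_power:
  assumes "unital_hom h" shows "h (a ^ n) = h a ^ n"
  using assms by (induction n) (auto simp: unital_hom_def)

lemma heval_eq_sum:
  assumes "unital_hom h" "degree q < n"
  shows "heval h y q = (\<Sum>i<n. h (coeff q i) * y ^ i)"
proof -
  have h0: "h 0 = 0" using assms by (simp add: unital_hom_def)
  have "heval h y q = (\<Sum>i\<le>degree (map_poly h q). coeff (map_poly h q) i * y ^ i)"
    by (simp add: heval_def poly_altdef)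
  also have "\<dots> = (\<Sum>i<n. coeff (map_poly h q) i * y ^ i)"
  proof (rule sum.mono_neutral_left)
    show "{..degree (map_poly h q)} \<subseteq> {..<n}"
      using map_poly_degree_leq[of h q] assms(2) by auto
    show "\<forall>i\<in>{..<n} - {..degree (map_poly h q)}. coeff (map_poly h q) i * y ^ i = 0"
      by (auto simp: coeff_eq_0)
  qed simp
  finally show ?thesis by (simp add: coeff_map_poly h0)
qed

lemma unital_hom_fls_const: "unital_hom (fls_const :: 'a::comm_ring_1 \<Rightarrow> 'a fls)"
  by (simp add: unital_hom_def fls_plus_const)

abbreviation peval :: "'a::field fls \<Rightarrow> 'a poly \<Rightarrow> 'a fls" where
  "peval \<equiv> heval fls_const"

lemmas peval_pCons = heval_pCons[OF unital_hom_fls_const]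
lemmas peval_const = heval_const[OF unital_hom_fls_const]
lemmas peval_1 = heval_1[OF unital_hom_fls_const]
lemmas peval_add = heval_add[OF unital_hom_fls_const]
lemmas peval_mult = heval_mult[OF unital_hom_fls_const]
lemmas peval_diff = unital_hom_diff[OF unital_hom_heval[OF unital_hom_fls_const]]
lemmas peval_power = unital_hom_power[OF unital_hom_heval[OF unital_hom_fls_const]]
lemmas peval_eq_sum = heval_eq_sum[OF unital_hom_fls_const]

lemma linear_factor:
  assumes "alg_closed_field TYPE('a::field)" "degree (b :: 'a poly) > 0"
  obtains a c where "b = [:-a, 1:] * c" "degree b = Suc (degree c)" "poly b a = 0"
proof -
  obtain a where a: "poly b a = 0"
    using assms by (auto simp: alg_closed_field_def)
  then obtain c where c: "b = [:-a, 1:] * c" by (auto simp: poly_eq_0_iff_dvd elim: dvdE)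
  have "c \<noteq> 0" using c assms(2) by auto
  then have "degree b = Suc (degree c)" using c by (simp add: degree_mult_eq del: mult_pCons_left)
  then show ?thesis using that c a by blast
qed

definition nonconst :: "'a::field fls \<Rightarrow> bool" where
  "nonconst X \<longleftrightarrow> (\<forall>c. X \<noteq> fls_const c)"

text \<open>Over an algebraically closed field a nonconstant series is transcendental: the
  polynomial splits, and no factor \<open>X - fls_const a\<close> vanishes.\<close>

lemma peval_nonzero:
  assumes alg: "alg_closed_field TYPE('a::field)" and X: "nonconst (X :: 'a fls)"
  shows "b \<noteq> 0 \<Longrightarrow> peval X b \<noteq> 0"
proof (induction "degree b" arbitrary: b)
  case 0
  then obtain c where "b = [:c:]" by (metis degree_eq_zeroE)
  then show ?case using 0 by (simp add: peval_const)
next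
  case (Suc n)
  obtain a c where c: "b = [:-a, 1:] * c" "degree b = Suc (degree c)"
    using linear_factor[OF alg, of b] Suc by (metis zero_less_Suc)
  have "c \<noteq> 0" using c(1) Suc.prems by auto
  then have "peval X c \<noteq> 0" using Suc.hyps c(2) by auto
  moreover have "X - fls_const a \<noteq> 0" using X by (auto simp: nonconst_def)
  ultimately show ?case by (simp add: c(1) peval_mult peval_pCons del: mult_pCons_left)
qed

text \<open>A fraction has no canonical numerator, so one is chosen; for nonconstant
  \<open>X\<close> the value does not depend on the choice (\<open>frac_eval_Fract\<close>).\<close>

definition frac_eval :: "'a::field fls \<Rightarrow> 'a poly fract \<Rightarrow> 'a fls" where
  "frac_eval X r = (let (a, b) = (SOME (a, b). b \<noteq> 0 \<and> r = Fract a b) in peval X a / peval X b)"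

lemma frac_eval_Fract:
  assumes alg: "alg_closed_field TYPE('a::field)" and X: "nonconst (X :: 'a fls)" and b: "b \<noteq> 0"
  shows "frac_eval X (Fract a b) = peval X a / peval X b"
proof -
  define ab where "ab = (SOME (a', b'). b' \<noteq> 0 \<and> Fract a b = Fract a' b')"
  have "case ab of (a', b') \<Rightarrow> b' \<noteq> 0 \<and> Fract a b = Fract a' b'"
    unfolding ab_def by (rule someI[of _ "(a, b)"]) (use b in simp)
  then obtain a' b' where ab: "ab = (a', b')" "b' \<noteq> 0" "Fract a b = Fract a' b'" by auto
  have "a * b' = a' * b" using ab b by (simp add: eq_fract)
  then have "peval X a * peval X b' = peval X a' * peval X b"
    by (metis peval_mult)
  moreover have "frac_eval X (Fract a b) = peval X a' / peval X b'"
    unfolding frac_eval_def ab_def[symmetric] by (simp add: ab(1))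
  ultimately show ?thesis
    using peval_nonzero[OF alg X ab(2)] peval_nonzero[OF alg X b] by (simp add: frac_eq_eq)
qed

lemma unital_hom_frac_eval:
  assumes alg: "alg_closed_field TYPE('a::field)" and X: "nonconst (X :: 'a fls)"
  shows "unital_hom (frac_eval X)"
  unfolding unital_hom_def
proof (intro conjI allI)
  note F = frac_eval_Fract[OF alg X] and nz = peval_nonzero[OF alg X]
  show "frac_eval X 0 = 0" "frac_eval X 1 = 1"
    by (simp_all add: Zero_fract_def One_fract_def F peval_1)
  fix r s :: "'a poly fract"
  obtain a b c d where rs: "r = Fract a b" "s = Fract c d" "b \<noteq> 0" "d \<noteq> 0"
    by (metis Fract_cases)
  show "frac_eval X (r + s) = frac_eval X r + frac_eval X s"
    using rs by (simp add: F peval_add peval_mult nz field_simps)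
  show "frac_eval X (r * s) = frac_eval X r * frac_eval X s"
    using rs by (simp add: F peval_mult nz)
qed

abbreviation curve_eval :: "'a::field fls \<Rightarrow> 'a fls \<Rightarrow> 'a poly fract poly \<Rightarrow> 'a fls" where
  "curve_eval X \<equiv> heval (frac_eval X)"

text \<open>Coefficientwise, because \<open>fls_subdegree 0 = 0\<close> would make zero an
  exception: here zero satisfies every bound and sums need no case split.\<close>

definition ord_ge :: "int \<Rightarrow> 'a::field fls \<Rightarrow> bool" where
  "ord_ge k z \<longleftrightarrow> (\<forall>i<k. z $$ i = 0)"

lemma ord_ge_iff: "ord_ge k z \<longleftrightarrow> z = 0 \<or> k \<le> fls_subdegree z"
proof
  assume "ord_ge k z"
  then show "z = 0 \<or> k \<le> fls_subdegree z"
    unfolding ord_ge_def using fls_subdegree_geI by blast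
qed (auto simp: ord_ge_def)

lemma ord_ge_0 [simp]: "ord_ge k 0" by (simp add: ord_ge_def)
lemma ord_ge_1 [simp]: "ord_ge 0 1" by (simp add: ord_ge_def)
lemma ord_ge_const [simp]: "ord_ge 0 (fls_const c)" by (simp add: ord_ge_def)
lemma ord_ge_fps [simp]: "ord_ge 0 (fps_to_fls f)" by (simp add: ord_ge_def)

lemma ord_ge_add: "ord_ge k x \<Longrightarrow> ord_ge k y \<Longrightarrow> ord_ge k (x + y)" by (simp add: ord_ge_def)
lemma ord_ge_diff: "ord_ge k x \<Longrightarrow> ord_ge k y \<Longrightarrow> ord_ge k (x - y)" by (simp add: ord_ge_def)
lemma ord_ge_uminus: "ord_ge k x \<Longrightarrow> ord_ge k (- x)" by (simp add: ord_ge_def)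
lemma ord_ge_mono: "ord_ge k x \<Longrightarrow> j \<le> k \<Longrightarrow> ord_ge j x" by (simp add: ord_ge_def)

lemma ord_ge_mult: "ord_ge k x \<Longrightarrow> ord_ge j y \<Longrightarrow> ord_ge (k + j) (x * y)"
  by (cases "x = 0 \<or> y = 0") (auto simp: ord_ge_iff)

lemma ord_ge_mult_left: "ord_ge 0 x \<Longrightarrow> ord_ge k y \<Longrightarrow> ord_ge k (x * y)"
  using ord_ge_mult[of 0 x k y] by simp

lemma ord_ge_power: "ord_ge k x \<Longrightarrow> ord_ge (int n * k) (x ^ n)"
  by (induction n) (auto simp: algebra_simps intro: ord_ge_mult)

lemma ord_ge_power0: "ord_ge 0 x \<Longrightarrow> ord_ge 0 (x ^ n)"
  using ord_ge_power[of 0 x n] by simp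

lemma ord_ge_inverse:
  assumes "\<not> ord_ge k x" shows "ord_ge (1 - k) (inverse x)"
  using assms by (auto simp: ord_ge_iff)

lemma ord_ge_cancel: "t \<noteq> 0 \<Longrightarrow> ord_ge k (z * t) \<Longrightarrow> ord_ge (k - fls_subdegree t) z"
  by (cases "z = 0") (auto simp: ord_ge_iff)

text \<open>The nonzero terms have pairwise distinct orders, so the term of lowest order survives in
  the sum and bounds all the others.\<close>

lemma ord_ge_sum_distinct:
  assumes "finite I"
    and "\<And>i j. i \<in> I \<Longrightarrow> j \<in> I \<Longrightarrow> g i \<noteq> 0 \<Longrightarrow> g j \<noteq> 0 \<Longrightarrow> fls_subdegree (g i) = fls_subdegree (g j) \<Longrightarrow> i = j"
    and "ord_ge k (\<Sum>i\<in>I. g i)" and "i \<in> I"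
  shows "ord_ge k (g i)"
proof (rule ccontr)
  assume neg: "\<not> ord_ge k (g i)"
  define J where "J = {i \<in> I. g i \<noteq> 0}"
  have iJ: "i \<in> J" using neg assms(4) by (auto simp: J_def)
  have fJ: "finite J" using assms(1) by (simp add: J_def)
  define m where "m = arg_min_on (\<lambda>i. fls_subdegree (g i)) J"
  have m: "m \<in> J" "\<And>j. j \<in> J \<Longrightarrow> fls_subdegree (g m) \<le> fls_subdegree (g j)"
    unfolding m_def by (rule arg_min_if_finite(1)[OF fJ], use iJ in blast)
      (rule arg_min_least[OF fJ], use iJ in blast)
  let ?n = "fls_subdegree (g m)"
  have lt: "?n < k" using m(2)[OF iJ] neg by (auto simp: ord_ge_iff)
  have "(\<Sum>i\<in>I. g i) $$ ?n = (\<Sum>i\<in>I. g i $$ ?n)"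
    using assms(1) by (induction I) auto
  also have "\<dots> = (\<Sum>i\<in>I. if i = m then g m $$ ?n else 0)"
  proof (rule sum.cong[OF refl])
    fix j assume j: "j \<in> I"
    show "g j $$ ?n = (if j = m then g m $$ ?n else 0)"
    proof (cases "g j = 0 \<or> j = m")
      case False
      then have "j \<in> J" using j by (simp add: J_def)
      then have "?n < fls_subdegree (g j)"
        using m assms(2)[of j m] j False by (fastforce simp: J_def)
      then show ?thesis using False by simp
    qed auto
  qed
  also have "\<dots> = g m $$ ?n" using m assms(1) by (simp add: J_def)
  finally have "(\<Sum>i\<in>I. g i) $$ ?n \<noteq> 0" using m(1) by (simp add: J_def)
  then show False using assms(3) lt by (simp add: ord_ge_def)
qed

text \<open>Newton interpolation over the valuation ring: differences of nodes are units, so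
  dividing \<open>B\<close> minus its value at a node by the linear factor costs no order.\<close>

lemma ord_ge_coeffs_by_interpolation:
  fixes S :: "'a::field fls set"
  assumes "finite S" "\<forall>a\<in>S. ord_ge 0 a" "\<forall>a\<in>S. \<forall>b\<in>S. a \<noteq> b \<longrightarrow> ord_ge 0 (inverse (a - b))"
    and "degree B < card S" "\<forall>a\<in>S. ord_ge k (poly B a)"
  shows "ord_ge k (coeff B j)"
  using assms
proof (induction S arbitrary: B j rule: finite_induct)
  case (insert a S)
  show ?case
  proof (cases "degree B = 0")
    case True
    then obtain c where "B = [:c:]" by (metis degree_eq_zeroE)
    then show ?thesis using insert.prems by (cases j) auto
  next
    case False
    let ?B = "synthetic_div B a"
    have B: "B = [:-a, 1:] * ?B + [:poly B a:]" by (simp only: synthetic_div_correct')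
    have IH: "ord_ge k (coeff ?B j)" for j
    proof (rule insert.IH)
      show "degree ?B < card S"
        using False insert by (simp add: degree_synthetic_div)
      show "\<forall>b\<in>S. ord_ge k (poly ?B b)"
      proof
        fix b assume b: "b \<in> S"
        then have ab: "b \<noteq> a" using insert.hyps by auto
        have "poly B b = (b - a) * poly ?B b + poly B a"
          by (subst B) (simp add: algebra_simps)
        then have "poly ?B b = inverse (b - a) * (poly B b - poly B a)"
          using ab by (simp add: field_simps)
        then show "ord_ge k (poly ?B b)"
          using insert.prems b ab by (auto intro!: ord_ge_mult_left ord_ge_diff)
      qed
    qed (use insert.prems in auto)
    have "coeff B j = - (a * coeff ?B j) + coeff (pCons 0 ?B) j + coeff [:poly B a:] j"
      by (subst B) simp
    moreover have "ord_ge k (coeff (pCons 0 ?B) j)" "ord_ge k (coeff [:poly B a:] j)"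
      using IH insert.prems by (auto simp: coeff_pCons split: nat.splits)
    moreover have "ord_ge k (- (a * coeff ?B j))"
      using IH insert.prems by (auto intro!: ord_ge_uminus ord_ge_mult_left)
    ultimately show ?thesis by (simp only: ord_ge_add)
  qed
qed simp

section \<open>Hensel lifting and separable polynomials\<close>

lemma poly_taylor2:
  fixes P :: "'a::idom poly"
  shows "\<exists>c. poly P (u + h) = poly P u + h * poly (pderiv P) u + h\<^sup>2 * c"
proof (induction P)
  case (pCons a P)
  then obtain c where c: "poly P (u + h) = poly P u + h * poly (pderiv P) u + h\<^sup>2 * c" by blast
  show ?case
    by (rule exI[of _ "poly (pderiv P) u + u * c + h * c"])
       (simp only: poly_pCons c pderiv_pCons poly_add, simp add: algebra_simps power2_eq_square)
qed simp

lemma fps_hensel: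
  fixes P :: "'a::field fps poly"
  assumes root: "poly P (fps_const a0) $ 0 = 0" and simple: "poly (pderiv P) (fps_const a0) $ 0 \<noteq> 0"
  obtains a where "a $ 0 = a0" "poly P a = 0"
proof -
  \<comment> \<open>Constant terms depend only on constant terms, which keeps the derivative a unit
    at every approximation.\<close>
  have cong0: "poly Q u $ 0 = poly Q v $ 0" if "u $ 0 = v $ 0" for Q and u v :: "'a fps"
    using that by (induction Q) auto
  define good where "good n a \<longleftrightarrow> a $ 0 = a0 \<and> (\<forall>i\<le>n. poly P a $ i = 0)" for n :: nat and a
  have step: "\<exists>b. good (Suc n) b \<and> (\<forall>i\<le>n. b $ i = a $ i)" if "good n a" for n a
  proof -
    \<comment> \<open>Newton correction. It starts in degree \<open>Suc n\<close>, so its square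
      does not disturb the coefficients up to that degree.\<close>
    define h where "h = fps_const (- (poly P a $ Suc n) / (poly (pderiv P) a $ 0)) * fps_X ^ Suc n"
    have nz: "poly (pderiv P) a $ 0 \<noteq> 0"
      using simple cong0[of a "fps_const a0"] that by (simp add: good_def)
    obtain c where c: "poly P (a + h) = poly P a + h * poly (pderiv P) a + h\<^sup>2 * c"
      using poly_taylor2 by blast
    have h0: "h $ i = 0" if "i \<le> n" for i using that by (simp add: h_def fps_X_power_nth del: power_Suc)
    have hp: "(h * q) $ i = (if i = Suc n then h $ Suc n * q $ 0 else 0)" if "i \<le> Suc n" for i q
      using that by (simp add: h_def mult.assoc fps_X_power_mult_nth del: power_Suc)
    have "poly P (a + h) $ i = 0" if i: "i \<le> Suc n" for i
    proof -
      have "(h\<^sup>2 * c) $ i = (h * (h * c)) $ i" by (simp add: power2_eq_square mult.assoc)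
      also have "\<dots> = 0" using hp[OF i, of "h * c"] h0[of 0] by simp
      finally have "poly P (a + h) $ i = poly P a $ i + (if i = Suc n then h $ Suc n * poly (pderiv P) a $ 0 else 0)"
        using hp[OF i, of "poly (pderiv P) a"] c by simp
      also have "\<dots> = 0"
      proof (cases "i = Suc n")
        case True
        have "h $ Suc n = - (poly P a $ Suc n) / (poly (pderiv P) a $ 0)"
          by (simp add: h_def fps_X_power_nth del: power_Suc)
        then show ?thesis using True nz by simp
      next
        case False
        then show ?thesis using \<open>good n a\<close> i by (simp add: good_def)
      qed
      finally show ?thesis .
    qed
    then have "good (Suc n) (a + h)" using h0[of 0] \<open>good n a\<close> by (simp add: good_def)
    then show ?thesis using h0 by (intro exI[of _ "a + h"]) simp
  qed
  have "good 0 (fps_const a0)" using root by (simp add: good_def)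
  then have "\<exists>s. \<forall>n. good n (s n) \<and> (\<forall>i\<le>n. s (Suc n) $ i = s n $ i)"
    by (intro dependent_nat_choice step) blast
  then obtain s where s: "\<And>n. good n (s n)" "\<And>n i. i \<le> n \<Longrightarrow> s (Suc n) $ i = s n $ i" by blast
  have stable: "s m $ i = s n $ i" if "n \<le> m" "i \<le> n" for m n i
    using that by (induction rule: dec_induct) (auto simp: s(2))
  \<comment> \<open>Each approximation keeps the earlier coefficients, so the diagonal is the
    limit.\<close>
  define a where "a = Abs_fps (\<lambda>n. s n $ n)"
  have an: "a $ i = s n $ i" if "i \<le> n" for i n using stable[OF that, of i] by (simp add: a_def)
  have "poly P a $ n = 0" for n
  proof -
    define h where "h = a - s n"
    have h0: "h $ i = 0" if "i \<le> n" for i using an that by (simp add: h_def)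
    have hq: "(h * q) $ n = 0" for q by (simp add: fps_mult_nth h0)
    obtain c where c: "poly P (s n + h) = poly P (s n) + h * poly (pderiv P) (s n) + h\<^sup>2 * c"
      using poly_taylor2 by blast
    have "poly P a = poly P (s n) + h * (poly (pderiv P) (s n) + h * c)"
      using c by (simp add: h_def power2_eq_square algebra_simps)
    then show ?thesis using s(1)[of n] by (simp add: hq good_def)
  qed
  then have "poly P a = 0" by (simp add: fps_eq_iff)
  moreover have "a $ 0 = a0" using s(1)[of 0] by (simp add: a_def good_def)
  ultimately show ?thesis using that by blast
qed

lemma card_roots_separable:
  assumes alg: "alg_closed_field TYPE('a::field)"
  shows "(q :: 'a poly) \<noteq> 0 \<Longrightarrow> \<forall>x. poly q x = 0 \<longrightarrow> poly (pderiv q) x \<noteq> 0 \<Longrightarrow> card {x. poly q x = 0} = degree q"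
proof (induction "degree q" arbitrary: q)
  case 0
  then obtain c where "q = [:c:]" "c \<noteq> 0" by (metis degree_eq_zeroE pCons_0_0)
  then show ?case by simp
next
  case (Suc n)
  obtain a r where r: "q = [:-a, 1:] * r" "degree q = Suc (degree r)" "poly q a = 0"
    using linear_factor[OF alg, of q] Suc by (metis zero_less_Suc)
  have r0: "r \<noteq> 0" using r Suc by auto
  have d: "poly (pderiv q) x = poly r x + (x - a) * poly (pderiv r) x" for x
    unfolding r(1) by (subst pderiv_mult) (simp add: pderiv_pCons algebra_simps)
  have ra: "poly r a \<noteq> 0" using Suc.prems r(3) d[of a] by auto
  have "{x. poly q x = 0} = insert a {x. poly r x = 0}" by (auto simp: r(1))
  moreover have "card {x. poly r x = 0} = degree r"
  proof (rule Suc.hyps)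
    show "\<forall>x. poly r x = 0 \<longrightarrow> poly (pderiv r) x \<noteq> 0"
      using Suc.prems(2) d by (auto simp: r(1))
  qed (use r Suc r0 in auto)
  ultimately show ?case using ra r(2) poly_roots_finite[OF r0] by simp
qed

section \<open>Function fields of Artin-Schreier curves inside Laurent series\<close>

text \<open>An expansion of the coordinates at infinity, taken as data;
  \<open>normal_AS_exists\<close> and \<open>AS_embedding_normalize\<close> provide it. The orders
  reflect p ord(Y) = 3 ord(X).\<close>

locale AS_embedding =
  fixes p :: nat and d e l :: "'a::field" and X Y :: "'a fls"
  assumes alg: "alg_closed_field TYPE('a)"
    and prime_p: "Factorial_Ring.prime p" and p_ge: "p \<ge> 5" and char_p: "CHAR('a) = p"
    and curve_eq: "Y ^ p - Y = X ^ 3 + fls_const d * X ^ 2 + fls_const e * X + fls_const l"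
    and subdegree_X: "fls_subdegree X = - int p" and subdegree_Y: "fls_subdegree Y = - 3"
begin

text \<open>One notion for three uses: the expansion at infinity, the expansions at affine points,
  and the images of the coordinates under automorphisms. Nonconstancy makes
  \<open>frac_eval X'\<close> a homomorphism.\<close>

definition on_curve :: "'a fls \<Rightarrow> 'a fls \<Rightarrow> bool" where
  "on_curve X' Y' \<longleftrightarrow> nonconst X' \<and>
     Y' ^ p - Y' = X' ^ 3 + fls_const d * X' ^ 2 + fls_const e * X' + fls_const l"

lemma nonconst_X: "nonconst X"
  using subdegree_X p_ge by (auto simp: nonconst_def)

lemma X_nz: "X \<noteq> 0" and Y_nz: "Y \<noteq> 0"
  using subdegree_X subdegree_Y p_ge by auto

lemma on_curve_XY: "on_curve X Y"
  using nonconst_X curve_eq by (simp add: on_curve_def)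

lemma hom_ev: "nonconst (X' :: 'a fls) \<Longrightarrow> unital_hom (curve_eval X' Y')"
  by (intro unital_hom_heval unital_hom_frac_eval alg)

lemma frac_eval_poly: "nonconst (X' :: 'a fls) \<Longrightarrow> frac_eval X' (Fract a 1) = peval X' a"
  by (simp add: frac_eval_Fract[OF alg] peval_1)

lemma ev_const: "nonconst (X' :: 'a fls) \<Longrightarrow> curve_eval X' Y' [:r:] = frac_eval X' r"
  by (simp add: heval_const unital_hom_frac_eval[OF alg])

lemma ev_Kemb: "nonconst (X' :: 'a fls) \<Longrightarrow> curve_eval X' Y' (Kemb c) = fls_const c"
  by (simp add: Kemb_def ev_const frac_eval_poly peval_const)

lemma ev_xfun: "nonconst (X' :: 'a fls) \<Longrightarrow> curve_eval X' Y' xfun = X'"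
  by (simp add: xfun_def ev_const frac_eval_poly peval_pCons)

lemma ev_yfun:
  assumes "nonconst (X' :: 'a fls)" shows "curve_eval X' Y' yfun = Y'"
proof -
  note h = unital_hom_frac_eval[OF alg assms]
  then show ?thesis by (simp add: yfun_def heval_pCons[OF h]) (simp add: unital_hom_def)
qed

lemma ev_modulus:
  assumes "on_curve X' Y'" shows "curve_eval X' Y' (AS_modulus p d e l) = 0"
proof -
  have nc: "nonconst X'" using assms by (simp add: on_curve_def)
  note h = hom_ev[OF nc]
  have "AS_modulus p d e l = yfun ^ p - yfun - [:cubic_rf d e l:]"
    by (simp add: AS_modulus_def yfun_def monom_altdef)
  then have "curve_eval X' Y' (AS_modulus p d e l) = Y' ^ p - Y' - frac_eval X' (cubic_rf d e l)"
    by (simp add: unital_hom_diff[OF h] unital_hom_power[OF h] ev_yfun[OF nc] ev_const[OF nc])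
  also have "frac_eval X' (cubic_rf d e l) = X' ^ 3 + fls_const d * X' ^ 2 + fls_const e * X' + fls_const l"
    by (simp add: cubic_rf_def frac_eval_poly[OF nc] peval_pCons power2_eq_square power3_eq_cube algebra_simps)
  finally show ?thesis using assms by (simp add: on_curve_def)
qed

lemma degree_modulus: "degree (AS_modulus p d e l) = p"
proof -
  have "AS_modulus p d e l = monom 1 p + (- [:0, 1:] - [:cubic_rf d e l:])"
    by (simp add: AS_modulus_def)
  moreover have "degree (- [:0, 1:] - [:cubic_rf d e l:]) < degree (monom (1 :: 'a poly fract) p)"
    using p_ge by (simp add: degree_monom_eq)
  ultimately show ?thesis by (metis degree_add_eq_left degree_monom_eq one_neq_zero)
qed

lemma modulus_nz: "AS_modulus p d e l \<noteq> 0"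
  using degree_modulus p_ge by auto

lemma ev_mod:
  assumes "on_curve X' Y'"
  shows "curve_eval X' Y' (q mod AS_modulus p d e l) = curve_eval X' Y' q"
proof -
  have nc: "nonconst X'" using assms by (simp add: on_curve_def)
  note h = hom_ev[OF nc, of Y']
  have "curve_eval X' Y' (q div AS_modulus p d e l * AS_modulus p d e l + q mod AS_modulus p d e l)
    = curve_eval X' Y' (q div AS_modulus p d e l) * curve_eval X' Y' (AS_modulus p d e l)
      + curve_eval X' Y' (q mod AS_modulus p d e l)"
    using h unfolding unital_hom_def by metis
  then show ?thesis using ev_modulus[OF assms] by simp
qed

lemma degree_mod_less: "degree (q mod AS_modulus p d e l) < p"
  using degree_mod_less[OF modulus_nz, of q] degree_modulus p_ge by auto

lemma subdegree_peval:
  "b \<noteq> 0 \<Longrightarrow> fls_subdegree (peval X b) = - int p * int (degree b)"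
proof (induction "degree b" arbitrary: b)
  case 0
  then obtain c where "b = [:c:]" by (metis degree_eq_zeroE)
  then show ?case by (simp add: peval_const)
next
  case (Suc n)
  obtain a c where c: "b = [:-a, 1:] * c" "degree b = Suc (degree c)"
    using linear_factor[OF alg, of b] Suc by (metis zero_less_Suc)
  have c0: "c \<noteq> 0" using c(1) Suc.prems by auto
  have s: "fls_subdegree (X - fls_const a) = - int p"
  proof (cases "a = 0")
    case False
    then show ?thesis using fls_subdegree_diff_eq1[of X "fls_const a"] subdegree_X p_ge X_nz by simp
  qed (simp add: subdegree_X)
  have "X - fls_const a \<noteq> 0" using s p_ge by auto
  moreover have "peval X b = (X - fls_const a) * peval X c"
    by (simp add: c(1) peval_mult peval_pCons del: mult_pCons_left)
  ultimately have "fls_subdegree (peval X b) = - int p + fls_subdegree (peval X c)"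
    using s peval_nonzero[OF alg nonconst_X c0] by simp
  then show ?case
    using Suc.hyps(1)[of c] Suc.hyps(2) c(2) c0 by (simp add: algebra_simps)
qed

lemma subdegree_frac_eval:
  assumes "b \<noteq> 0" "a \<noteq> 0"
  shows "fls_subdegree (frac_eval X (Fract a b)) = int p * (int (degree b) - int (degree a))"
  using assms peval_nonzero[OF alg nonconst_X]
  by (simp add: frac_eval_Fract[OF alg nonconst_X] fls_divide_subdegree subdegree_peval algebra_simps)

lemma frac_eval_eq_0_iff: "frac_eval X r = 0 \<longleftrightarrow> r = 0"
proof
  assume r: "frac_eval X r = 0"
  obtain a b where ab: "r = Fract a b" "b \<noteq> 0" by (metis Fract_cases)
  then have "peval X a = 0 \<or> peval X b = 0"
    using r by (simp add: frac_eval_Fract[OF alg nonconst_X])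
  then have "a = 0" using peval_nonzero[OF alg nonconst_X] ab(2) by blast
  then show "r = 0" using ab by (simp add: Zero_fract_def eq_fract)
qed (use unital_hom_frac_eval[OF alg nonconst_X] in \<open>simp add: unital_hom_def\<close>)

text \<open>The order of a nonzero term is -3i modulo p, and 3 is invertible modulo p, so the terms
  with i < p have distinct orders. This also yields injectivity of evaluation without first proving
  the modulus irreducible.\<close>

lemma ord_ge_terms:
  assumes "degree q < p" "ord_ge k (curve_eval X Y q)" "i < p"
  shows "ord_ge k (frac_eval X (coeff q i) * Y ^ i)"
proof (rule ord_ge_sum_distinct[where I = "{..<p}" and g = "\<lambda>i. frac_eval X (coeff q i) * Y ^ i"])
  show "ord_ge k (\<Sum>i<p. frac_eval X (coeff q i) * Y ^ i)"
    using assms(1,2) by (simp add: heval_eq_sum[OF unital_hom_frac_eval[OF alg nonconst_X]])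
  fix i j assume ij: "i \<in> {..<p}" "j \<in> {..<p}" "frac_eval X (coeff q i) * Y ^ i \<noteq> 0" "frac_eval X (coeff q j) * Y ^ j \<noteq> 0"
    and eq: "fls_subdegree (frac_eval X (coeff q i) * Y ^ i) = fls_subdegree (frac_eval X (coeff q j) * Y ^ j)"
  have *: "\<exists>n. fls_subdegree (frac_eval X (coeff q i) * Y ^ i) = int p * n - 3 * int i"
    if "frac_eval X (coeff q i) * Y ^ i \<noteq> 0" for i
  proof -
    obtain a b where ab: "coeff q i = Fract a b" "b \<noteq> 0" by (metis Fract_cases)
    have "a \<noteq> 0" using that ab by (auto simp: frac_eval_eq_0_iff Zero_fract_def eq_fract)
    then show ?thesis using subdegree_frac_eval[OF ab(2)] that ab(1)
      by (auto simp: fls_subdegree_pow subdegree_Y)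
  qed
  obtain m n where "int p * m - 3 * int i = int p * n - 3 * int j"
    using *[OF ij(3)] *[OF ij(4)] eq by metis
  then have "int p * (m - n) = 3 * (int i - int j)" by (simp add: algebra_simps)
  then have dvd: "int p dvd 3 * (int i - int j)" by (metis dvd_triv_left)
  have "coprime (int p) 3"
  proof -
    have "\<not> p dvd 3" using p_ge by (auto dest: dvd_imp_le)
    then have "coprime p 3" using prime_p prime_imp_coprime by blast
    then show ?thesis by (metis coprime_int_iff of_nat_numeral)
  qed
  then have "int p dvd int i - int j" using dvd coprime_dvd_mult_right_iff by blast
  moreover have "\<bar>int i - int j\<bar> < int p" using ij by auto
  ultimately have "int i - int j = 0"
    using zdvd_imp_le[of "int p" "\<bar>int i - int j\<bar>"] by (cases "int i - int j = 0") auto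
  then show "i = j" by simp
qed (use assms in auto)

lemma ev_inj:
  assumes "degree q < p" "curve_eval X Y q = 0" shows "q = 0"
proof -
  have "coeff q i = 0" for i
  proof (cases "i < p")
    case True
    let ?t = "frac_eval X (coeff q i) * Y ^ i"
    \<comment> \<open>The sum is zero and so meets every bound, even one beyond the order of the
      term itself.\<close>
    have "ord_ge (fls_subdegree ?t + 1) ?t"
      by (rule ord_ge_terms) (use assms True in auto)
    then have "?t = 0" by (simp add: ord_ge_iff)
    then show ?thesis using Y_nz by (simp add: frac_eval_eq_0_iff)
  qed (use assms in \<open>simp add: coeff_eq_0\<close>)
  then show ?thesis by (simp add: poly_eq_iff)
qed

definition F :: "'a fls set" where "F = range (curve_eval X Y)"

lemma F_const [simp]: "fls_const c \<in> F"
  unfolding F_def using ev_Kemb[OF nonconst_X, of Y c] by (metis rangeI)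

lemma F_0 [simp]: "0 \<in> F" and F_1 [simp]: "1 \<in> F"
  using F_const[of 0] F_const[of 1] by simp_all

lemma F_X [simp]: "X \<in> F" and F_Y [simp]: "Y \<in> F"
  unfolding F_def using ev_xfun[OF nonconst_X, of Y] ev_yfun[OF nonconst_X, of Y] by (metis rangeI)+

lemma F_frac [simp]: "frac_eval X r \<in> F"
  unfolding F_def using ev_const[OF nonconst_X, of Y r] by (metis rangeI)

lemma F_add: "x \<in> F \<Longrightarrow> y \<in> F \<Longrightarrow> x + y \<in> F"
  unfolding F_def by (auto simp flip: heval_add[OF unital_hom_frac_eval[OF alg nonconst_X]])

lemma F_mult: "x \<in> F \<Longrightarrow> y \<in> F \<Longrightarrow> x * y \<in> F"
  unfolding F_def by (auto simp flip: heval_mult[OF unital_hom_frac_eval[OF alg nonconst_X]])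

lemma F_uminus: "x \<in> F \<Longrightarrow> - x \<in> F"
  using F_mult[OF F_const[of "-1"], of x] by simp

lemma F_diff: "x \<in> F \<Longrightarrow> y \<in> F \<Longrightarrow> x - y \<in> F"
  using F_add[of x "- y"] F_uminus by simp

lemma F_power: "x \<in> F \<Longrightarrow> x ^ n \<in> F"
  by (induction n) (auto intro: F_mult)

lemma F_rep:
  assumes "z \<in> F" obtains q where "degree q < p" "z = curve_eval X Y q"
  using assms ev_mod[OF on_curve_XY] degree_mod_less unfolding F_def by (metis imageE)

lemma F_peval [simp]: "peval X a \<in> F"
  using F_frac[of "Fract a 1"] frac_eval_poly[OF nonconst_X] by simp

text \<open>Euclidean descent on the degree: dividing the modulus by a representative of \<open>z\<close> expresses
  \<open>1 / z\<close> through the inverse of an element with a representative of smaller degree.\<close>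
lemma F_inverse:
  assumes "z \<in> F" shows "inverse z \<in> F"
proof -
  note h = hom_ev[OF nonconst_X, of Y]
  have "inverse (curve_eval X Y q) \<in> F" if "degree q < p" for q
    using that
  proof (induction "degree q" arbitrary: q rule: less_induct)
    case less
    show ?case
    proof (cases "degree q = 0")
      case True
      then obtain r where r: "q = [:r:]" by (metis degree_eq_zeroE)
      obtain a b where ab: "r = Fract a b" "b \<noteq> 0" by (metis Fract_cases)
      have "inverse (curve_eval X Y q) = peval X b / peval X a"
        by (simp add: r ev_const[OF nonconst_X] ab frac_eval_Fract[OF alg nonconst_X])
      also have "\<dots> \<in> F"
      proof (cases "a = 0")
        case False
        then show ?thesis using F_frac[of "Fract b a"] by (simp add: frac_eval_Fract[OF alg nonconst_X])
      qed simp
      finally show ?thesis .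
    next
      case False
      let ?m = "AS_modulus p d e l"
      define s t where "s = ?m div q" and "t = ?m mod q"
      have q0: "q \<noteq> 0" using False by auto
      have m: "?m = q * s + t" by (simp add: s_def t_def mult.commute)
      have ev0: "curve_eval X Y q * curve_eval X Y s + curve_eval X Y t = 0"
        using ev_modulus[OF on_curve_XY] h unfolding m unital_hom_def by metis
      have evq: "curve_eval X Y q \<noteq> 0" using ev_inj less.prems q0 by blast
      \<comment> \<open>A zero remainder would split the modulus into two factors of degree below p,
        one of which would evaluate to zero, against \<open>ev_inj\<close>.\<close>
      have t0: "t \<noteq> 0"
      proof
        assume t: "t = 0"
        then have "s \<noteq> 0" using m modulus_nz by auto
        moreover have "degree ?m = degree q + degree s" using m t q0 calculation by (simp add: degree_mult_eq)
        ultimately have "curve_eval X Y s \<noteq> 0" using ev_inj[of s] False degree_modulus by auto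
        then show False using ev0 t evq by simp
      qed
      have dt: "degree t < degree q" using degree_mod_less'[of q ?m] q0 t0 by (simp add: t_def)
      have inv: "inverse (curve_eval X Y t) \<in> F" using less dt by simp
      have evt: "curve_eval X Y t \<noteq> 0" using ev_inj[of t] dt less.prems t0 by auto
      have "curve_eval X Y t = - (curve_eval X Y q * curve_eval X Y s)" using ev0 by (simp add: eq_neg_iff_add_eq_0 add.commute)
      then have "inverse (curve_eval X Y q) = - (curve_eval X Y s * inverse (curve_eval X Y t))"
        using evq evt by (simp add: field_simps)
      moreover have "curve_eval X Y s \<in> F" by (simp add: F_def)
      ultimately show ?thesis using inv F_mult F_uminus by simp
    qed
  qed
  then show ?thesis using assms F_rep by metis
qed

lemma F_divide: "x \<in> F \<Longrightarrow> y \<in> F \<Longrightarrow> x / y \<in> F"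
  by (simp add: divide_inverse F_mult F_inverse)

lemmas F_intros = F_add F_mult F_uminus F_diff F_power F_divide F_inverse F_const F_X F_Y F_0 F_1 F_peval

lemma peval_closed:
  assumes "\<And>c. fls_const c \<in> S" "\<And>x y. x \<in> S \<Longrightarrow> y \<in> S \<Longrightarrow> x + y \<in> S" "\<And>x y. x \<in> S \<Longrightarrow> y \<in> S \<Longrightarrow> x * y \<in> S" "x \<in> S"
  shows "peval x a \<in> S"
  using assms(4)
proof (induction a)
  case 0
  show ?case using assms(1)[of 0] by simp
qed (auto simp: peval_pCons intro!: assms)

lemma F_subsetI:
  assumes S: "\<And>x y. x \<in> S \<Longrightarrow> y \<in> S \<Longrightarrow> x + y \<in> S" "\<And>x y. x \<in> S \<Longrightarrow> y \<in> S \<Longrightarrow> x * y \<in> S"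
    "\<And>r. frac_eval X r \<in> S" "Y \<in> S"
  shows "F \<subseteq> S"
proof -
  note h = unital_hom_frac_eval[OF alg nonconst_X]
  have "curve_eval X Y q \<in> S" for q
  proof (induction q)
    case 0
    show ?case using S(3)[of 0] h by (simp add: unital_hom_def)
  qed (simp add: heval_pCons[OF h] S)
  then show ?thesis by (auto simp: F_def)
qed

lemma F_least:
  assumes S: "\<And>c. fls_const c \<in> S" "\<And>x y. x \<in> S \<Longrightarrow> y \<in> S \<Longrightarrow> x + y \<in> S" "\<And>x y. x \<in> S \<Longrightarrow> y \<in> S \<Longrightarrow> x * y \<in> S"
    "\<And>x. x \<in> S \<Longrightarrow> inverse x \<in> S" "X \<in> S" "Y \<in> S"
  shows "F \<subseteq> S"
proof (rule F_subsetI[OF S(2,3)])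
  fix r :: "'a poly fract"
  obtain a b where ab: "r = Fract a b" "b \<noteq> 0" by (metis Fract_cases)
  have "peval X a * inverse (peval X b) \<in> S" by (intro S(3,4) peval_closed S(1,2,5))
  then show "frac_eval X r \<in> S" using ab by (simp add: frac_eval_Fract[OF alg nonconst_X] divide_inverse)
qed (use S in auto)

text \<open>The K-homomorphism on \<open>F\<close> that sends (X, Y) to (X', Y'). Its target is the
  whole Laurent field, so it serves for expansions at affine points as well as for
  automorphisms.\<close>

definition subst :: "'a fls \<Rightarrow> 'a fls \<Rightarrow> 'a fls \<Rightarrow> 'a fls" where
  "subst X' Y' z = curve_eval X' Y' (SOME q. curve_eval X Y q = z)"

context
  fixes X' Y' assumes oc: "on_curve X' Y'"
begin

text \<open>Two representatives of one element differ by a multiple of the modulus, since the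
  remainder of their difference is zero by \<open>ev_inj\<close>, and every point on the curve kills
  the modulus.\<close>

lemma subst_ev: "subst X' Y' (curve_eval X Y q) = curve_eval X' Y' q"
proof -
  have nc: "nonconst X'" using oc by (simp add: on_curve_def)
  define r where "r = (SOME r. curve_eval X Y r = curve_eval X Y q)"
  have "curve_eval X Y r = curve_eval X Y q" unfolding r_def by (rule someI) simp
  then have "curve_eval X Y (r - q) = 0" by (simp add: unital_hom_diff[OF hom_ev[OF nonconst_X]])
  then have "(r - q) mod AS_modulus p d e l = 0"
    using ev_mod[OF on_curve_XY] degree_mod_less by (metis ev_inj)
  then have "curve_eval X' Y' (r - q) = 0" using ev_mod[OF oc, of "r - q"] by simp
  then show ?thesis by (simp add: subst_def unital_hom_diff[OF hom_ev[OF nc]] flip: r_def)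
qed

lemma subst_X: "subst X' Y' X = X'" and subst_Y: "subst X' Y' Y = Y'" and subst_const: "subst X' Y' (fls_const c) = fls_const c"
  using subst_ev[of xfun] subst_ev[of yfun] subst_ev[of "Kemb c"] oc nonconst_X
  by (simp_all add: ev_xfun ev_yfun ev_Kemb on_curve_def)

lemma subst_add: "x \<in> F \<Longrightarrow> y \<in> F \<Longrightarrow> subst X' Y' (x + y) = subst X' Y' x + subst X' Y' y"
proof -
  assume "x \<in> F" "y \<in> F"
  then obtain q r where q: "x = curve_eval X Y q" "y = curve_eval X Y r" by (auto simp: F_def)
  have nc: "nonconst X'" using oc by (simp add: on_curve_def)
  have "x + y = curve_eval X Y (q + r)" using hom_ev[OF nonconst_X, of Y] q by (simp add: unital_hom_def)
  then show ?thesis using hom_ev[OF nc, of Y'] q by (simp add: subst_ev unital_hom_def)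
qed

lemma subst_mult: "x \<in> F \<Longrightarrow> y \<in> F \<Longrightarrow> subst X' Y' (x * y) = subst X' Y' x * subst X' Y' y"
proof -
  assume "x \<in> F" "y \<in> F"
  then obtain q r where q: "x = curve_eval X Y q" "y = curve_eval X Y r" by (auto simp: F_def)
  have nc: "nonconst X'" using oc by (simp add: on_curve_def)
  have "x * y = curve_eval X Y (q * r)" using hom_ev[OF nonconst_X, of Y] q by (simp add: unital_hom_def)
  then show ?thesis using hom_ev[OF nc, of Y'] q by (simp add: subst_ev unital_hom_def)
qed

lemma subst_0: "subst X' Y' 0 = 0" and subst_1: "subst X' Y' 1 = 1"
  using subst_const[of 0] subst_const[of 1] by simp_all

lemma subst_nz:
  assumes "x \<in> F" "x \<noteq> 0" shows "subst X' Y' x \<noteq> 0"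
proof
  assume "subst X' Y' x = 0"
  then have "subst X' Y' (x * inverse x) = 0" using assms subst_mult[of x "inverse x"] by (simp only: F_inverse mult_zero_left)
  then show False using assms by (simp add: subst_1)
qed

lemma subst_inverse: "x \<in> F \<Longrightarrow> subst X' Y' (inverse x) = inverse (subst X' Y' x)"
proof (cases "x = 0")
  case False
  assume x: "x \<in> F"
  have "subst X' Y' (x * inverse x) = 1" using False by (simp add: subst_1)
  then show ?thesis using x subst_mult[of x "inverse x"] F_inverse inverse_unique by metis
qed (simp add: subst_0)

lemma subst_diff: "x \<in> F \<Longrightarrow> y \<in> F \<Longrightarrow> subst X' Y' (x - y) = subst X' Y' x - subst X' Y' y"
  using subst_add[of "x - y" y] by (simp add: F_diff)

lemma subst_power: "x \<in> F \<Longrightarrow> subst X' Y' (x ^ n) = subst X' Y' x ^ n"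
  by (induction n) (auto simp: subst_1 subst_mult F_power)

lemma subst_inj: "inj_on (subst X' Y') F"
proof (rule inj_onI)
  fix x y assume "x \<in> F" "y \<in> F" "subst X' Y' x = subst X' Y' y"
  then show "x = y" using subst_nz[of "x - y"] by (auto simp: subst_diff F_diff)
qed

end

end

section \<open>Places\<close>

lemma peval_pcompose: "peval x (pcompose h q) = peval (peval x q) h"
  by (induction h) (simp_all add: pcompose_pCons peval_add peval_mult peval_const peval_pCons)

context AS_embedding
begin

definition place :: "'a fls set \<Rightarrow> bool" where
  "place V \<longleftrightarrow> V \<subseteq> F \<and> V \<noteq> F \<and> (\<forall>c. fls_const c \<in> V) \<and>
     (\<forall>x\<in>V. \<forall>y\<in>V. x + y \<in> V \<and> x * y \<in> V) \<and> (\<forall>z\<in>F. z \<notin> V \<longrightarrow> inverse z \<in> V)"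

context
  fixes V assumes pl: "place V"
begin

lemma V_F: "x \<in> V \<Longrightarrow> x \<in> F" using pl by (auto simp: place_def)
lemma V_const: "fls_const c \<in> V" using pl by (simp add: place_def)
lemma V_add: "x \<in> V \<Longrightarrow> y \<in> V \<Longrightarrow> x + y \<in> V" using pl by (simp add: place_def)
lemma V_mult: "x \<in> V \<Longrightarrow> y \<in> V \<Longrightarrow> x * y \<in> V" using pl by (simp add: place_def)
lemma V_inverse: "z \<in> F \<Longrightarrow> z \<notin> V \<Longrightarrow> inverse z \<in> V" using pl by (simp add: place_def)
lemma V_1: "1 \<in> V" using V_const[of 1] by simp
lemma V_0: "0 \<in> V" using V_const[of 0] by simp
lemma V_uminus: "x \<in> V \<Longrightarrow> - x \<in> V" using V_mult[OF V_const[of "-1"], of x] by simp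
lemma V_diff: "x \<in> V \<Longrightarrow> y \<in> V \<Longrightarrow> x - y \<in> V" using V_add[of x "-y"] V_uminus by simp
lemma V_power: "x \<in> V \<Longrightarrow> x ^ n \<in> V" by (induction n) (auto intro: V_mult V_1)
lemma V_sum: "(\<And>i. i \<in> I \<Longrightarrow> g i \<in> V) \<Longrightarrow> sum g I \<in> V"
  by (induction I rule: infinite_finite_induct) (auto intro: V_add V_0)
lemma V_peval: "x \<in> V \<Longrightarrow> peval x a \<in> V"
  by (rule peval_closed) (auto intro: V_const V_add V_mult)

text \<open>Valuation rings are integrally closed: otherwise 1/z would lie in \<open>V\<close>, and
  z = z^n (1/z)^(n-1).\<close>

lemma V_root:
  assumes "z \<in> F" "z ^ n \<in> V" "n > 0" shows "z \<in> V"
proof (rule ccontr)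
  assume z: "z \<notin> V"
  then have "z \<noteq> 0" using V_0 by auto
  obtain m where n: "n = Suc m" using assms(3) by (cases n) auto
  have "z = z ^ n * inverse z ^ m" using \<open>z \<noteq> 0\<close> by (simp add: n field_simps)
  also have "\<dots> \<in> V" by (rule V_mult[OF assms(2) V_power[OF V_inverse[OF assms(1) z]]])
  finally show False using z by simp
qed

text \<open>Used in contraposition to find centres: if P(T) is a nonzero element of the maximal
  ideal, then so is T - a for some root a of P.\<close>

lemma V_inverse_peval:
  assumes T: "T \<in> F"
  shows "P \<noteq> 0 \<Longrightarrow> \<forall>a. poly P a = 0 \<longrightarrow> inverse (T - fls_const a) \<in> V \<Longrightarrow> inverse (peval T P) \<in> V"
proof (induction "degree P" arbitrary: P)
  case 0
  then obtain c where "P = [:c:]" by (metis degree_eq_zeroE)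
  then show ?case using V_const[of "inverse c"] by (simp add: peval_const fls_inverse_const)
next
  case (Suc n)
  obtain a c where c: "P = [:-a, 1:] * c" "degree P = Suc (degree c)" "poly P a = 0"
    using linear_factor[OF alg, of P] Suc by (metis zero_less_Suc)
  have c0: "c \<noteq> 0" using c(1) Suc.prems by auto
  have "inverse (peval T c) \<in> V" using Suc c c0 by auto
  moreover have "peval T P = (T - fls_const a) * peval T c"
    by (simp add: c(1) peval_mult peval_pCons del: mult_pCons_left)
  ultimately show ?case using Suc.prems(2) c(3) V_mult by simp
qed

end

definition V_inf :: "'a fls set" where "V_inf = {z \<in> F. ord_ge 0 z}"

lemma X_notin_V_inf: "X \<notin> V_inf"
  using subdegree_X p_ge X_nz by (auto simp: V_inf_def ord_ge_iff)

lemma place_V_inf: "place V_inf"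
  unfolding place_def
proof (intro conjI allI ballI impI)
  show "V_inf \<noteq> F" using X_notin_V_inf F_X by metis
  fix z assume z: "z \<in> F" "z \<notin> V_inf"
  then have "ord_ge (1 - 0) (inverse z)" by (intro ord_ge_inverse) (simp add: V_inf_def)
  then show "inverse z \<in> V_inf" using z F_inverse ord_ge_mono[of 1 _ 0] by (simp add: V_inf_def)
next
  fix x y assume xy: "x \<in> V_inf" "y \<in> V_inf"
  show "x + y \<in> V_inf" "x * y \<in> V_inf"
    using xy ord_ge_mult[of 0 x 0 y] by (auto simp: V_inf_def intro: ord_ge_add F_add F_mult)
qed (auto simp: V_inf_def)

end

section \<open>Places of the normalised curve\<close>

locale normal_AS = AS_embedding p 0 e 0 X Y for p and e :: "'a::field" and X Y
begin

lemma curve_eq': "Y ^ p - Y = X ^ 3 + fls_const e * X"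
  using curve_eq by simp

lemma Yp: "Y ^ p = X ^ 3 + fls_const e * X + Y"
  using curve_eq' by (simp add: algebra_simps)

lemma on_curve_iff: "on_curve X' Y' \<longleftrightarrow> nonconst X' \<and> Y' ^ p - Y' = X' ^ 3 + fls_const e * X'"
  by (simp add: on_curve_def)

text \<open>The \<open>p\<close>-th power of a monomial \<open>a(X) Y^i\<close> is a rational function of \<open>X\<close> times a power of
  \<open>Y^p / X^3\<close>, which is a unit at every pole of \<open>X\<close>.\<close>
lemma place_at_infinity_unique:
  assumes pl: "place V" and X: "X \<notin> V"
  shows "V = V_inf"
proof -
  have lin: "inverse (X - fls_const a) \<in> V" for a
  proof (rule V_inverse[OF pl])
    show "X - fls_const a \<notin> V"
      using X V_add[OF pl _ V_const[OF pl, of a], of "X - fls_const a"] by auto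
  qed (intro F_intros)
  have invX: "inverse X \<in> V" using lin[of 0] by simp
  \<comment> \<open>Rational functions of \<open>X\<close> without a pole at infinity, by splitting
    one linear factor off the denominator at a time.\<close>
  have frac: "peval X a / peval X b \<in> V" if "b \<noteq> 0" "degree a \<le> degree b" for a b
    using that
  proof (induction "degree b" arbitrary: a b)
    case 0
    then obtain u v where "a = [:u:]" "b = [:v:]" by (metis degree_eq_zeroE le_zero_eq)
    then show ?case using V_const[OF pl, of "u / v"] by (simp add: peval_const fls_const_divide_const)
  next
    case (Suc n)
    obtain \<beta> c where c: "b = [:-\<beta>, 1:] * c" "degree b = Suc (degree c)"
      using linear_factor[OF alg, of b] Suc by (metis zero_less_Suc)
    have c0: "c \<noteq> 0" using c(1) Suc.prems by auto
    let ?a = "synthetic_div a \<beta>"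
    have a: "a = [:-\<beta>, 1:] * ?a + [:poly a \<beta>:]" by (simp only: synthetic_div_correct')
    have nz: "X - fls_const \<beta> \<noteq> 0" using nonconst_X by (auto simp: nonconst_def)
    have pa: "peval X a = (X - fls_const \<beta>) * peval X ?a + fls_const (poly a \<beta>)"
      by (subst a) (simp add: peval_mult peval_add peval_const peval_pCons del: mult_pCons_left)
    have pb: "peval X b = (X - fls_const \<beta>) * peval X c"
      by (simp add: c(1) peval_mult peval_pCons del: mult_pCons_left)
    have "peval X a / peval X b = peval X ?a / peval X c
        + fls_const (poly a \<beta>) * inverse (X - fls_const \<beta>) * (peval X 1 / peval X c)"
      using nz peval_nonzero[OF alg nonconst_X c0] by (simp add: pa pb peval_1 field_simps)
    moreover have "peval X ?a / peval X c \<in> V"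
      by (rule Suc.hyps) (use Suc c c0 in \<open>auto simp: degree_synthetic_div\<close>)
    moreover have "peval X 1 / peval X c \<in> V"
      by (rule Suc.hyps) (use Suc c c0 in auto)
    ultimately show ?case using lin V_const[OF pl] by (simp only: V_add[OF pl] V_mult[OF pl])
  qed
  \<comment> \<open>If only X^3/Y were in \<open>V\<close>, the equation divided by Y would put
    Y^(p-1), hence Y, and so Y/X^3 into \<open>V\<close>.\<close>
  have w: "Y / X ^ 3 \<in> V"
  proof (rule ccontr)
    assume n: "Y / X ^ 3 \<notin> V"
    then have 1: "X ^ 3 / Y \<in> V" using V_inverse[OF pl, of "Y / X ^ 3"] by (simp add: F_intros)
    have "Y ^ (p - 1) = Y ^ p / Y" using p_ge Y_nz by (simp add: power_diff)
    also have "\<dots> = X ^ 3 / Y + fls_const e * (X ^ 3 / Y) * inverse X ^ 2 + 1"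
      using X_nz Y_nz by (simp add: Yp field_simps power2_eq_square power3_eq_cube)
    also have "\<dots> \<in> V" by (intro V_add[OF pl] V_mult[OF pl] V_power[OF pl] V_const[OF pl] V_1[OF pl] 1 invX)
    finally have "Y \<in> V" by (rule V_root[OF pl F_Y]) (use p_ge in auto)
    then have "Y * inverse X ^ 3 \<in> V" by (intro V_mult[OF pl] V_power[OF pl] invX)
    then show False using n by (simp add: field_simps)
  qed
  have "Y ^ p / X ^ 3 = 1 + fls_const e * inverse X ^ 2 + Y / X ^ 3"
    using X_nz by (simp add: Yp field_simps power2_eq_square power3_eq_cube)
  also have "\<dots> \<in> V" by (intro V_add[OF pl] V_mult[OF pl] V_power[OF pl] V_const[OF pl] V_1[OF pl] w invX)
  finally have YX: "Y ^ p / X ^ 3 \<in> V" .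
  have monomial_in_V: "frac_eval X r * Y ^ i \<in> V" if ord: "ord_ge 0 (frac_eval X r * Y ^ i)" for r i
  proof (cases "r = 0")
    case True
    then show ?thesis using frac_eval_eq_0_iff[of r] V_0[OF pl] by simp
  next
    case False
    obtain a b where ab: "r = Fract a b" "b \<noteq> 0" by (metis Fract_cases)
    have a0: "a \<noteq> 0" using False ab by (auto simp: Zero_fract_def eq_fract)
    have nz: "frac_eval X r * Y ^ i \<noteq> 0" using False Y_nz by (simp add: frac_eval_eq_0_iff)
    have "0 \<le> fls_subdegree (frac_eval X r * Y ^ i)" using ord nz unfolding ord_ge_iff by blast
    also have "\<dots> = int p * (int (degree b) - int (degree a)) - 3 * int i"
      using nz subdegree_frac_eval[OF ab(2) a0] by (simp add: ab fls_subdegree_pow subdegree_Y)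
    finally have "int (p * degree a + 3 * i) \<le> int (p * degree b)" by (simp add: algebra_simps)
    then have "p * degree a + 3 * i \<le> p * degree b" by (simp only: of_nat_le_iff)
    \<comment> \<open>The bound on the order at infinity is exactly what gives this fraction a
      numerator of no larger degree than its denominator.\<close>
    then have deg: "degree (a ^ p * [:0, 1:] ^ (3 * i)) \<le> degree (b ^ p)"
      using a0 by (simp add: degree_mult_eq degree_power_eq ab(2) mult.commute)
    have "peval X (a ^ p * [:0, 1:] ^ (3 * i)) / peval X (b ^ p) \<in> V"
      by (rule frac) (use deg ab in auto)
    also have "peval X (a ^ p * [:0, 1:] ^ (3 * i)) / peval X (b ^ p) = frac_eval X r ^ p * X ^ (3 * i)"
      by (simp add: ab frac_eval_Fract[OF alg nonconst_X] peval_mult peval_power peval_pCons power_divide)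
    finally have "frac_eval X r ^ p * X ^ (3 * i) * (Y ^ p / X ^ 3) ^ i \<in> V"
      using YX by (rule V_mult[OF pl _ V_power[OF pl]])
    also have "frac_eval X r ^ p * X ^ (3 * i) * (Y ^ p / X ^ 3) ^ i = (frac_eval X r * Y ^ i) ^ p"
      using X_nz by (simp add: power_divide power_mult_distrib mult.commute flip: power_mult)
    finally show ?thesis by (rule V_root[OF pl, rotated]) (use p_ge in \<open>auto intro!: F_intros F_frac\<close>)
  qed
  have sub: "V_inf \<subseteq> V"
  proof
    fix z assume z: "z \<in> V_inf"
    then obtain q where q: "degree q < p" "z = curve_eval X Y q" using F_rep by (auto simp: V_inf_def)
    have "z = (\<Sum>i<p. frac_eval X (coeff q i) * Y ^ i)"
      using q by (simp add: heval_eq_sum[OF unital_hom_frac_eval[OF alg nonconst_X]])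
    also have "\<dots> \<in> V"
      using ord_ge_terms[OF q(1)] z q(2) by (intro V_sum[OF pl] monomial_in_V) (auto simp: V_inf_def)
    finally show "z \<in> V" .
  qed
  \<comment> \<open>The reverse inclusion is maximality: an element of \<open>V\<close> with a pole
    at infinity has powers that absorb any pole, so \<open>V\<close> would be all of
    \<open>F\<close>.\<close>
  have "z \<in> V_inf" if z: "z \<in> V" for z
  proof (rule ccontr)
    assume n: "z \<notin> V_inf"
    have zF: "z \<in> F" using z V_F[OF pl] by simp
    then have no: "\<not> ord_ge 0 z" using n by (simp add: V_inf_def)
    then have zs: "z \<noteq> 0" "fls_subdegree z \<le> -1" by (auto simp: ord_ge_iff)
    have "w \<in> V" if w: "w \<in> F" for w
    proof -
      define n where "n = nat \<bar>fls_subdegree w\<bar>"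
      have "ord_ge 1 (inverse z)" using ord_ge_inverse[OF no] by simp
      then have "ord_ge (int n * 1) (inverse z ^ n)" by (rule ord_ge_power)
      moreover have "ord_ge (fls_subdegree w) w" by (simp add: ord_ge_iff)
      ultimately have "ord_ge (fls_subdegree w + int n * 1) (w * inverse z ^ n)" by (intro ord_ge_mult)
      then have "ord_ge 0 (w * inverse z ^ n)" by (rule ord_ge_mono) (simp add: n_def)
      moreover have "w * inverse z ^ n \<in> F" by (intro F_mult F_power F_inverse w zF)
      ultimately have "w * inverse z ^ n \<in> V" using sub unfolding V_inf_def by blast
      then have "w * inverse z ^ n * z ^ n \<in> V" by (rule V_mult[OF pl _ V_power[OF pl z]])
      moreover have "w * inverse z ^ n * z ^ n = w"
        using zs(1) by (simp add: mult.assoc flip: power_mult_distrib)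
      ultimately show ?thesis by simp
    qed
    then show False using pl unfolding place_def by blast
  qed
  then show ?thesis using sub by blast
qed

text \<open>\<open>Y\<close> is integral over K[X]: were 1/Y in \<open>V\<close> and
  \<open>Y\<close> not, the equation divided by Y^(p-1) would put \<open>Y\<close> into
  \<open>V\<close> after all.\<close>

lemma Y_in_place:
  assumes pl: "place V" and X: "X \<in> V" shows "Y \<in> V"
proof (rule ccontr)
  assume n: "Y \<notin> V"
  then have i: "inverse Y \<in> V" using V_inverse[OF pl] by simp
  obtain m where m: "p = Suc (Suc m)" using p_ge by (intro that[of "p - 2"]) simp
  have "Y = Y ^ p * inverse Y ^ (p - 1)"
    using Y_nz by (simp add: m field_simps)
  also have "\<dots> = (X ^ 3 + fls_const e * X) * inverse Y ^ (p - 1) + Y * inverse Y ^ (p - 1)"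
    by (simp add: Yp algebra_simps)
  also have "Y * inverse Y ^ (p - 1) = inverse Y ^ (p - 2)"
    using Y_nz by (simp add: m field_simps)
  also have "(X ^ 3 + fls_const e * X) * inverse Y ^ (p - 1) + inverse Y ^ (p - 2) \<in> V"
    by (intro V_add[OF pl] V_mult[OF pl] V_power[OF pl] V_const[OF pl] X i)
  finally show False using n by simp
qed

text \<open>\<open>inverse z \<notin> V\<close> expresses that z is a nonzero element of the maximal
  ideal, as \<open>inverse 0 = 0\<close> lies in \<open>V\<close>. A centre exists because otherwise
  all X - \<alpha> would be units and \<open>V\<close> would contain K(X) and
  \<open>Y\<close>.\<close>

lemma finite_place_center:
  assumes pl: "place V" and X: "X \<in> V"
  obtains \<alpha> \<eta> where "inverse (X - fls_const \<alpha>) \<notin> V" "inverse (Y - fls_const \<eta>) \<notin> V"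
    "\<eta> ^ p - \<eta> = \<alpha> ^ 3 + e * \<alpha>"
proof -
  have "\<exists>\<alpha>. inverse (X - fls_const \<alpha>) \<notin> V"
  proof (rule ccontr)
    assume n: "\<nexists>\<alpha>. inverse (X - fls_const \<alpha>) \<notin> V"
    have "frac_eval X r \<in> V" for r
    proof -
      obtain a b where ab: "r = Fract a b" "b \<noteq> 0" by (metis Fract_cases)
      have "inverse (peval X b) \<in> V" using V_inverse_peval[OF pl F_X ab(2)] n by blast
      then show ?thesis
        using V_peval[OF pl X] V_mult[OF pl] by (simp add: ab frac_eval_Fract[OF alg nonconst_X] divide_inverse)
    qed
    then have "F \<subseteq> V" by (intro F_subsetI V_add[OF pl] V_mult[OF pl] Y_in_place[OF pl X])
    then show False using pl by (auto simp: place_def)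
  qed
  then obtain \<alpha> where \<alpha>: "inverse (X - fls_const \<alpha>) \<notin> V" by blast
  define c where "c = \<alpha> ^ 3 + e * \<alpha>"
  define P where "P = [:0, 1:] ^ p - [:c, 1:]"
  have "degree P = p"
    using p_ge degree_add_eq_left[of "- [:c, 1:]" "[:0, 1:] ^ p"]
    by (simp add: P_def degree_power_eq diff_conv_add_uminus del: add_uminus_conv_diff)
  then have P0: "P \<noteq> 0" using p_ge by auto
  \<comment> \<open>The cubic minus its value at \<alpha> is divisible by X - \<alpha>, which puts
    P(Y) into the maximal ideal.\<close>
  have evP: "peval Y P = (X - fls_const \<alpha>) * (X ^ 2 + fls_const \<alpha> * X + fls_const (\<alpha> ^ 2) + fls_const e)"
  proof -
    have "peval Y P = Y ^ p - Y - fls_const c" by (simp add: P_def peval_diff peval_power peval_pCons)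
    also have "\<dots> = X ^ 3 + fls_const e * X - (fls_const \<alpha> ^ 3 + fls_const e * fls_const \<alpha>)"
      by (simp add: c_def curve_eq' fls_const_power flip: fls_plus_const)
    finally show ?thesis by (simp add: algebra_simps power2_eq_square power3_eq_cube fls_const_power)
  qed
  have "inverse (peval Y P) \<notin> V"
  proof
    assume i: "inverse (peval Y P) \<in> V"
    define h where "h = X ^ 2 + fls_const \<alpha> * X + fls_const (\<alpha> ^ 2) + fls_const e"
    have h: "h \<in> V" unfolding h_def by (intro V_add[OF pl] V_mult[OF pl] V_power[OF pl] V_const[OF pl] X)
    have "peval Y P \<noteq> 0" by (rule peval_nonzero[OF alg _ P0]) (use subdegree_Y in \<open>auto simp: nonconst_def\<close>)
    then have "h * inverse (peval Y P) = inverse (X - fls_const \<alpha>)"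
      unfolding evP h_def[symmetric] by simp
    then show False using \<alpha> V_mult[OF pl h i] by simp
  qed
  then obtain \<eta> where "poly P \<eta> = 0" "inverse (Y - fls_const \<eta>) \<notin> V"
    using V_inverse_peval[OF pl F_Y P0] by blast
  then show ?thesis using that[OF \<alpha>] by (simp add: P_def c_def algebra_simps)
qed

end

section \<open>Points of the affine curve and regular functions\<close>

context AS_embedding
begin

lemma fls_freshman: "((x :: 'a fls) + y) ^ p = x ^ p + y ^ p"
  by (rule freshmans_dream) (use prime_p char_p in simp_all)

lemma fps_freshman: "((x :: 'a fps) + y) ^ p = x ^ p + y ^ p"
  by (rule freshmans_dream) (use prime_p char_p in simp_all)

lemma of_nat_p: "of_nat p = (0 :: 'a)" "of_nat p = (0 :: 'a fps)" "of_nat p = (0 :: 'a fls)"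
  by (simp_all add: of_nat_eq_0_iff_char_dvd char_p)

lemma three_nz: "(3 :: 'a) \<noteq> 0"
proof -
  have "\<not> p dvd 3" using p_ge by (auto dest: dvd_imp_le)
  then show ?thesis using of_nat_eq_0_iff_char_dvd[of 3, where 'a = 'a] by (simp add: char_p)
qed

text \<open>These elements form the prime field; as roots of T^p - T they are simple, because its
  derivative is -1.\<close>

lemma card_Frobenius_fixed: "card {i :: 'a. i ^ p = i} = p"
proof -
  define q :: "'a poly" where "q = [:0, 1:] ^ p + - [:0, 1:]"
  have deg: "degree q = p"
    using p_ge degree_add_eq_left[of "- [:0, 1:]" "[:0, 1::'a:] ^ p"] by (simp add: q_def degree_power_eq)
  have ev: "poly q x = x ^ p - x" for x by (simp add: q_def)
  have "pderiv q = -1"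
    by (simp add: q_def pderiv_add pderiv_minus pderiv_power pderiv_pCons of_nat_p one_pCons flip: smult_conv_map_poly)
  then have "card {x. poly q x = 0} = degree q"
    using deg p_ge by (intro card_roots_separable[OF alg]) auto
  then show ?thesis using deg by (simp add: ev)
qed

end

context normal_AS
begin

definition xi :: "'a \<Rightarrow> 'a fls" where "xi \<alpha> = fls_const \<alpha> + fls_X"

text \<open>\<psi> is the expansion of \<open>Y\<close> in the local parameter X - \<alpha>; its
  constant term is the ordinate of the point.\<close>

definition curve_point :: "'a \<Rightarrow> 'a fps \<Rightarrow> bool" where
  "curve_point \<alpha> \<psi> \<longleftrightarrow> \<psi> ^ p - \<psi> = (fps_const \<alpha> + fps_X) ^ 3 + fps_const e * (fps_const \<alpha> + fps_X)"

lemma nonconst_xi: "nonconst (xi \<alpha>)"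
proof -
  have "xi \<alpha> $$ 1 \<noteq> fls_const c $$ 1" for c by (simp add: xi_def)
  then show ?thesis unfolding nonconst_def by metis
qed

lemma ord_ge_X: "ord_ge 1 (fls_X :: 'a fls)" by (auto simp: ord_ge_def)
lemma ord_ge_xi: "ord_ge 0 (xi \<alpha>)" by (auto simp: ord_ge_def xi_def)

lemma on_curve_point:
  assumes "curve_point \<alpha> \<psi>" shows "on_curve (xi \<alpha>) (fps_to_fls \<psi>)"
proof -
  have x: "fps_to_fls (fps_const \<alpha> + fps_X) = xi \<alpha>"
    by (simp add: xi_def)
  have "fps_to_fls (\<psi> ^ p - \<psi>) = fps_to_fls ((fps_const \<alpha> + fps_X) ^ 3 + fps_const e * (fps_const \<alpha> + fps_X))"
    using assms by (simp add: curve_point_def)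
  then show ?thesis
    by (simp add: on_curve_iff nonconst_xi fps_to_fls_power fls_times_fps_to_fls x del: fps_to_fls_plus add: fps_to_fls_plus[of "_ ^ _"])
qed

text \<open>As a polynomial in Y the equation has derivative -1, so Hensel lifting applies at every
  affine point: the x-coordinate is unramified there.\<close>

lemma curve_point_exists:
  assumes "\<eta> ^ p - \<eta> = \<alpha> ^ 3 + e * \<alpha>"
  obtains \<psi> where "curve_point \<alpha> \<psi>" "\<psi> $ 0 = \<eta>"
proof -
  define f :: "'a fps" where "f = (fps_const \<alpha> + fps_X) ^ 3 + fps_const e * (fps_const \<alpha> + fps_X)"
  define P where "P = [:0, 1:] ^ p + - [:f, 1:]"
  have ev: "poly P s = s ^ p - s - f" for s by (simp add: P_def)
  have f0: "f $ 0 = \<alpha> ^ 3 + e * \<alpha>" by (simp add: f_def fps_power_zeroth)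
  have "pderiv P = -1"
    by (simp add: P_def pderiv_add pderiv_minus pderiv_power pderiv_pCons of_nat_p one_pCons)
  then obtain \<psi> where "\<psi> $ 0 = \<eta>" "poly P \<psi> = 0"
    using fps_hensel[of P \<eta>] assms by (auto simp: ev f0 fps_power_zeroth)
  then show ?thesis using that[of \<psi>] by (simp add: curve_point_def ev f_def)
qed

lemma curve_point_shift:
  assumes "curve_point \<alpha> \<psi>" "i ^ p = i" shows "curve_point \<alpha> (\<psi> + fps_const i)"
  using assms by (simp add: curve_point_def fps_freshman fps_const_power)

text \<open>\<psi>^p has no terms in degrees 1 to p-1, so in these degrees \<psi> is minus the cubic
  side of the equation.\<close>

lemma curve_point_coeffs:
  assumes "curve_point \<alpha> \<psi>"
  shows "(\<psi> $ 0) ^ p - \<psi> $ 0 = \<alpha> ^ 3 + e * \<alpha>" "\<psi> $ 1 = - (3 * \<alpha> ^ 2 + e)" "\<psi> $ 2 = - 3 * \<alpha>"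
proof -
  define r where "r = fps_shift 1 \<psi>"
  have "\<psi> = fps_const (\<psi> $ 0) + fps_X * r"
    by (rule fps_ext) (simp add: r_def fps_X_mult_nth)
  then have "\<psi> ^ p = fps_const (\<psi> $ 0) ^ p + (fps_X * r) ^ p" by (metis fps_freshman)
  then have pw: "\<psi> ^ p = fps_const ((\<psi> $ 0) ^ p) + fps_X ^ p * r ^ p"
    by (simp add: power_mult_distrib fps_const_power)
  have eq: "\<psi> = \<psi> ^ p - ((fps_const \<alpha> + fps_X) ^ 3 + fps_const e * (fps_const \<alpha> + fps_X))"
    using assms by (simp add: curve_point_def algebra_simps)
  have cube: "(fps_const \<alpha> + fps_X) ^ 3 = fps_const (\<alpha> ^ 3) + fps_const (3 * \<alpha> ^ 2) * fps_X
      + fps_const (3 * \<alpha>) * fps_X ^ 2 + fps_X ^ 3"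
  proof -
    have 3: "(3 :: 'a fps) = fps_const 3" by (simp add: numeral_fps_const)
    have "(fps_const \<alpha> + fps_X) ^ 3 = fps_const \<alpha> ^ 3 + 3 * fps_const \<alpha> ^ 2 * fps_X + 3 * fps_const \<alpha> * fps_X ^ 2 + fps_X ^ 3"
      by (simp add: power2_eq_square power3_eq_cube algebra_simps)
    then show ?thesis by (simp add: 3 fps_const_power)
  qed
  have c: "\<psi> $ n = (\<psi> ^ p) $ n - ((fps_const \<alpha> + fps_X) ^ 3 + fps_const e * (fps_const \<alpha> + fps_X)) $ n" for n
    using eq by (metis fps_sub_nth)
  show "\<psi> $ 1 = - (3 * \<alpha> ^ 2 + e)" "\<psi> $ 2 = - 3 * \<alpha>"
    using p_ge by (subst c; simp add: pw fps_X_power_mult_nth cube fps_X_power_nth)+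
  show "(\<psi> $ 0) ^ p - \<psi> $ 0 = \<alpha> ^ 3 + e * \<alpha>"
    using p_ge c[of 0] by (simp add: pw fps_X_power_mult_nth fps_power_zeroth algebra_simps)
qed

abbreviation at_point :: "'a \<Rightarrow> 'a fps \<Rightarrow> 'a fls \<Rightarrow> 'a fls" where
  "at_point \<alpha> \<psi> \<equiv> subst (xi \<alpha>) (fps_to_fls \<psi>)"

definition point_place :: "'a \<Rightarrow> 'a fps \<Rightarrow> 'a fls set" where
  "point_place \<alpha> \<psi> = {z \<in> F. ord_ge 0 (at_point \<alpha> \<psi> z)}"

context
  fixes \<alpha> \<psi> assumes pt: "curve_point \<alpha> \<psi>"
begin

lemmas point_subst = subst_add[OF on_curve_point[OF pt]] subst_mult[OF on_curve_point[OF pt]]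
  subst_diff[OF on_curve_point[OF pt]] subst_inverse[OF on_curve_point[OF pt]] subst_power[OF on_curve_point[OF pt]]
  subst_const[OF on_curve_point[OF pt]] subst_X[OF on_curve_point[OF pt]] subst_Y[OF on_curve_point[OF pt]]

lemma place_point_place: "place (point_place \<alpha> \<psi>)"
  unfolding place_def
proof (intro conjI allI ballI impI)
  have "inverse (X - fls_const \<alpha>) \<in> F" by (intro F_intros)
  moreover have "at_point \<alpha> \<psi> (inverse (X - fls_const \<alpha>)) = inverse fls_X"
    by (simp add: point_subst F_intros) (simp add: xi_def)
  ultimately have "inverse (X - fls_const \<alpha>) \<notin> point_place \<alpha> \<psi>"
    by (simp add: point_place_def ord_ge_iff)
  then show "point_place \<alpha> \<psi> \<noteq> F" using \<open>inverse (X - fls_const \<alpha>) \<in> F\<close> by blast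
  fix z assume z: "z \<in> F" "z \<notin> point_place \<alpha> \<psi>"
  then have "ord_ge (1 - 0) (inverse (at_point \<alpha> \<psi> z))" by (intro ord_ge_inverse) (simp add: point_place_def)
  then show "inverse z \<in> point_place \<alpha> \<psi>"
    using z F_inverse ord_ge_mono[of 1 _ 0] by (simp add: point_place_def point_subst)
next
  fix x y assume "x \<in> point_place \<alpha> \<psi>" "y \<in> point_place \<alpha> \<psi>"
  then show "x + y \<in> point_place \<alpha> \<psi>" "x * y \<in> point_place \<alpha> \<psi>"
    by (auto simp: point_place_def point_subst intro: ord_ge_add ord_ge_mult_left F_add F_mult)
qed (auto simp: point_place_def point_subst)

lemma X_in_point_place: "X \<in> point_place \<alpha> \<psi>"
  by (simp add: point_place_def point_subst ord_ge_xi)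

lemma point_place_center_X:
  assumes "inverse (X - fls_const \<beta>) \<notin> point_place \<alpha> \<psi>" shows "\<beta> = \<alpha>"
proof (rule ccontr)
  assume ne: "\<beta> \<noteq> \<alpha>"
  have "(xi \<alpha> - fls_const \<beta>) $$ 0 \<noteq> 0" using ne by (simp add: xi_def)
  then have "\<not> ord_ge 1 (xi \<alpha> - fls_const \<beta>)" unfolding ord_ge_def by (metis zero_less_one)
  then have "ord_ge (1 - 1) (inverse (xi \<alpha> - fls_const \<beta>))" by (rule ord_ge_inverse)
  then show False using assms by (simp add: point_place_def point_subst F_intros)
qed

lemma point_place_center_Y:
  assumes "inverse (Y - fls_const \<beta>) \<notin> point_place \<alpha> \<psi>" shows "\<beta> = \<psi> $ 0"
proof (rule ccontr)
  assume ne: "\<beta> \<noteq> \<psi> $ 0"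
  have "(fps_to_fls \<psi> - fls_const \<beta>) $$ 0 \<noteq> 0" using ne by simp
  then have "\<not> ord_ge 1 (fps_to_fls \<psi> - fls_const \<beta>)" unfolding ord_ge_def by (metis zero_less_one)
  then have "ord_ge (1 - 1) (inverse (fps_to_fls \<psi> - fls_const \<beta>))" by (rule ord_ge_inverse)
  then show False using assms by (simp add: point_place_def point_subst F_intros)
qed

end

section \<open>Functions regular at all affine points\<close>

lemma ord_ge_peval_xi: "ord_ge 0 (peval (xi \<alpha>) a)"
  by (induction a) (auto simp: peval_pCons intro!: ord_ge_add ord_ge_mult_left ord_ge_xi)

lemma peval_xi_nth_0: "peval (xi \<alpha>) a $$ 0 = poly a \<alpha>"
proof -
  have "peval (xi \<alpha>) a = peval (xi \<alpha>) ([:-\<alpha>, 1:] * synthetic_div a \<alpha> + [:poly a \<alpha>:])"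
    by (simp only: synthetic_div_correct')
  also have "\<dots> = fls_X * peval (xi \<alpha>) (synthetic_div a \<alpha>) + fls_const (poly a \<alpha>)"
    unfolding peval_add peval_mult by (simp add: peval_pCons xi_def)
  finally have "peval (xi \<alpha>) a = fls_X * peval (xi \<alpha>) (synthetic_div a \<alpha>) + fls_const (poly a \<alpha>)" .
  moreover have "(fls_X * peval (xi \<alpha>) (synthetic_div a \<alpha>)) $$ 0 = 0"
    using ord_ge_mult[OF ord_ge_X ord_ge_peval_xi, of \<alpha> "synthetic_div a \<alpha>"] by (simp add: ord_ge_def)
  ultimately show ?thesis by simp
qed

text \<open>Each root of the denominator must cancel against the numerator, or the fraction would
  have a pole there.\<close>

lemma fract_without_poles:
  assumes "\<And>\<alpha>. ord_ge 0 (frac_eval (xi \<alpha>) r)"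
  shows "\<exists>a. r = Fract a 1"
proof -
  have "\<exists>a'. Fract a b = Fract a' 1" if "b \<noteq> 0" "\<And>\<alpha>. ord_ge 0 (frac_eval (xi \<alpha>) (Fract a b))" for a b :: "'a poly"
    using that
  proof (induction "degree b" arbitrary: a b)
    case 0
    then obtain c where c: "b = [:c:]" "c \<noteq> 0" by (metis degree_eq_zeroE pCons_0_0)
    then have "Fract a b = Fract (smult (inverse c) a) 1" by (simp add: eq_fract)
    then show ?case by blast
  next
    case (Suc n)
    obtain \<alpha> c where c: "b = [:-\<alpha>, 1:] * c" "degree b = Suc (degree c)"
      using linear_factor[OF alg, of b] Suc by (metis zero_less_Suc)
    have c0: "c \<noteq> 0" using c(1) Suc.prems by auto
    let ?r = "frac_eval (xi \<alpha>) (Fract a b)"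
    have pb: "peval (xi \<alpha>) b = fls_X * peval (xi \<alpha>) c"
      by (simp add: c(1) peval_mult peval_pCons xi_def del: mult_pCons_left)
    have "peval (xi \<alpha>) a = ?r * (fls_X * peval (xi \<alpha>) c)"
      using peval_nonzero[OF alg nonconst_xi Suc.prems(1), of \<alpha>] unfolding pb[symmetric]
      by (simp add: frac_eval_Fract[OF alg nonconst_xi Suc.prems(1)])
    moreover have "ord_ge (0 + (1 + 0)) (?r * (fls_X * peval (xi \<alpha>) c))"
      by (intro ord_ge_mult Suc.prems(2) ord_ge_X ord_ge_peval_xi)
    ultimately have "poly a \<alpha> = 0" using peval_xi_nth_0[of \<alpha> a] by (simp add: ord_ge_def)
    then obtain a1 where a1: "a = [:-\<alpha>, 1:] * a1" by (auto simp: poly_eq_0_iff_dvd elim: dvdE)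
    have "Fract a b = Fract a1 c"
      unfolding a1 c(1) by (rule mult_fract_cancel) simp
    then show ?case using Suc.hyps(1)[of c a1] Suc.hyps(2) Suc.prems(2) c(2) c0 by simp
  qed
  then show ?thesis using assms by (metis Fract_cases)
qed

text \<open>Regularity is tested only at points with an expansion; this already forces polynomial
  coefficients in \<open>finite_regular_expansion\<close>.\<close>

definition finite_regular :: "'a fls \<Rightarrow> bool" where
  "finite_regular z \<longleftrightarrow> z \<in> F \<and> (\<forall>\<alpha> \<psi>. curve_point \<alpha> \<psi> \<longrightarrow> z \<in> point_place \<alpha> \<psi>)"

definition shifts :: "'a fps \<Rightarrow> 'a fls set" where
  "shifts \<psi> = (\<lambda>i. fps_to_fls \<psi> + fls_const i) ` {i. i ^ p = i}"

text \<open>The nodes are the p conjugates of \<psi> over K(X). Their differences are constants, so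
  interpolation costs no order.\<close>

lemma interpolate_at_shifts:
  fixes \<psi> :: "'a fps"
  assumes "degree B < p" "\<And>i. i ^ p = i \<Longrightarrow> ord_ge k (poly B (fps_to_fls \<psi> + fls_const i))"
  shows "ord_ge k (coeff B j)"
proof (rule ord_ge_coeffs_by_interpolation)
  have "inj_on (\<lambda>i. fps_to_fls \<psi> + fls_const i) {i. i ^ p = i}"
    by (rule inj_onI) (simp, metis fls_const_nth)
  then have card: "card (shifts \<psi>) = p" by (simp add: shifts_def card_image card_Frobenius_fixed)
  then show "finite (shifts \<psi>)" using p_ge by (intro card_ge_0_finite) simp
  show "degree B < card (shifts \<psi>)" using assms card by simp
  show "\<forall>a\<in>shifts \<psi>. ord_ge 0 a" by (auto simp: shifts_def intro: ord_ge_add)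
  show "\<forall>a\<in>shifts \<psi>. ord_ge k (poly B a)" using assms by (auto simp: shifts_def)
  show "\<forall>a\<in>shifts \<psi>. \<forall>b\<in>shifts \<psi>. a \<noteq> b \<longrightarrow> ord_ge 0 (inverse (a - b))"
    by (auto simp: shifts_def fls_minus_const fls_inverse_const)
qed

text \<open>The functions regular on the affine curve form K[X,Y]: the coefficients of the
  representative are interpolated at the p conjugate points above each \<alpha>. The last clause
  reads off pole orders at infinity, where X^i Y^j contributes p i + 3 j.\<close>

lemma finite_regular_expansion:
  assumes "finite_regular z"
  obtains a where "z = (\<Sum>j<p. peval X (a j) * Y ^ j)"
    "\<And>\<alpha> \<psi>. curve_point \<alpha> \<psi> \<Longrightarrow> at_point \<alpha> \<psi> z = (\<Sum>j<p. peval (xi \<alpha>) (a j) * fps_to_fls \<psi> ^ j)"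
    "\<And>N j. ord_ge (- int N) z \<Longrightarrow> j < p \<Longrightarrow> a j \<noteq> 0 \<Longrightarrow> p * degree (a j) + 3 * j \<le> N"
proof -
  obtain q where q: "degree q < p" "z = curve_eval X Y q" using assms F_rep by (auto simp: finite_regular_def)
  have at: "at_point \<alpha> \<psi> z = curve_eval (xi \<alpha>) (fps_to_fls \<psi>) q" if "curve_point \<alpha> \<psi>" for \<alpha> \<psi>
    by (simp add: q(2) subst_ev[OF on_curve_point[OF that]])
  have "\<exists>a. coeff q j = Fract a 1" for j
  proof (rule fract_without_poles)
    fix \<alpha>
    \<comment> \<open>Algebraic closedness supplies one point above \<alpha>; its shifts give all p
      of them.\<close>
    have "degree ([:0, 1::'a:] ^ p + - [:\<alpha> ^ 3 + e * \<alpha>, 1:]) = p"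
      using p_ge degree_add_eq_left[of "- [:\<alpha> ^ 3 + e * \<alpha>, 1:]" "[:0, 1::'a:] ^ p"] by (simp add: degree_power_eq)
    then obtain \<eta> where "poly ([:0, 1:] ^ p + - [:\<alpha> ^ 3 + e * \<alpha>, 1:]) \<eta> = 0"
      using alg p_ge unfolding alg_closed_field_def by (metis gr0I not_numeral_le_zero)
    then have "\<eta> ^ p - \<eta> = \<alpha> ^ 3 + e * \<alpha>" by (simp add: algebra_simps)
    then obtain \<psi> where \<psi>: "curve_point \<alpha> \<psi>" by (rule curve_point_exists)
    have h0: "frac_eval (xi \<alpha>) 0 = 0" using unital_hom_frac_eval[OF alg nonconst_xi] by (simp add: unital_hom_def)
    have "ord_ge 0 (coeff (map_poly (frac_eval (xi \<alpha>)) q) j)"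
    proof (rule interpolate_at_shifts)
      show "degree (map_poly (frac_eval (xi \<alpha>)) q) < p"
        using map_poly_degree_leq[of "frac_eval (xi \<alpha>)" q] q(1) by simp
      fix i :: 'a assume "i ^ p = i"
      then have pt: "curve_point \<alpha> (\<psi> + fps_const i)" using curve_point_shift \<psi> by simp
      then have "ord_ge 0 (at_point \<alpha> (\<psi> + fps_const i) z)"
        using assms unfolding finite_regular_def point_place_def by blast
      then show "ord_ge 0 (poly (map_poly (frac_eval (xi \<alpha>)) q) (fps_to_fls \<psi> + fls_const i))"
        unfolding at[OF pt] by (simp add: heval_def fps_to_fls_plus)
    qed
    then show "ord_ge 0 (frac_eval (xi \<alpha>) (coeff q j))" by (simp add: coeff_map_poly h0)
  qed
  then obtain a where a: "\<And>j. coeff q j = Fract (a j) 1" by metis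
  show ?thesis
  proof (rule that)
    show "z = (\<Sum>j<p. peval X (a j) * Y ^ j)"
      using q heval_eq_sum[OF unital_hom_frac_eval[OF alg nonconst_X] q(1)] by (simp add: a frac_eval_poly[OF nonconst_X])
    show "at_point \<alpha> \<psi> z = (\<Sum>j<p. peval (xi \<alpha>) (a j) * fps_to_fls \<psi> ^ j)" if "curve_point \<alpha> \<psi>" for \<alpha> \<psi>
      using at[OF that] heval_eq_sum[OF unital_hom_frac_eval[OF alg nonconst_xi] q(1)] by (simp add: a frac_eval_poly[OF nonconst_xi])
    fix N j assume N: "ord_ge (- int N) z" and j: "j < p" "a j \<noteq> 0"
    have nz: "peval X (a j) * Y ^ j \<noteq> 0" using peval_nonzero[OF alg nonconst_X j(2)] Y_nz by simp
    have "ord_ge (- int N) (peval X (a j) * Y ^ j)"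
      using ord_ge_terms[OF q(1) _ j(1), of "- int N"] N q(2) by (simp add: a frac_eval_poly[OF nonconst_X])
    then have "- int N \<le> fls_subdegree (peval X (a j) * Y ^ j)" using nz unfolding ord_ge_iff by blast
    also have "\<dots> = - int p * int (degree (a j)) - 3 * int j"
      using nz subdegree_peval[OF j(2)] by (simp add: fls_subdegree_pow subdegree_Y)
    finally have "int (p * degree (a j) + 3 * j) \<le> int N" by simp
    then show "p * degree (a j) + 3 * j \<le> N" by (simp only: of_nat_le_iff)
  qed
qed

text \<open>The bound p + 3 is the pole order of XY. Below it only \<open>X\<close> and powers of
  \<open>Y\<close> occur; X^2 has order 2p, which is larger because p is at least 5.\<close>

lemma finite_regular_small:
  assumes "finite_regular z" "ord_ge (- int N) z" "N < p + 3"
  obtains c h where "z = fls_const c * X + peval Y h" "3 * degree h \<le> N" "N < p \<Longrightarrow> c = 0"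
proof -
  obtain a where a: "z = (\<Sum>j<p. peval X (a j) * Y ^ j)"
    "\<And>j. j < p \<Longrightarrow> a j \<noteq> 0 \<Longrightarrow> p * degree (a j) + 3 * j \<le> N"
    using finite_regular_expansion[OF assms(1)] assms(2) by metis
  define h where "h = (\<Sum>j<p. monom (coeff (a j) 0) j)"
  define c where "c = coeff (a 0) 1"
  have deg0: "degree (a j) = 0" if "j < p" "j \<noteq> 0" for j
  proof (rule ccontr)
    assume n: "degree (a j) \<noteq> 0"
    then have "p * 1 \<le> p * degree (a j)" by (intro mult_le_mono2) simp
    moreover have "a j \<noteq> 0" using n by auto
    ultimately show False using a(2)[of j] that assms(3) by linarith
  qed
  have deg1: "degree (a 0) \<le> 1"
  proof (rule ccontr)
    assume n: "\<not> degree (a 0) \<le> 1"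
    then have "p * 2 \<le> p * degree (a 0)" by (intro mult_le_mono2) simp
    moreover have "a 0 \<noteq> 0" using n by auto
    ultimately show False using a(2)[of 0] p_ge assms(3) by linarith
  qed
  have pX: "peval X (a j) = fls_const (coeff (a j) 0) + (if j = 0 then fls_const c * X else 0)" if "j < p" for j
  proof -
    have "degree (a j) < 2" using deg0[OF that] deg1 by (cases "j = 0") auto
    then have "peval X (a j) = (\<Sum>i<2. fls_const (coeff (a j) i) * X ^ i)" by (rule peval_eq_sum)
    then have "peval X (a j) = fls_const (coeff (a j) 0) + fls_const (coeff (a j) 1) * X"
      by (simp add: numeral_2_eq_2)
    then show ?thesis using deg0[OF that] by (auto simp: c_def coeff_eq_0)
  qed
  have ch: "coeff h i = (if i < p then coeff (a i) 0 else 0)" for i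
    by (simp add: h_def coeff_sum)
  have "degree h < p"
    using p_ge degree_le[of "p - 1" h] by (fastforce simp: ch)
  then have pY: "peval Y h = (\<Sum>j<p. fls_const (coeff (a j) 0) * Y ^ j)"
    by (simp add: peval_eq_sum ch)
  have "z = (\<Sum>j<p. fls_const (coeff (a j) 0) * Y ^ j + (if j = 0 then fls_const c * X else 0))"
    unfolding a(1) by (rule sum.cong) (auto simp: pX algebra_simps)
  also have "\<dots> = fls_const c * X + peval Y h"
    using p_ge by (simp add: sum.distrib pY)
  finally have z: "z = fls_const c * X + peval Y h" .
  have "degree h \<le> N div 3"
  proof (rule degree_le, intro allI impI)
    fix i assume i: "N div 3 < i"
    show "coeff h i = 0"
    proof (rule ccontr)
      assume "coeff h i \<noteq> 0"
      then have "i < p" "a i \<noteq> 0" by (auto simp: ch split: if_splits)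
      then have "3 * i \<le> N" using a(2)[of i] by simp
      then show False using i by simp
    qed
  qed
  moreover have "c = 0" if "N < p"
  proof (rule ccontr)
    assume c: "c \<noteq> 0"
    then have "1 \<le> degree (a 0)" unfolding c_def by (rule le_degree)
    then have "p * 1 \<le> p * degree (a 0)" by (intro mult_le_mono2)
    moreover have "a 0 \<noteq> 0" using c by (auto simp: c_def)
    ultimately show False using a(2)[of 0] p_ge that by linarith
  qed
  ultimately show ?thesis using that[OF z] by simp
qed

end

section \<open>Obstruction to triple poles, and independence of 1, X, X^2\<close>

context normal_AS
begin

text \<open>A polynomial in \<open>Y\<close> of degree below \<open>p\<close> that vanishes to order 3 at all \<open>\<psi> + i\<close> with \<open>i\<close> a nonzero element of
  the prime field is, modulo \<open>t^3\<close>, a multiple of \<open>(Y - \<psi>)^(p-1) - 1 = (\<Sum>j<p. \<psi>^(p-1-j) Y^j) - 1\<close>.\<close>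
lemma triple_pole_imp_flat:
  fixes a :: "nat \<Rightarrow> 'a poly"
  assumes pt: "curve_point \<alpha> \<psi>"
    and deg: "\<And>j. j < p \<Longrightarrow> a j \<noteq> 0 \<Longrightarrow> p * degree (a j) + 3 * j \<le> 3 * p"
    and A: "A = (\<lambda>s. \<Sum>j<p. peval (xi \<alpha>) (a j) * s ^ j)"
    and van: "\<And>i. i ^ p = i \<Longrightarrow> i \<noteq> 0 \<Longrightarrow> ord_ge 3 (A (fps_to_fls \<psi> + fls_const i))"
    and nv: "\<not> ord_ge 3 (A (fps_to_fls \<psi>))"
  shows "\<psi> $ 1 = 0" "\<psi> $ 2 = 0"
proof -
  let ?s = "fps_to_fls \<psi>"
  define C where "C = A ?s"
  define G where "G = (\<Sum>j<p. monom (?s ^ (p - Suc j)) j) - 1"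
  \<comment> \<open>At \<psi> the second summand cancels the value \<open>C\<close> of the first; at
    the other conjugates \<open>G\<close> vanishes. So all coefficients of \<open>B\<close> have
    order at least 3.\<close>
  define B where "B = (\<Sum>j<p. monom (peval (xi \<alpha>) (a j)) j) + smult C G"
  have evG: "poly G x = (\<Sum>j<p. ?s ^ (p - Suc j) * x ^ j) - 1" for x
    by (simp add: G_def poly_sum poly_monom)
  have evB: "poly B x = A x + C * poly G x" for x
    by (simp add: B_def A poly_sum poly_monom)
  have G_s: "poly G ?s = -1"
  proof -
    have "(\<Sum>j<p. ?s ^ (p - Suc j) * ?s ^ j) = (\<Sum>j<p. ?s ^ (p - 1))"
      by (rule sum.cong) (auto simp flip: power_add)
    then show ?thesis by (simp add: evG of_nat_p)
  qed
  have G_i: "poly G (?s + fls_const i) = 0" if "i ^ p = i" "i \<noteq> 0" for i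
  proof -
    have "fls_const i * (\<Sum>j<p. ?s ^ (p - Suc j) * (?s + fls_const i) ^ j) = (?s + fls_const i) ^ p - ?s ^ p"
      using power_diff_sumr2[of "?s + fls_const i" p ?s] by simp
    also have "\<dots> = fls_const i" using that by (simp add: fls_freshman flip: fls_const_power)
    finally have "(\<Sum>j<p. ?s ^ (p - Suc j) * (?s + fls_const i) ^ j) = 1" using that by simp
    then show ?thesis by (simp add: evG)
  qed
  have ordB: "ord_ge 3 (coeff B j)" for j
  proof (rule interpolate_at_shifts)
    have "degree (\<Sum>j<p. monom (peval (xi \<alpha>) (a j)) j) \<le> p - 1"
      by (rule degree_sum_le) (auto intro: order_trans[OF degree_monom_le])
    moreover have "degree (\<Sum>j<p. monom (?s ^ (p - Suc j)) j) \<le> p - 1"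
      by (rule degree_sum_le) (auto intro: order_trans[OF degree_monom_le])
    then have "degree G \<le> p - 1" unfolding G_def by (intro degree_diff_le) auto
    then have "degree (smult C G) \<le> p - 1" by (meson degree_smult_le order_trans)
    ultimately have "degree B \<le> p - 1" unfolding B_def by (rule degree_add_le)
    then show "degree B < p" using p_ge by simp
    fix i :: 'a assume i: "i ^ p = i"
    show "ord_ge 3 (poly B (?s + fls_const i))"
    proof (cases "i = 0")
      case True
      then show ?thesis by (simp add: evB G_s C_def)
    next
      case False
      then show ?thesis using van[OF i] by (simp add: evB G_i[OF i])
    qed
  qed
  have coB: "coeff B j = peval (xi \<alpha>) (a j) + C * ?s ^ (p - Suc j)" if "0 < j" "j < p" for j
    using that by (simp add: B_def G_def coeff_sum one_pCons coeff_pCons split: nat.splits)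
  \<comment> \<open>The degree bound leaves only a constant as top coefficient, so \<open>C\<close>
    is constant modulo t^3.\<close>
  have "degree (a (p - 1)) = 0"
  proof (rule ccontr)
    assume n: "degree (a (p - 1)) \<noteq> 0"
    then have "p * 1 \<le> p * degree (a (p - 1))" by (intro mult_le_mono2) simp
    moreover have "a (p - 1) \<noteq> 0" using n by auto
    ultimately show False using deg[of "p - 1"] p_ge by linarith
  qed
  then obtain c where "a (p - 1) = [:c:]" by (metis degree_eq_zeroE)
  then have Cc: "ord_ge 3 (fls_const c + C)" using ordB[of "p - 1"] p_ge by (simp add: coB peval_const)
  have c0: "c \<noteq> 0" using Cc nv by (auto simp: C_def)
  \<comment> \<open>A term X^2 Y^j has pole order 2p + 3j, which exceeds 3p for these j; so the
    coefficient is at most linear in t.\<close>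
  have nth2: "peval (xi \<alpha>) (a j) $$ 2 = 0" if "j = p - 2 \<or> j = p - 3" for j
  proof -
    have "degree (a j) < 2"
    proof (rule ccontr)
      assume n: "\<not> degree (a j) < 2"
      then have "p * 2 \<le> p * degree (a j)" by (intro mult_le_mono2) simp
      moreover have "a j \<noteq> 0" using n by auto
      moreover have "j < p" "3 * p \<le> 3 * j + 9" using that p_ge by auto
      ultimately show False using deg[of j] p_ge by linarith
    qed
    then have "peval (xi \<alpha>) (a j) = (\<Sum>i<2. fls_const (coeff (a j) i) * xi \<alpha> ^ i)" by (rule peval_eq_sum)
    also have "\<dots> = fls_const (coeff (a j) 0) + fls_const (coeff (a j) 1) * fls_const \<alpha> + fls_const (coeff (a j) 1) * fls_X"
      by (simp add: numeral_2_eq_2 xi_def algebra_simps)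
    finally show ?thesis by (simp add: fls_plus_const)
  qed
  \<comment> \<open>For these j the coefficient of \<open>B\<close> says that c \<psi>^k agrees
    modulo t^3 with a polynomial linear in t. The case k = 1 gives \<psi> $ 2 = 0, and k = 2 then
    gives that the square of \<psi> $ 1 is zero.\<close>
  have key: "(\<psi> ^ k) $ 2 = 0" if k: "k = 1 \<or> k = 2" for k
  proof -
    define j where "j = p - Suc k"
    have j: "0 < j" "j < p" "p - Suc j = k" "j = p - 2 \<or> j = p - 3" using k p_ge by (auto simp: j_def)
    have "coeff B j $$ 2 = 0" using ordB[of j] by (simp add: ord_ge_def)
    then have "(C * ?s ^ k) $$ 2 = 0" using coB[OF j(1,2)] nth2[OF j(4)] j(3) by simp
    moreover have "ord_ge (0 + 3) (?s ^ k * (fls_const c + C))"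
      by (intro ord_ge_mult ord_ge_power0 Cc) simp
    then have "(?s ^ k * (fls_const c + C)) $$ 2 = 0" by (simp add: ord_ge_def)
    ultimately have "(fls_const c * ?s ^ k) $$ 2 = 0" by (simp add: algebra_simps)
    moreover have "fls_const c * ?s ^ k = fps_to_fls (fps_const c * \<psi> ^ k)"
      by (simp add: fls_times_fps_to_fls fps_to_fls_power)
    ultimately show ?thesis using c0 by simp
  qed
  show 2: "\<psi> $ 2 = 0" using key[of 1] by simp
  have "(\<psi> ^ 2) $ 2 = \<psi> $ 0 * \<psi> $ 2 + \<psi> $ 1 * \<psi> $ 1 + \<psi> $ 2 * \<psi> $ 0"
    by (simp add: power2_eq_square fps_mult_nth numeral_2_eq_2)
  then show "\<psi> $ 1 = 0" using key[of 2] 2 by simp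
qed

text \<open>The orders of the three summands are -p i modulo 3, hence distinct, as p is prime to 3.
  With \<open>T\<close> standing for \<open>Y\<close> or Y - \<eta>, and X^3 eliminated by the
  equation, this turns identities between functions into comparisons of coefficients.\<close>

lemma independent_1_X_X2:
  assumes T: "fls_subdegree T = -3"
    and eq: "peval T P0 + X * peval T P1 + X ^ 2 * peval T P2 = 0"
  shows "P0 = 0" "P1 = 0" "P2 = 0"
proof -
  have ncT: "nonconst T" using T by (auto simp: nonconst_def)
  have sub: "fls_subdegree (peval T b) = - 3 * int (degree b)" if "b \<noteq> 0" for b
    using that
  proof (induction "degree b" arbitrary: b)
    case 0
    then obtain c where "b = [:c:]" by (metis degree_eq_zeroE)
    then show ?case by (simp add: peval_const)
  next
    case (Suc n)
    obtain a c where c: "b = [:-a, 1:] * c" "degree b = Suc (degree c)"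
      using linear_factor[OF alg, of b] Suc by (metis zero_less_Suc)
    have c0: "c \<noteq> 0" using c(1) Suc.prems by auto
    have T0: "T \<noteq> 0" using T by auto
    have s: "fls_subdegree (T - fls_const a) = - 3"
    proof (cases "a = 0")
      case False
      then show ?thesis using fls_subdegree_diff_eq1[of T "fls_const a"] T T0 by simp
    qed (simp add: T)
    have "T - fls_const a \<noteq> 0" using s by auto
    moreover have "peval T b = (T - fls_const a) * peval T c"
      by (simp add: c(1) peval_mult peval_pCons del: mult_pCons_left)
    ultimately have "fls_subdegree (peval T b) = - 3 + fls_subdegree (peval T c)"
      using s peval_nonzero[OF alg ncT c0] by simp
    then show ?case using Suc.hyps(1)[of c] Suc.hyps(2) c(2) c0 by simp
  qed
  define P where "P = (\<lambda>i::nat. if i = 0 then P0 else if i = 1 then P1 else P2)"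
  define g where "g = (\<lambda>i. X ^ i * peval T (P i))"
  have sum0: "(\<Sum>i<3. g i) = 0" using eq by (simp add: g_def P_def numeral_3_eq_3 power2_eq_square)
  have zero: "P i = 0" if i: "i < 3" for i
  proof -
    have "ord_ge (fls_subdegree (g i) + 1) (g i)"
    proof (rule ord_ge_sum_distinct[where I = "{..<3}"])
      show "ord_ge (fls_subdegree (g i) + 1) (\<Sum>i<3. g i)" by (simp add: sum0)
      fix i j :: nat assume ij: "i \<in> {..<3}" "j \<in> {..<3}" "g i \<noteq> 0" "g j \<noteq> 0" "fls_subdegree (g i) = fls_subdegree (g j)"
      have s: "fls_subdegree (g i) = - int p * int i - 3 * int (degree (P i))" if "g i \<noteq> 0" for i
      proof -
        have "P i \<noteq> 0" using that by (auto simp: g_def)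
        then show ?thesis using that sub[of "P i"] by (simp add: g_def fls_subdegree_pow subdegree_X)
      qed
      have eq': "int p * int i + 3 * int (degree (P i)) = int p * int j + 3 * int (degree (P j))"
        using s[OF ij(3)] s[OF ij(4)] ij(5) by simp
      have "\<not> 3 dvd p"
        using prime_p p_ge by (auto simp: prime_nat_iff)
      then have p3: "p mod 3 = 1 \<or> p mod 3 = 2" by presburger
      have "(p * i + 3 * degree (P i)) mod 3 = (p * j + 3 * degree (P j)) mod 3"
        using eq' by (metis (mono_tags) of_nat_add of_nat_eq_iff of_nat_mult of_nat_numeral)
      then have "(p * i) mod 3 = (p * j) mod 3" by simp
      then have m: "((p mod 3) * i) mod 3 = ((p mod 3) * j) mod 3" by (simp add: mod_mult_left_eq)
      have "i \<in> {0,1,2}" "j \<in> {0,1,2}" using ij by auto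
      then show "i = j" using m p3 by auto
    qed (use i in auto)
    then have "g i = 0" by (simp add: ord_ge_iff)
    then show ?thesis using peval_nonzero[OF alg ncT] X_nz by (auto simp: g_def)
  qed
  show "P0 = 0" "P1 = 0" "P2 = 0" using zero[of 0] zero[of 1] zero[of 2] by (simp_all add: P_def)
qed

end

section \<open>Automorphisms\<close>

context AS_embedding
begin

definition K_aut :: "('a fls \<Rightarrow> 'a fls) \<Rightarrow> bool" where
  "K_aut \<sigma> \<longleftrightarrow> bij_betw \<sigma> F F \<and> (\<forall>x\<in>F. \<forall>y\<in>F. \<sigma> (x + y) = \<sigma> x + \<sigma> y \<and> \<sigma> (x * y) = \<sigma> x * \<sigma> y) \<and>
     (\<forall>c. \<sigma> (fls_const c) = fls_const c)"

context
  fixes \<sigma> assumes aut: "K_aut \<sigma>"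
begin

lemma aut_F: "x \<in> F \<Longrightarrow> \<sigma> x \<in> F" using aut by (auto simp: K_aut_def bij_betw_def)
lemma aut_add: "x \<in> F \<Longrightarrow> y \<in> F \<Longrightarrow> \<sigma> (x + y) = \<sigma> x + \<sigma> y" using aut by (simp add: K_aut_def)
lemma aut_mult: "x \<in> F \<Longrightarrow> y \<in> F \<Longrightarrow> \<sigma> (x * y) = \<sigma> x * \<sigma> y" using aut by (simp add: K_aut_def)
lemma aut_const: "\<sigma> (fls_const c) = fls_const c" using aut by (simp add: K_aut_def)
lemma aut_0: "\<sigma> 0 = 0" using aut_const[of 0] by simp
lemma aut_1: "\<sigma> 1 = 1" using aut_const[of 1] by simp
lemma aut_inj: "x \<in> F \<Longrightarrow> y \<in> F \<Longrightarrow> \<sigma> x = \<sigma> y \<Longrightarrow> x = y"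
  using aut by (auto simp: K_aut_def bij_betw_def inj_on_def)
lemma aut_surj: "z \<in> F \<Longrightarrow> \<exists>w\<in>F. z = \<sigma> w" using aut by (auto simp: K_aut_def bij_betw_def)
lemma aut_diff: "x \<in> F \<Longrightarrow> y \<in> F \<Longrightarrow> \<sigma> (x - y) = \<sigma> x - \<sigma> y"
  using aut_add[of "x - y" y] by (simp add: F_diff)
lemma aut_power: "x \<in> F \<Longrightarrow> \<sigma> (x ^ n) = \<sigma> x ^ n"
  by (induction n) (auto simp: aut_1 aut_mult F_power)

lemma aut_inverse: "x \<in> F \<Longrightarrow> \<sigma> (inverse x) = inverse (\<sigma> x)"
proof (cases "x = 0")
  case False
  assume x: "x \<in> F"
  have "\<sigma> (x * inverse x) = 1" using False by (simp add: aut_1)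
  then show ?thesis using x aut_mult[of x "inverse x"] F_inverse inverse_unique by metis
qed (simp add: aut_0)

lemma aut_nonconst: "z \<in> F \<Longrightarrow> nonconst z \<Longrightarrow> nonconst (\<sigma> z)"
  unfolding nonconst_def using aut_const aut_inj F_const by metis

lemma aut_image_place:
  assumes pl: "place V" shows "place (\<sigma> ` V)"
  unfolding place_def
proof (intro conjI allI ballI impI)
  show "\<sigma> ` V \<subseteq> F" using aut_F V_F[OF pl] by auto
  show "\<sigma> ` V \<noteq> F"
  proof
    assume eq: "\<sigma> ` V = F"
    have "F \<subseteq> V"
    proof
      fix x assume x: "x \<in> F"
      then have "\<sigma> x \<in> \<sigma> ` V" using eq aut_F by simp
      then show "x \<in> V" using aut_inj[OF x] V_F[OF pl] by blast
    qed
    then show False using pl by (auto simp: place_def)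
  qed
  show "fls_const c \<in> \<sigma> ` V" for c using V_const[OF pl, of c] aut_const by (metis image_eqI)
next
  fix x y assume "x \<in> \<sigma> ` V" "y \<in> \<sigma> ` V"
  then obtain u v where "x = \<sigma> u" "y = \<sigma> v" "u \<in> V" "v \<in> V" by auto
  then show "x + y \<in> \<sigma> ` V" "x * y \<in> \<sigma> ` V"
    using V_F[OF pl] V_add[OF pl, of u v] V_mult[OF pl, of u v] by (auto simp flip: aut_add aut_mult)
next
  fix z assume z: "z \<in> F" "z \<notin> \<sigma> ` V"
  then obtain w where w: "w \<in> F" "z = \<sigma> w" using aut_surj by blast
  then have "inverse w \<in> V" using V_inverse[OF pl w(1)] z by blast
  then show "inverse z \<in> \<sigma> ` V" using w by (auto simp flip: aut_inverse)
qed

lemma aut_preimage_place: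
  assumes pl: "place V" shows "place {w \<in> F. \<sigma> w \<in> V}"
  unfolding place_def
proof (intro conjI allI ballI impI)
  show "{w \<in> F. \<sigma> w \<in> V} \<noteq> F"
  proof
    assume eq: "{w \<in> F. \<sigma> w \<in> V} = F"
    have "F \<subseteq> V"
    proof
      fix x assume "x \<in> F"
      then obtain w where "w \<in> F" "x = \<sigma> w" using aut_surj by blast
      then show "x \<in> V" using eq by blast
    qed
    then show False using pl by (auto simp: place_def)
  qed
next
  fix x y assume "x \<in> {w \<in> F. \<sigma> w \<in> V}" "y \<in> {w \<in> F. \<sigma> w \<in> V}"
  then show "x + y \<in> {w \<in> F. \<sigma> w \<in> V}" "x * y \<in> {w \<in> F. \<sigma> w \<in> V}"
    by (auto simp: aut_add aut_mult F_add F_mult V_add[OF pl] V_mult[OF pl])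
next
  fix z assume "z \<in> F" "z \<notin> {w \<in> F. \<sigma> w \<in> V}"
  then show "inverse z \<in> {w \<in> F. \<sigma> w \<in> V}"
    by (auto simp: aut_inverse F_inverse aut_F V_inverse[OF pl])
qed (auto simp: aut_const V_const[OF pl])

lemma aut_curve: "on_curve (\<sigma> X) (\<sigma> Y)"
proof -
  have "\<sigma> (Y ^ p - Y) = \<sigma> (X ^ 3 + fls_const d * X ^ 2 + fls_const e * X + fls_const l)"
    using curve_eq by simp
  then show ?thesis
    by (simp add: on_curve_def aut_nonconst nonconst_X aut_diff aut_add aut_mult aut_power aut_const F_intros)
qed

text \<open>\<tau> lies in the maximal ideal of the image place, so it is the image of some w
  vanishing at infinity, where w^3 and w^p cancel the poles of \<open>Y\<close> and
  \<open>X\<close>.\<close>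

lemma aut_pole_order:
  assumes \<tau>: "\<tau> \<in> F" "inverse \<tau> \<notin> \<sigma> ` V_inf"
  shows "\<sigma> Y * \<tau> ^ 3 \<in> \<sigma> ` V_inf" "\<sigma> X * \<tau> ^ p \<in> \<sigma> ` V_inf"
proof -
  obtain w where w: "w \<in> F" "\<tau> = \<sigma> w" using aut_surj \<tau>(1) by blast
  have "\<not> ord_ge 0 (inverse w)"
  proof
    assume "ord_ge 0 (inverse w)"
    then have "inverse w \<in> V_inf" using w F_inverse by (simp add: V_inf_def)
    then show False using \<tau>(2) w by (auto simp flip: aut_inverse)
  qed
  then have ow: "ord_ge 1 w" using ord_ge_inverse[of 0 "inverse w"] by simp
  have "ord_ge (-3) Y" "ord_ge (- int p) X" using subdegree_X subdegree_Y by (simp_all add: ord_ge_iff)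
  then have "ord_ge (-3 + int 3 * 1) (Y * w ^ 3)" "ord_ge (- int p + int p * 1) (X * w ^ p)"
    using ord_ge_mult[OF _ ord_ge_power[OF ow, of 3], of "-3" Y] ord_ge_mult[OF _ ord_ge_power[OF ow, of p], of "- int p" X]
    by blast+
  then have "Y * w ^ 3 \<in> V_inf" "X * w ^ p \<in> V_inf" using w by (simp_all add: V_inf_def F_intros)
  then have "\<sigma> (Y * w ^ 3) \<in> \<sigma> ` V_inf" "\<sigma> (X * w ^ p) \<in> \<sigma> ` V_inf" by blast+
  then show "\<sigma> Y * \<tau> ^ 3 \<in> \<sigma> ` V_inf" "\<sigma> X * \<tau> ^ p \<in> \<sigma> ` V_inf"
    using w by (simp_all add: aut_mult aut_power F_power)
qed

end

end

section \<open>Automorphisms that fix the place at infinity\<close>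

context normal_AS
begin

lemma p_cases:
  obtains k where "p = 3 * k + 1" | k where "p = 3 * k + 2"
proof -
  have "\<not> 3 dvd p"
    using prime_p p_ge by (auto simp: prime_nat_iff)
  then have "p mod 3 = 1 \<or> p mod 3 = 2" by presburger
  then show ?thesis using that by (metis mult_div_mod_eq)
qed

text \<open>Bezout for p and 3: the witnesses have order p - 3k and 3(k+1) - p respectively.\<close>

lemma uniformizer_at_infinity:
  obtains t where "t \<in> F" "t \<noteq> 0" "fls_subdegree t = 1"
proof (cases rule: p_cases)
  case (1 k)
  show ?thesis
    by (rule that[of "Y ^ k / X"])
       (use 1 X_nz Y_nz in \<open>simp_all add: F_intros fls_divide_subdegree fls_subdegree_pow subdegree_X subdegree_Y\<close>)
next
  case (2 k)
  show ?thesis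
    by (rule that[of "X / Y ^ (k + 1)"])
       (use 2 X_nz Y_nz in \<open>simp_all add: F_intros fls_divide_subdegree fls_subdegree_pow subdegree_X subdegree_Y del: power_Suc\<close>)
qed

context
  fixes \<sigma> assumes aut: "K_aut \<sigma>"
begin

text \<open>Pulled back along \<sigma>, the place \<open>V\<close> differs from the place at
  infinity, which is the only pole of \<open>X\<close> and \<open>Y\<close>.\<close>

lemma aut_coordinates_in_place:
  assumes pl: "place V" and ne: "V \<noteq> \<sigma> ` V_inf"
  shows "\<sigma> X \<in> V" "\<sigma> Y \<in> V"
proof -
  let ?W = "{w \<in> F. \<sigma> w \<in> V}"
  have W: "place ?W" by (rule aut_preimage_place[OF aut pl])
  have im: "\<sigma> ` ?W = V"
  proof
    show "V \<subseteq> \<sigma> ` ?W" using aut_surj[OF aut] V_F[OF pl] by blast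
  qed auto
  have "X \<in> ?W"
  proof (rule ccontr)
    assume "X \<notin> ?W"
    then have "?W = V_inf" by (rule place_at_infinity_unique[OF W])
    then show False using im ne by simp
  qed
  then show "\<sigma> X \<in> V" "\<sigma> Y \<in> V" using Y_in_place[OF W] by auto
qed

lemma aut_fixing_infinity:
  assumes fix_inf: "\<sigma> ` V_inf = V_inf"
  obtains a b where "\<sigma> X = fls_const a * X" "\<sigma> Y = fls_const (a ^ 3) * Y + fls_const b"
    "a \<noteq> 0" "a ^ (3 * p) = a ^ 3" "b ^ p = b" "e = 0 \<or> a ^ 2 = 1"
proof -
  have "point_place \<alpha> \<psi> \<noteq> \<sigma> ` V_inf" if "curve_point \<alpha> \<psi>" for \<alpha> \<psi>
    using X_in_point_place[OF that] X_notin_V_inf fix_inf by metis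
  then have reg: "finite_regular (\<sigma> X)" "finite_regular (\<sigma> Y)"
    using aut_coordinates_in_place place_point_place aut_F[OF aut] by (auto simp: finite_regular_def)
  obtain t where t: "t \<in> F" "t \<noteq> 0" "fls_subdegree t = 1" by (rule uniformizer_at_infinity)
  have "inverse t \<notin> \<sigma> ` V_inf" using t unfolding fix_inf by (simp add: V_inf_def ord_ge_iff)
  then have "ord_ge 0 (\<sigma> Y * t ^ 3)" "ord_ge 0 (\<sigma> X * t ^ p)"
    using aut_pole_order[OF aut t(1)] fix_inf by (simp_all add: V_inf_def)
  then have ord: "ord_ge (- int 3) (\<sigma> Y)" "ord_ge (- int p) (\<sigma> X)"
    using ord_ge_cancel[of "t ^ 3" 0 "\<sigma> Y"] ord_ge_cancel[of "t ^ p" 0 "\<sigma> X"] t by (simp_all add: fls_subdegree_pow)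
  obtain c' hy where hy: "\<sigma> Y = fls_const c' * X + peval Y hy" "3 * degree hy \<le> 3" "3 < p \<Longrightarrow> c' = 0"
    by (rule finite_regular_small[OF reg(2) ord(1)]) (use p_ge in simp, blast)
  obtain b c where "hy = [:b, c:]"
  proof (rule that)
    show "hy = [:coeff hy 0, coeff hy 1:]" using hy(2)
      by (intro poly_eqI) (auto simp: coeff_pCons coeff_eq_0 split: nat.splits)
  qed
  then have sY: "\<sigma> Y = fls_const c * Y + fls_const b"
    using hy p_ge by (simp add: peval_pCons algebra_simps)
  obtain a h where sX: "\<sigma> X = fls_const a * X + peval Y h"
    by (rule finite_regular_small[OF reg(1) ord(2)]) (simp, blast)
  define H where "H = peval Y h"
  have ncY: "nonconst Y" using subdegree_Y by (auto simp: nonconst_def)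
  have c0: "c \<noteq> 0"
    using aut_nonconst[OF aut F_Y ncY] sY by (auto simp: nonconst_def)
  have "\<sigma> Y ^ p - \<sigma> Y = \<sigma> X ^ 3 + fls_const e * \<sigma> X"
    using aut_curve[OF aut] by (simp add: on_curve_iff)
  moreover have "\<sigma> Y ^ p = fls_const (c ^ p) * Y ^ p + fls_const (b ^ p)"
    by (simp add: sY fls_freshman power_mult_distrib fls_const_power)
  ultimately have eq: "fls_const (c ^ p) * Y ^ p + fls_const (b ^ p) - (fls_const c * Y + fls_const b)
      = (fls_const a * X + H) ^ 3 + fls_const e * (fls_const a * X + H)"
    by (simp add: sY sX H_def)
  \<comment> \<open>Coefficients of 1, X and X^2 after X^3 is replaced by Y^p - Y - eX.\<close>
  define P0 where "P0 = smult (a ^ 3) ([:0, 1:] ^ p - [:0, 1:]) + h ^ 3 + smult e h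
    - (smult (c ^ p) ([:0, 1:] ^ p) + [:b ^ p - b, - c:])"
  define P1 where "P1 = smult (3 * a) (h ^ 2) + [:e * a - e * a ^ 3:]"
  define P2 where "P2 = smult (3 * a ^ 2) h"
  note psmult = heval_smult[OF unital_hom_fls_const]
  have X3: "X ^ 3 = Y ^ p - Y - fls_const e * X" using curve_eq' by simp
  have three: "(3 :: 'a fls) = fls_const 3" by simp
  have "peval Y P0 + X * peval Y P1 + X ^ 2 * peval Y P2
    = fls_const a ^ 3 * (Y ^ p - Y - fls_const e * X) + 3 * fls_const a ^ 2 * X ^ 2 * H + 3 * fls_const a * X * H ^ 2 + H ^ 3
      + fls_const e * (fls_const a * X + H) - (fls_const (c ^ p) * Y ^ p + fls_const (b ^ p) - (fls_const c * Y + fls_const b))"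
    unfolding P0_def P1_def P2_def
    by (simp add: peval_add peval_diff peval_power peval_pCons psmult H_def[symmetric] fls_minus_const[symmetric]
        fls_const_power[symmetric] fls_const_mult_const[symmetric] algebra_simps del: fls_const_mult_const)
  also have "\<dots> = (fls_const a * X + H) ^ 3 + fls_const e * (fls_const a * X + H)
       - (fls_const (c ^ p) * Y ^ p + fls_const (b ^ p) - (fls_const c * Y + fls_const b))"
    unfolding X3[symmetric] by (simp add: power2_eq_square power3_eq_cube algebra_simps)
  also have "\<dots> = 0" by (simp add: eq)
  finally have P: "P0 = 0" "P1 = 0" "P2 = 0"
    using independent_1_X_X2[OF subdegree_Y] by blast+
  \<comment> \<open>A nonzero h would force a = 0 through \<open>P2\<close>, and comparing degrees
    would then give p = 3 deg h.\<close>
  have h0: "h = 0"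
  proof (rule ccontr)
    assume h: "h \<noteq> 0"
    then have a0: "a = 0" using P(3) three_nz by (simp add: P2_def)
    then have hh: "h ^ 3 + smult e h = smult (c ^ p) ([:0, 1:] ^ p) + [:b ^ p - b, - c:]"
      using P(1) by (simp add: P0_def)
    have "degree (smult (c ^ p) ([:0, 1:] ^ p) + [:b ^ p - b, - c:]) = p"
      using c0 p_ge by (subst degree_add_eq_left) (auto simp: degree_power_eq)
    moreover have "degree (h ^ 3 + smult e h) = 3 * degree h"
    proof (cases "degree h = 0")
      case True
      then obtain u where "h = [:u:]" by (metis degree_eq_zeroE)
      then show ?thesis by (simp add: power3_eq_cube)
    next
      case False
      then have "degree (smult e h) < degree (h ^ 3)"
        using h by (intro le_less_trans[OF degree_smult_le]) (simp add: degree_power_eq)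
      then show ?thesis using h by (simp add: degree_add_eq_left degree_power_eq)
    qed
    ultimately have "p = 3 * degree h" using hh by simp
    then show False by (cases rule: p_cases) presburger+
  qed
  have cf: "coeff (smult (a ^ 3) ([:0, 1:] ^ p - [:0, 1:]) - (smult (c ^ p) ([:0, 1:] ^ p) + [:b ^ p - b, - c:])) n = 0" for n
    using P(1) h0 by (simp add: P0_def)
  have mono: "[:0, 1:] ^ p = monom (1 :: 'a) p" by (simp add: monom_altdef)
  have "b ^ p = b" using cf[of 0] p_ge by (simp add: mono)
  moreover have ca: "c = a ^ 3" using cf[of 1] p_ge by (simp add: mono)
  moreover have "c ^ p = a ^ 3" using cf[of p] p_ge by (simp add: mono coeff_pCons split: nat.splits)
  moreover have "a \<noteq> 0" using c0 ca by auto
  moreover have "e = 0 \<or> a ^ 2 = 1"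
  proof -
    have "e * a - e * a ^ 3 = 0" using P(2) h0 by (simp add: P1_def)
    then have "e * a * (1 - a ^ 2) = 0" by (simp add: algebra_simps power2_eq_square power3_eq_cube)
    then show ?thesis using \<open>a \<noteq> 0\<close> by auto
  qed
  moreover have "a ^ (3 * p) = a ^ 3" using calculation by (simp add: power_mult)
  ultimately show ?thesis using that[of a b] sX sY h0 by simp
qed

end

end

section \<open>Automorphisms that move the place at infinity\<close>

context normal_AS
begin

lemma nonconst_Y: "nonconst Y"
  using subdegree_Y by (auto simp: nonconst_def)

context
  fixes \<sigma> assumes aut: "K_aut \<sigma>"
begin

lemma aut_moving_infinity_center:
  assumes moves: "\<sigma> ` V_inf \<noteq> V_inf"
  obtains \<eta> where "e = 0" "\<eta> ^ p = \<eta>" "inverse X \<notin> \<sigma> ` V_inf" "inverse (Y - fls_const \<eta>) \<notin> \<sigma> ` V_inf"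
proof -
  let ?V = "\<sigma> ` V_inf"
  have pl: "place ?V" by (rule aut_image_place[OF aut place_V_inf])
  have "X \<in> ?V" using place_at_infinity_unique[OF pl] moves by blast
  then obtain \<alpha> \<eta> where center: "inverse (X - fls_const \<alpha>) \<notin> ?V" "inverse (Y - fls_const \<eta>) \<notin> ?V"
    "\<eta> ^ p - \<eta> = \<alpha> ^ 3 + e * \<alpha>"
    by (rule finite_place_center[OF pl])
  let ?t = "X - fls_const \<alpha>"
  have tF: "?t \<in> F" by (intro F_intros)
  have yF: "\<sigma> Y \<in> F" using aut_F[OF aut] by simp
  have y_inf: "ord_ge 0 (\<sigma> Y)"
    using aut_coordinates_in_place(2)[OF aut place_V_inf] moves by (auto simp: V_inf_def)
  \<comment> \<open>Different centres mean different places, so among the affine points \<sigma>(Y)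
    can have a pole only at (\<alpha>, \<eta>).\<close>
  have other: "\<sigma> Y \<in> point_place \<beta> \<phi>" if "curve_point \<beta> \<phi>" "\<not> (\<beta> = \<alpha> \<and> \<phi> $ 0 = \<eta>)" for \<beta> \<phi>
  proof (rule aut_coordinates_in_place(2)[OF aut place_point_place[OF that(1)]])
    show "point_place \<beta> \<phi> \<noteq> ?V"
      using center that(2) point_place_center_X[OF that(1)] point_place_center_Y[OF that(1)] by blast
  qed
  \<comment> \<open>The factor cancels the pole of \<sigma>(Y) at the centre, at the price of a pole
    of order at most 3p at infinity.\<close>
  define A where "A = \<sigma> Y * ?t ^ 3"
  have AF: "A \<in> F" unfolding A_def by (intro F_mult F_power yF tF)
  have "A \<in> point_place \<beta> \<phi>" if pt: "curve_point \<beta> \<phi>" for \<beta> \<phi>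
  proof (cases "point_place \<beta> \<phi> = ?V")
    case True
    then show ?thesis using aut_pole_order(1)[OF aut tF center(1)] by (simp add: A_def)
  next
    case False
    note P = place_point_place[OF pt]
    have "\<sigma> Y \<in> point_place \<beta> \<phi>" by (rule aut_coordinates_in_place(2)[OF aut P False])
    then show ?thesis unfolding A_def
      by (intro V_mult[OF P] V_power[OF P] V_diff[OF P] V_const[OF P] X_in_point_place[OF pt])
  qed
  then have regA: "finite_regular A" using AF by (simp add: finite_regular_def)
  obtain a where a: "A = (\<Sum>j<p. peval X (a j) * Y ^ j)"
    "\<And>\<alpha> \<psi>. curve_point \<alpha> \<psi> \<Longrightarrow> at_point \<alpha> \<psi> A = (\<Sum>j<p. peval (xi \<alpha>) (a j) * fps_to_fls \<psi> ^ j)"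
    "\<And>N j. ord_ge (- int N) A \<Longrightarrow> j < p \<Longrightarrow> a j \<noteq> 0 \<Longrightarrow> p * degree (a j) + 3 * j \<le> N"
    by (rule finite_regular_expansion[OF regA], rule that, assumption, blast, blast)
  have "ord_ge (- int p) X" using subdegree_X by (simp add: ord_ge_iff)
  then have "ord_ge (- int p) ?t" using ord_ge_mono[OF ord_ge_const, of "- int p" \<alpha>] by (intro ord_ge_diff) simp_all
  then have "ord_ge (int 3 * - int p) (?t ^ 3)" by (rule ord_ge_power)
  then have "ord_ge (int 3 * - int p) A" unfolding A_def by (rule ord_ge_mult_left[OF y_inf])
  then have ordA: "ord_ge (- int (3 * p)) A" by simp
  have at_A: "at_point \<alpha> \<phi> A = at_point \<alpha> \<phi> (\<sigma> Y) * fls_X ^ 3" if "curve_point \<alpha> \<phi>" for \<phi>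
    unfolding A_def by (simp add: point_subst[OF that] yF tF F_power) (simp add: xi_def)
  \<comment> \<open>Being regular at infinity, \<sigma>(Y) would be constant if it had no affine
    pole either.\<close>
  have irregular: "\<not> finite_regular (\<sigma> Y)"
  proof
    assume r: "finite_regular (\<sigma> Y)"
    obtain c h where ch: "\<sigma> Y = fls_const c * X + peval Y h" "3 * degree h \<le> 0" "0 < p \<Longrightarrow> c = 0"
      by (rule finite_regular_small[OF r, of 0]) (use y_inf p_ge in simp, use p_ge in simp, blast)
    then obtain u where "h = [:u:]" by (metis degree_eq_zeroE le_zero_eq mult_eq_0_iff zero_neq_numeral)
    then have "\<sigma> Y = fls_const u" using ch p_ge by (simp add: peval_const)
    then show False
      using aut_nonconst[OF aut F_Y nonconst_Y] by (auto simp: nonconst_def)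
  qed
  then obtain \<psi> where \<psi>: "curve_point \<alpha> \<psi>" "\<psi> $ 0 = \<eta>" "\<sigma> Y \<notin> point_place \<alpha> \<psi>"
    using other yF unfolding finite_regular_def by blast
  have flat: "\<psi> $ 1 = 0" "\<psi> $ 2 = 0"
  proof (rule_tac [!] triple_pole_imp_flat[OF \<psi>(1) a(3)[OF ordA] refl])
    show "ord_ge 3 (\<Sum>j<p. peval (xi \<alpha>) (a j) * (fps_to_fls \<psi> + fls_const i) ^ j)" if i: "i ^ p = i" "i \<noteq> 0" for i
    proof -
      let ?\<phi> = "\<psi> + fps_const i"
      have pt: "curve_point \<alpha> ?\<phi>" by (rule curve_point_shift[OF \<psi>(1) i(1)])
      have "\<sigma> Y \<in> point_place \<alpha> ?\<phi>" by (rule other[OF pt]) (use \<psi> i in simp)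
      then have "ord_ge 0 (at_point \<alpha> ?\<phi> (\<sigma> Y))" by (simp add: point_place_def)
      then have "ord_ge (int 3 * 1) (at_point \<alpha> ?\<phi> (\<sigma> Y) * fls_X ^ 3)"
        by (rule ord_ge_mult_left) (rule ord_ge_power[OF ord_ge_X])
      then show ?thesis using at_A[OF pt] a(2)[OF pt] by simp
    qed
    then show "i ^ p = i \<Longrightarrow> i \<noteq> 0 \<Longrightarrow> ord_ge 3 (\<Sum>j<p. peval (xi \<alpha>) (a j) * (fps_to_fls \<psi> + fls_const i) ^ j)" for i .
    have "\<not> ord_ge 3 (at_point \<alpha> \<psi> A)"
    proof
      assume "ord_ge 3 (at_point \<alpha> \<psi> A)"
      moreover have "ord_ge (-3) (inverse fls_X ^ 3 :: 'a fls)"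
        by (simp add: ord_ge_iff fls_subdegree_pow)
      ultimately have "ord_ge (3 + -3) (at_point \<alpha> \<psi> A * inverse fls_X ^ 3)" by (rule ord_ge_mult)
      moreover have "at_point \<alpha> \<psi> A * inverse fls_X ^ 3 = at_point \<alpha> \<psi> (\<sigma> Y)"
        by (simp add: at_A[OF \<psi>(1)] mult.assoc flip: power_mult_distrib)
      ultimately show False using \<psi>(3) yF by (simp add: point_place_def)
    qed
    then show "\<not> ord_ge 3 (\<Sum>j<p. peval (xi \<alpha>) (a j) * fps_to_fls \<psi> ^ j)"
      "\<not> ord_ge 3 (\<Sum>j<p. peval (xi \<alpha>) (a j) * fps_to_fls \<psi> ^ j)" using a(2)[OF \<psi>(1)] by simp_all
  qed
  have \<alpha>0: "\<alpha> = 0" using curve_point_coeffs(3)[OF \<psi>(1)] flat three_nz by simp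
  have e0: "e = 0" using curve_point_coeffs(2)[OF \<psi>(1)] flat \<alpha>0 by simp
  have "\<eta> ^ p = \<eta>" using center(3) \<alpha>0 by simp
  then show ?thesis using that[OF e0] center \<alpha>0 by simp
qed

lemma aut_moving_infinity:
  assumes moves: "\<sigma> ` V_inf \<noteq> V_inf"
  obtains c b \<eta> where "e = 0" "p mod 3 = 2" "\<eta> ^ p = \<eta>" "b ^ p = b" "c \<noteq> 0" "c ^ (3 * p) = c ^ 3"
    "\<sigma> X = fls_const c * X / (Y - fls_const \<eta>) ^ ((p + 1) div 3)"
    "\<sigma> Y = fls_const b - fls_const (c ^ 3) / (Y - fls_const \<eta>)"
proof -
  let ?V = "\<sigma> ` V_inf"
  obtain \<eta> where e0: "e = 0" and \<eta>: "\<eta> ^ p = \<eta>" and center: "inverse X \<notin> ?V" "inverse (Y - fls_const \<eta>) \<notin> ?V"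
    by (rule aut_moving_infinity_center[OF moves])
  define u where "u = Y - fls_const \<eta>"
  have uF: "u \<in> F" unfolding u_def by (intro F_intros)
  have pl: "place ?V" by (rule aut_image_place[OF aut place_V_inf])
  have sub_u: "fls_subdegree u = -3"
    unfolding u_def using subdegree_Y Y_nz
    by (cases "\<eta> = 0") (auto simp: fls_subdegree_diff_eq1)
  have u0: "u \<noteq> 0" using sub_u by auto
  have sF: "\<sigma> X \<in> F" "\<sigma> Y \<in> F" using aut_F[OF aut] by simp_all
  have s_inf: "ord_ge 0 (\<sigma> X)" "ord_ge 0 (\<sigma> Y)"
    using aut_coordinates_in_place[OF aut place_V_inf] moves by (auto simp: V_inf_def)
  \<comment> \<open>At the centre Y - \<eta> vanishes to order 3, because \<alpha> = e = 0 kills the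
    coefficients of degree 1 and 2. So one factor u cancels the triple pole of \<sigma>(Y), and u^K
    with 3K \<ge> p cancels the p-fold pole of \<sigma>(X).\<close>
  have reg: "finite_regular (\<sigma> Y * u)" "p \<le> 3 * K \<Longrightarrow> finite_regular (\<sigma> X * u ^ K)" for K
  proof -
    have "\<sigma> Y * u \<in> point_place \<beta> \<phi> \<and> (p \<le> 3 * K \<longrightarrow> \<sigma> X * u ^ K \<in> point_place \<beta> \<phi>)" if pt: "curve_point \<beta> \<phi>" for \<beta> \<phi>
    proof (cases "point_place \<beta> \<phi> = ?V")
      case False
      note P = place_point_place[OF pt]
      have "u \<in> point_place \<beta> \<phi>"
        unfolding u_def by (intro V_diff[OF P] V_const[OF P] Y_in_place[OF P] X_in_point_place[OF pt])
      then show ?thesis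
        using aut_coordinates_in_place[OF aut P False] V_mult[OF P] V_power[OF P] by blast
    next
      case True
      note P = place_point_place[OF pt]
      have b: "\<beta> = 0" using point_place_center_X[OF pt, of 0] center(1) True by simp
      have f0: "\<phi> $ 0 = \<eta>" using point_place_center_Y[OF pt, of \<eta>] center(2) True by simp
      have "\<phi> $ 1 = 0" "\<phi> $ 2 = 0" using curve_point_coeffs[OF pt] b e0 by simp_all
      then have "ord_ge 3 (fps_to_fls \<phi> - fls_const \<eta>)"
        unfolding ord_ge_def
      proof (intro allI impI)
        fix i :: int assume "i < 3"
        then consider "i < 0" | "i = 0" | "i = 1" | "i = 2" by linarith
        then show "(fps_to_fls \<phi> - fls_const \<eta>) $$ i = 0"
          by cases (use \<open>\<phi> $ 1 = 0\<close> \<open>\<phi> $ 2 = 0\<close> f0 in auto)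
      qed
      moreover have "ord_ge (-3) (inverse fls_X ^ 3 :: 'a fls)" by (simp add: ord_ge_iff fls_subdegree_pow)
      ultimately have "ord_ge (3 + -3) ((fps_to_fls \<phi> - fls_const \<eta>) * inverse fls_X ^ 3)" by (rule ord_ge_mult)
      moreover have "at_point \<beta> \<phi> (u * inverse X ^ 3) = (fps_to_fls \<phi> - fls_const \<eta>) * inverse fls_X ^ 3"
        unfolding u_def by (simp add: point_subst[OF pt] F_intros) (simp add: xi_def b)
      ultimately have w: "u * inverse X ^ 3 \<in> point_place \<beta> \<phi>"
        using uF by (simp add: point_place_def F_intros)
      define w' where "w' = u * inverse X ^ 3"
      have uw: "u = w' * X ^ 3" using X_nz by (simp add: w'_def field_simps)
      note po = aut_pole_order[OF aut F_X center(1), folded True]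
      have "\<sigma> Y * u = \<sigma> Y * X ^ 3 * w'" by (subst uw) (simp add: mult_ac)
      then have 1: "\<sigma> Y * u \<in> point_place \<beta> \<phi>" using V_mult[OF P po(1) w, folded w'_def] by (simp only:)
      have 2: "\<sigma> X * u ^ K \<in> point_place \<beta> \<phi>" if K: "p \<le> 3 * K"
      proof -
        have "X ^ (3 * K) = X ^ p * X ^ (3 * K - p)" using K by (simp flip: power_add)
        then have "\<sigma> X * u ^ K = \<sigma> X * X ^ p * (X ^ (3 * K - p) * w' ^ K)"
          by (simp add: uw power_mult_distrib algebra_simps flip: power_mult)
        also have "\<dots> \<in> point_place \<beta> \<phi>"
          using w by (intro V_mult[OF P po(2)] V_mult[OF P] V_power[OF P] X_in_point_place[OF pt]) (simp add: w'_def)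
        finally show ?thesis .
      qed
      show ?thesis using 1 2 by blast
    qed
    then show "finite_regular (\<sigma> Y * u)" "p \<le> 3 * K \<Longrightarrow> finite_regular (\<sigma> X * u ^ K)"
      unfolding finite_regular_def using sF uF by (auto intro: F_mult F_power)
  qed
  have ord_u: "ord_ge (-3) u" using sub_u by (simp add: ord_ge_iff)
  have toU: "\<exists>h'. peval Y h = peval u h' \<and> degree h' = degree h" for h
  proof (intro exI conjI)
    show "peval Y h = peval u (pcompose h [:\<eta>, 1:])" by (simp add: peval_pcompose peval_pCons u_def)
    show "degree (pcompose h [:\<eta>, 1:]) = degree h" by (simp add: degree_pcompose)
  qed
  obtain c' hy where hy: "\<sigma> Y * u = fls_const c' * X + peval Y hy" "3 * degree hy \<le> 3" "3 < p \<Longrightarrow> c' = 0"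
    by (rule finite_regular_small[OF reg(1), of 3]) (use ord_ge_mult_left[OF s_inf(2) ord_u] in simp, use p_ge in simp, blast)
  obtain hy' where hy': "peval Y hy = peval u hy'" "degree hy' = degree hy" using toU by blast
  obtain c0 c1 where "hy' = [:c0, c1:]"
  proof (rule that)
    show "hy' = [:coeff hy' 0, coeff hy' 1:]" using hy(2) hy'(2)
      by (intro poly_eqI) (auto simp: coeff_pCons coeff_eq_0 split: nat.splits)
  qed
  then have "\<sigma> Y * u = fls_const c1 * u + fls_const c0"
    using hy hy'(1) p_ge by (simp add: peval_pCons algebra_simps)
  then have sY: "\<sigma> Y = fls_const c1 + fls_const c0 / u" using u0 by (simp add: field_simps)
  have c0: "c0 \<noteq> 0"
    using aut_nonconst[OF aut F_Y nonconst_Y] sY by (auto simp: nonconst_def)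
  \<comment> \<open>p/3 rounded up, so that \<open>m\<close> is 1 or 2 according as p is 2 or 1
    modulo 3, and the pole order 3K stays below p + 3.\<close>
  define K where "K = (p + 2) div 3"
  define m where "m = 3 * K - p"
  have Km: "3 * K = p + m" "(m = 1 \<and> p mod 3 = 2 \<and> K = (p + 1) div 3) \<or> (m = 2 \<and> p mod 3 = 1)"
    by (cases rule: p_cases; simp add: K_def m_def; presburger)+
  have "ord_ge (int K * -3) (\<sigma> X * u ^ K)" by (rule ord_ge_mult_left[OF s_inf(1) ord_ge_power[OF ord_u]])
  then have ordX: "ord_ge (- int (3 * K)) (\<sigma> X * u ^ K)" by (simp add: mult.commute)
  obtain c hx where hx: "\<sigma> X * u ^ K = fls_const c * X + peval Y hx"
  proof (rule finite_regular_small[OF reg(2) ordX])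
    show "p \<le> 3 * K" "3 * K < p + 3" using Km by linarith+
  qed (use that in blast)
  obtain h where h: "peval Y hx = peval u h" using toU by blast
  define H where "H = peval u h"
  have sXu: "\<sigma> X * u ^ K = fls_const c * X + H" using hx h by (simp add: H_def)
  have up: "u ^ p = Y ^ p - fls_const \<eta>"
    using fls_freshman[of u "fls_const \<eta>"] \<eta> by (simp add: u_def algebra_simps flip: fls_const_power)
  have X3: "X ^ 3 = u ^ p - u" using curve_eq' e0 unfolding up by (simp add: u_def)
  have sYp: "\<sigma> Y ^ p = fls_const (c1 ^ p) + fls_const (c0 ^ p) / u ^ p"
    by (simp add: sY fls_freshman power_divide fls_const_power)
  define \<kappa> where "\<kappa> = c1 ^ p - c1"
  have "\<sigma> Y ^ p - \<sigma> Y = \<sigma> X ^ 3 + fls_const e * \<sigma> X"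
    using aut_curve[OF aut] by (simp add: on_curve_iff)
  then have "\<sigma> X ^ 3 = \<sigma> Y ^ p - \<sigma> Y" by (simp add: e0)
  then have sX3: "\<sigma> X ^ 3 = fls_const \<kappa> + fls_const (c0 ^ p) / u ^ p - fls_const c0 / u"
    by (simp add: sYp \<kappa>_def flip: fls_minus_const) (simp add: sY)
  obtain q where q: "p = Suc q" using p_ge by (cases p) auto
  have "(fls_const c * X + H) ^ 3 = \<sigma> X ^ 3 * u ^ (3 * K)"
    unfolding sXu[symmetric] by (simp add: power_mult_distrib mult.commute flip: power_mult)
  also have "\<dots> = fls_const \<kappa> * u ^ (p + m) + fls_const (c0 ^ p) * u ^ m - fls_const c0 * u ^ (q + m)"
    unfolding sX3 Km(1) using u0 by (simp add: q power_add field_simps)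
  finally have eq: "(fls_const c * X + H) ^ 3 = fls_const \<kappa> * u ^ (p + m) + fls_const (c0 ^ p) * u ^ m - fls_const c0 * u ^ (q + m)" .
  \<comment> \<open>The image of the curve equation, multiplied by u^(3K), as a polynomial in
    u.\<close>
  define R where "R = monom \<kappa> (p + m) + monom (c0 ^ p) m - monom c0 (q + m)"
  have pm: "peval u (monom r n) = fls_const r * u ^ n" for r n
    by (induction n) (simp_all add: monom_0 monom_Suc peval_pCons mult.left_commute)
  have evR: "peval u R = (fls_const c * X + H) ^ 3" by (simp add: eq R_def peval_add peval_diff pm)
  \<comment> \<open>Coefficients of 1, X and X^2 over K[u], with X^3 = u^p - u.\<close>
  define P0 where "P0 = monom (c ^ 3) p - monom (c ^ 3) 1 + h ^ 3 - R"
  define P1 where "P1 = smult (3 * c) (h ^ 2)"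
  define P2 where "P2 = smult (3 * c ^ 2) h"
  have "peval u P0 + X * peval u P1 + X ^ 2 * peval u P2
    = fls_const c ^ 3 * (u ^ p - u) + 3 * fls_const c ^ 2 * X ^ 2 * H + 3 * fls_const c * X * H ^ 2 + H ^ 3 - peval u R"
    unfolding P0_def P1_def P2_def
    by (simp add: peval_add peval_diff peval_power pm heval_smult[OF unital_hom_fls_const] H_def[symmetric]
        fls_const_power[symmetric] fls_const_mult_const[symmetric] algebra_simps del: fls_const_mult_const)
  also have "\<dots> = (fls_const c * X + H) ^ 3 - peval u R"
    unfolding X3[symmetric] by (simp add: power2_eq_square power3_eq_cube algebra_simps)
  also have "\<dots> = 0" by (simp add: evR)
  finally have P: "P0 = 0" "P1 = 0" "P2 = 0"
    using independent_1_X_X2[OF sub_u] by blast+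
  \<comment> \<open>Were c zero, h^3 = R would be divisible by u and therefore by u^3, but
    \<open>R\<close> contains u^m with m at most 2.\<close>
  have cnz: "c \<noteq> 0"
  proof
    assume c: "c = 0"
    then have hR: "h ^ 3 = R" using P(1) by (simp add: P0_def)
    have m12: "m = 1 \<or> m = 2" using Km(2) by auto
    have "q \<ge> 4" using q p_ge by simp
    have "coeff (h ^ 3) 0 = 0" using hR m12 \<open>q \<ge> 4\<close> by (auto simp: R_def)
    then have "coeff h 0 = 0" by (simp add: coeff_0_power)
    then obtain g where g: "h = pCons 0 g" by (cases h) auto
    then have "h ^ 3 = monom 1 3 * g ^ 3"
      by (simp add: power3_eq_cube numeral_3_eq_3 monom_Suc monom_0)
    then have "coeff (h ^ 3) m = 0" using m12 by (auto simp: coeff_monom_mult)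
    moreover have "coeff R m = c0 ^ p" using \<open>q \<ge> 4\<close> p_ge by (simp add: R_def)
    ultimately show False using hR c0 by simp
  qed
  then have h0: "h = 0" using P(3) three_nz by (simp add: P2_def)
  have cf: "coeff (monom (c ^ 3) p - monom (c ^ 3) 1) n = coeff R n" for n
    using P(1) h0 by (simp add: P0_def)
  \<comment> \<open>For m = 2 the polynomial \<open>R\<close> has no linear term, whereas the left
    side contains -c^3 u; this is what excludes p \<equiv> 1 modulo 3.\<close>
  have m1: "m = 1"
  proof (rule ccontr)
    assume "m \<noteq> 1"
    then have "m = 2" using Km(2) by auto
    then show False using cf[of 1] p_ge cnz q by (simp add: R_def)
  qed
  have k0: "\<kappa> = 0" using cf[of "p + 1"] m1 p_ge q by (simp add: R_def)
  have "- (c ^ 3) = c0 ^ p" using cf[of 1] m1 p_ge q by (simp add: R_def)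
  then have "c0 ^ p = - (c ^ 3)" by (rule sym)
  moreover have "c ^ 3 = - c0" using cf[of p] m1 p_ge q by (simp add: R_def)
  then have c03: "c0 = - (c ^ 3)" by simp
  moreover have "odd p" using prime_p p_ge by (auto simp: prime_nat_iff)
  ultimately have "c ^ (3 * p) = c ^ 3" by (simp add: power_mult)
  moreover have "c1 ^ p = c1" using k0 by (simp add: \<kappa>_def)
  moreover have "\<sigma> X = fls_const c * X / u ^ ((p + 1) div 3)"
    using sXu h0 u0 Km(2) m1 by (auto simp: H_def field_simps)
  moreover have "\<sigma> Y = fls_const c1 - fls_const (c ^ 3) / u" using sY c03 by simp
  moreover have "p mod 3 = 2" using Km(2) m1 by auto
  ultimately show ?thesis using that[of \<eta> c1 c] e0 \<eta> cnz by (simp add: u_def)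
qed

end

end

section \<open>Counting automorphisms\<close>

context AS_embedding
begin

text \<open>The image of the substitution is a field, so it is onto as soon as it contains
  \<open>X\<close> and \<open>Y\<close>.\<close>

lemma K_aut_subst:
  assumes oc: "on_curve X' Y'" and F': "X' \<in> F" "Y' \<in> F" and XY: "X \<in> subst X' Y' ` F" "Y \<in> subst X' Y' ` F"
  shows "K_aut (restrict (subst X' Y') F)"
proof -
  let ?s = "subst X' Y'"
  have into: "F \<subseteq> {z \<in> F. ?s z \<in> F}"
    by (rule F_least)
       (auto simp: subst_const[OF oc] subst_X[OF oc] subst_Y[OF oc] subst_add[OF oc] subst_mult[OF oc] subst_inverse[OF oc] F'
         intro: F_intros)
  have onto: "F \<subseteq> ?s ` F"
  proof (rule F_least)
    show "fls_const c \<in> ?s ` F" for c using subst_const[OF oc] by (metis F_const image_eqI)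
    show "x + y \<in> ?s ` F" "x * y \<in> ?s ` F" if "x \<in> ?s ` F" "y \<in> ?s ` F" for x y
      using that by (auto simp flip: subst_add[OF oc] subst_mult[OF oc] intro: F_intros)
    show "inverse x \<in> ?s ` F" if "x \<in> ?s ` F" for x
      using that by (auto simp flip: subst_inverse[OF oc] intro: F_intros)
  qed (rule XY)+
  have "bij_betw ?s F F" using into onto subst_inj[OF oc] by (auto simp: bij_betw_def)
  then have "bij_betw (restrict ?s F) F F" by (simp add: bij_betw_restrict_eq)
  then show ?thesis
    by (simp add: K_aut_def F_add F_mult subst_add[OF oc] subst_mult[OF oc] subst_const[OF oc])
qed

lemma K_aut_eqI:
  assumes "K_aut \<sigma>" "K_aut \<tau>" "\<sigma> X = \<tau> X" "\<sigma> Y = \<tau> Y" "z \<in> F"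
  shows "\<sigma> z = \<tau> z"
proof -
  have "F \<subseteq> {z \<in> F. \<sigma> z = \<tau> z}"
    by (rule F_least)
       (auto simp: assms aut_const[OF assms(1)] aut_const[OF assms(2)] aut_add[OF assms(1)] aut_add[OF assms(2)]
         aut_mult[OF assms(1)] aut_mult[OF assms(2)] aut_inverse[OF assms(1)] aut_inverse[OF assms(2)] intro: F_intros)
  then show ?thesis using assms(5) by blast
qed

definition autos :: "('a fls \<Rightarrow> 'a fls) set" where
  "autos = {\<sigma> \<in> extensional F. K_aut \<sigma>}"

lemma inj_on_autos: "inj_on (\<lambda>\<sigma>. (\<sigma> X, \<sigma> Y)) autos"
proof (rule inj_onI)
  fix \<sigma> \<tau> assume st: "\<sigma> \<in> autos" "\<tau> \<in> autos" "(\<sigma> X, \<sigma> Y) = (\<tau> X, \<tau> Y)"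
  show "\<sigma> = \<tau>"
    by (rule extensionalityI[of _ F]) (use st K_aut_eqI[of \<sigma> \<tau>] in \<open>auto simp: autos_def\<close>)
qed

lemma two_nz: "(2 :: 'a) \<noteq> 0"
proof -
  have "\<not> p dvd 2" using p_ge by (auto dest: dvd_imp_le)
  then show ?thesis using of_nat_eq_0_iff_char_dvd[of 2, where 'a = 'a] by (simp add: char_p)
qed

lemma odd_p: "odd p"
  using prime_p p_ge by (auto simp: prime_nat_iff)

end

context normal_AS
begin

text \<open>For nonzero a the power condition says that a^3 lies in the prime field.\<close>

definition scalings :: "'a set" where
  "scalings = {a. a \<noteq> 0 \<and> a ^ (3 * p) = a ^ 3 \<and> (e = 0 \<or> a ^ 2 = 1)}"

abbreviation Fp :: "'a set" where "Fp \<equiv> {b. b ^ p = b}"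

definition fixing_pairs :: "('a fls \<times> 'a fls) set" where
  "fixing_pairs = (\<lambda>(a, b). (fls_const a * X, fls_const (a ^ 3) * Y + fls_const b)) ` (scalings \<times> Fp)"

text \<open>On \<open>Y\<close> these are the Moebius maps over the prime field, of determinant c^3,
  that send \<eta> to infinity.\<close>

definition moving_pairs :: "('a fls \<times> 'a fls) set" where
  "moving_pairs = (\<lambda>(c, b, \<eta>). (fls_const c * X / (Y - fls_const \<eta>) ^ ((p + 1) div 3),
     fls_const b - fls_const (c ^ 3) / (Y - fls_const \<eta>))) ` (scalings \<times> Fp \<times> Fp)"

lemma Y_minus_nz: "Y - fls_const \<eta> \<noteq> 0"
  using nonconst_Y by (auto simp: nonconst_def)

lemma subdegree_Y_minus: "fls_subdegree (Y - fls_const \<eta>) = -3"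
  using subdegree_Y Y_nz by (cases "\<eta> = 0") (auto simp: fls_subdegree_diff_eq1)

lemma subdegree_imp_nonconst: "fls_subdegree z \<noteq> 0 \<Longrightarrow> nonconst z"
  by (auto simp: nonconst_def)

lemma subdegree_moved_X:
  assumes "c \<noteq> 0" "p mod 3 = 2"
  shows "fls_subdegree (fls_const c * X / (Y - fls_const \<eta>) ^ ((p + 1) div 3)) = 1"
proof -
  have "3 * ((p + 1) div 3) = p + 1" using assms(2) by presburger
  then have "3 * int ((p + 1) div 3) = int p + 1" by (metis of_nat_1 of_nat_add of_nat_mult of_nat_numeral)
  then show ?thesis
    using assms(1) X_nz Y_minus_nz[of \<eta>]
    by (simp add: fls_divide_subdegree fls_subdegree_pow subdegree_Y_minus subdegree_X)
qed

lemma fixing_pairs_auto: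
  assumes "(X', Y') \<in> fixing_pairs" shows "(X', Y') \<in> (\<lambda>\<sigma>. (\<sigma> X, \<sigma> Y)) ` autos"
proof -
  obtain a b where ab: "a \<noteq> 0" "a ^ (3 * p) = a ^ 3" "e = 0 \<or> a ^ 2 = 1" "b ^ p = b"
    and X': "X' = fls_const a * X" and Y': "Y' = fls_const (a ^ 3) * Y + fls_const b"
    using assms by (auto simp: fixing_pairs_def scalings_def)
  have ea: "e * a ^ 3 = e * a" using ab(3) by (auto simp: power3_eq_cube power2_eq_square)
  have oc: "on_curve X' Y'"
  proof -
    have "fls_subdegree X' \<noteq> 0" using ab(1) X_nz subdegree_X p_ge by (simp add: X')
    moreover have "Y' ^ p = fls_const (a ^ 3) * Y ^ p + fls_const b"
      using ab by (simp add: Y' fls_freshman power_mult_distrib flip: fls_const_power power_mult)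
    then have "Y' ^ p - Y' = fls_const (a ^ 3) * (Y ^ p - Y)" by (simp add: Y' algebra_simps)
    then have "Y' ^ p - Y' = fls_const (a ^ 3) * X ^ 3 + fls_const (e * a ^ 3) * X"
      by (simp add: curve_eq' algebra_simps flip: fls_const_mult_const)
    ultimately show ?thesis
      by (simp add: on_curve_iff subdegree_imp_nonconst ea X' power_mult_distrib fls_const_power algebra_simps
          flip: fls_const_mult_const)
  qed
  have F': "X' \<in> F" "Y' \<in> F" unfolding X' Y' by (intro F_intros)+
  have "subst X' Y' (fls_const (inverse a) * X) = X"
    using ab(1) by (simp add: subst_mult[OF oc] subst_const[OF oc] subst_X[OF oc]) (simp add: X' flip: mult.assoc)
  moreover have "subst X' Y' (fls_const (inverse a ^ 3) * (Y - fls_const b)) = Y"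
    using ab(1) by (simp add: subst_mult[OF oc] subst_const[OF oc] subst_Y[OF oc] subst_diff[OF oc] F_intros)
       (simp add: Y' power_inverse flip: mult.assoc)
  ultimately have "K_aut (restrict (subst X' Y') F)"
    by (intro K_aut_subst[OF oc F']) (metis F_mult F_const F_X F_Y F_diff image_eqI)+
  then show ?thesis
    by (intro image_eqI[of _ _ "restrict (subst X' Y') F"]) (auto simp: autos_def subst_X[OF oc] subst_Y[OF oc])
qed

lemma moving_pairs_auto:
  assumes "(X', Y') \<in> moving_pairs" and e0: "e = 0" and p3: "p mod 3 = 2"
  shows "(X', Y') \<in> (\<lambda>\<sigma>. (\<sigma> X, \<sigma> Y)) ` autos"
proof -
  obtain c b \<eta> where c: "c \<noteq> 0" "c ^ (3 * p) = c ^ 3" "b ^ p = b" "\<eta> ^ p = \<eta>"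
    and X': "X' = fls_const c * X / (Y - fls_const \<eta>) ^ ((p + 1) div 3)"
    and Y': "Y' = fls_const b - fls_const (c ^ 3) / (Y - fls_const \<eta>)"
    using assms(1) by (auto simp: moving_pairs_def scalings_def)
  define u where "u = Y - fls_const \<eta>"
  define K where "K = (p + 1) div 3"
  define v where "v = fls_const (c ^ 3) * inverse u"
  \<comment> \<open>The cube of the denominator of \<open>X'\<close> is u^(p+1), the common
    denominator that appears in 1/u - 1/u^p = (u^p - u)/u^(p+1).\<close>
  have K: "K * 3 = p + 1" using p3 unfolding K_def by presburger
  have u0: "u \<noteq> 0" using Y_minus_nz by (simp add: u_def)
  have up: "u ^ p = Y ^ p - fls_const \<eta>"
    using fls_freshman[of u "fls_const \<eta>"] c(4) by (simp add: u_def algebra_simps flip: fls_const_power)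
  have X3: "X ^ 3 = u ^ p - u" using curve_eq' e0 unfolding up by (simp add: u_def)
  have oc: "on_curve X' Y'"
  proof -
    have "Y' + v = fls_const b" by (simp add: Y' v_def u_def divide_inverse)
    then have "(Y' + v) ^ p = fls_const b" using c(3) by (simp flip: fls_const_power)
    then have "Y' ^ p = fls_const b - v ^ p" by (simp add: fls_freshman algebra_simps)
    also have "v ^ p = fls_const (c ^ 3) * inverse u ^ p"
      using c(2) by (simp add: v_def power_mult_distrib flip: fls_const_power power_mult)
    finally have "Y' ^ p - Y' = fls_const (c ^ 3) * (inverse u - inverse u ^ p)"
      using \<open>Y' + v = fls_const b\<close> by (simp add: v_def algebra_simps)
    also have "\<dots> = fls_const (c ^ 3) * ((u ^ p - u) / u ^ (p + 1))"
      using u0 by (simp add: field_simps)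
    also have "\<dots> = X' ^ 3"
      by (simp only: X' X3[symmetric] power_divide power_mult_distrib fls_const_power u_def[symmetric]
          K_def[symmetric] power_mult[symmetric] K) simp
    finally have "Y' ^ p - Y' = X' ^ 3" .
    moreover have "nonconst X'" using subdegree_moved_X[OF c(1) p3] by (intro subdegree_imp_nonconst) (simp add: X')
    ultimately show ?thesis by (simp add: on_curve_iff) (simp add: e0)
  qed
  have uF: "u \<in> F" unfolding u_def by (intro F_intros)
  have F': "X' \<in> F" "Y' \<in> F" unfolding X' Y' by (intro F_intros)+
  \<comment> \<open>Solving Y' = b - c^3/u for u gives the preimage of u.\<close>
  define w where "w = fls_const (c ^ 3) * inverse (fls_const b - Y)"
  have wF: "w \<in> F" unfolding w_def by (intro F_intros)
  have sw: "subst X' Y' w = u"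
    unfolding w_def using u0 c(1)
    by (simp add: subst_mult[OF oc] subst_inverse[OF oc] subst_diff[OF oc] subst_const[OF oc] subst_Y[OF oc] F_intros)
       (simp add: Y' u_def[symmetric])
  have "subst X' Y' (w + fls_const \<eta>) = Y"
    by (simp add: subst_add[OF oc] wF sw subst_const[OF oc]) (simp add: u_def)
  moreover have "subst X' Y' (X * w ^ K * fls_const (inverse c)) = X"
  proof -
    have "X' * u ^ K = fls_const c * X" using u0 by (simp only: X' u_def[symmetric] K_def[symmetric]) simp
    then have "X' * u ^ K * fls_const (inverse c) = X" using c(1)
      by (simp add: mult.commute[of "fls_const c"] mult.assoc)
    then show ?thesis by (simp add: subst_mult[OF oc] subst_power[OF oc] wF sw subst_const[OF oc] subst_X[OF oc] F_intros)
  qed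
  ultimately have "K_aut (restrict (subst X' Y') F)"
    by (intro K_aut_subst[OF oc F']) (metis F_mult F_const F_X F_add F_power wF image_eqI)+
  then show ?thesis
    by (intro image_eqI[of _ _ "restrict (subst X' Y') F"]) (auto simp: autos_def subst_X[OF oc] subst_Y[OF oc])
qed

lemma auto_fixes_or_moves:
  assumes aut: "K_aut \<sigma>"
  shows "(\<sigma> X, \<sigma> Y) \<in> fixing_pairs \<or> e = 0 \<and> p mod 3 = 2 \<and> (\<sigma> X, \<sigma> Y) \<in> moving_pairs"
proof (cases "\<sigma> ` V_inf = V_inf")
  case True
  obtain a b where "\<sigma> X = fls_const a * X" "\<sigma> Y = fls_const (a ^ 3) * Y + fls_const b"
    "a \<noteq> 0" "a ^ (3 * p) = a ^ 3" "b ^ p = b" "e = 0 \<or> a ^ 2 = 1"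
    by (rule aut_fixing_infinity[OF aut True])
  then have "(\<sigma> X, \<sigma> Y) \<in> fixing_pairs"
    unfolding fixing_pairs_def scalings_def by (intro image_eqI[of _ _ "(a, b)"]) auto
  then show ?thesis ..
next
  case False
  obtain c b \<eta> where c: "e = 0" "p mod 3 = 2" "\<eta> ^ p = \<eta>" "b ^ p = b" "c \<noteq> 0" "c ^ (3 * p) = c ^ 3"
    "\<sigma> X = fls_const c * X / (Y - fls_const \<eta>) ^ ((p + 1) div 3)"
    "\<sigma> Y = fls_const b - fls_const (c ^ 3) / (Y - fls_const \<eta>)"
    by (rule aut_moving_infinity[OF aut False])
  have "(\<sigma> X, \<sigma> Y) \<in> moving_pairs"
    unfolding moving_pairs_def scalings_def by (rule image_eqI[of _ _ "(c, b, \<eta>)"]) (use c in auto)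
  then show ?thesis using c by blast
qed

lemma inj_fixing: "inj_on (\<lambda>(a, b). (fls_const a * X, fls_const (a ^ 3) * Y + fls_const b)) (scalings \<times> Fp)"
proof (rule inj_onI, clarify)
  fix a b a' b'
  assume 1: "fls_const a * X = fls_const a' * X" and 2: "fls_const (a ^ 3) * Y + fls_const b = fls_const (a' ^ 3) * Y + fls_const b'"
  have cinj: "fls_const x = fls_const y \<Longrightarrow> x = y" for x y :: 'a by (metis fls_const_nth)
  have "a = a'" using 1 X_nz cinj by simp
  then show "a = a' \<and> b = b'" using 2 cinj by simp
qed

lemma inj_moving:
  "inj_on (\<lambda>(c, b, \<eta>). (fls_const c * X / (Y - fls_const \<eta>) ^ ((p + 1) div 3),
     fls_const b - fls_const (c ^ 3) / (Y - fls_const \<eta>))) (scalings \<times> Fp \<times> Fp)"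
proof (rule inj_onI, unfold split_paired_all prod.case prod.inject mem_Times_iff fst_conv snd_conv, elim conjE)
  fix c b \<eta> c' b' \<eta>'
  assume sc: "c \<in> scalings" "c' \<in> scalings"
    and 1: "fls_const c * X / (Y - fls_const \<eta>) ^ ((p + 1) div 3) = fls_const c' * X / (Y - fls_const \<eta>') ^ ((p + 1) div 3)"
    and 2: "fls_const b - fls_const (c ^ 3) / (Y - fls_const \<eta>) = fls_const b' - fls_const (c' ^ 3) / (Y - fls_const \<eta>')"
  have cinj: "fls_const x = fls_const y \<Longrightarrow> x = y" for x y :: 'a by (metis fls_const_nth)
  let ?u = "Y - fls_const \<eta>" and ?v = "Y - fls_const \<eta>'"
  \<comment> \<open>The difference of the two images of \<open>Y\<close> with denominators cleared.
    It vanishes at the transcendental \<open>Y\<close>, so its coefficients give b, c^3 and \<eta>;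
    then c comes from the images of \<open>X\<close>.\<close>
  define P where "P = smult (b - b') ([:-\<eta>, 1:] * [:-\<eta>', 1:]) - smult (c ^ 3) [:-\<eta>', 1:] + smult (c' ^ 3) [:-\<eta>, 1:]"
  have lin: "peval Y [:-x, 1:] = Y - fls_const x" for x by (simp add: peval_pCons)
  have "peval Y P = fls_const (b - b') * (?u * ?v) - fls_const (c ^ 3) * ?v + fls_const (c' ^ 3) * ?u"
    unfolding P_def peval_add peval_diff peval_mult heval_smult[OF unital_hom_fls_const] lin ..
  also have "\<dots> = ((fls_const b - fls_const (c ^ 3) / ?u) - (fls_const b' - fls_const (c' ^ 3) / ?v)) * (?u * ?v)"
  proof -
    obtain U V where UV: "?u = U" "?v = V" by simp
    then have "U \<noteq> 0" "V \<noteq> 0" using Y_minus_nz by metis+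
    then show ?thesis unfolding UV by (simp add: algebra_simps flip: fls_minus_const)
  qed
  also have "\<dots> = 0" by (simp only: 2 diff_self mult_zero_left)
  finally have "P = 0" using peval_nonzero[OF alg nonconst_Y] by blast
  then have cf: "coeff P n = 0" for n by simp
  have b: "b = b'" using cf[of 2] by (simp add: P_def numeral_2_eq_2)
  have c3: "c ^ 3 = c' ^ 3" using cf[of 1] b by (simp add: P_def)
  have "c ^ 3 * (\<eta>' - \<eta>) = 0" using cf[of 0] b c3 by (simp add: P_def algebra_simps)
  then have \<eta>: "\<eta> = \<eta>'" using sc by (auto simp: scalings_def)
  have "c = c'" using 1 \<eta> X_nz Y_minus_nz[of \<eta>'] cinj by simp
  then show "c = c' \<and> b = b' \<and> \<eta> = \<eta>'" using b \<eta> by blast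
qed

text \<open>For e = 0 these are the roots of T^(3(p-1)) - 1, which are simple since p does not
  divide 3(p-1); otherwise only 1 and -1 remain.\<close>

lemma card_scalings: "card scalings = (if e = 0 then 3 * (p - 1) else 2)"
proof (cases "e = 0")
  case True
  define n where "n = 3 * (p - 1)"
  have n: "3 * p = n + 3" "n > 0" using p_ge by (auto simp: n_def)
  define q :: "'a poly" where "q = [:0, 1:] ^ n + [:-1:]"
  have deg: "degree q = n"
    using n degree_add_eq_left[of "[:-1:]" "[:0, 1::'a:] ^ n"] by (simp add: q_def degree_power_eq)
  have ev: "poly q x = x ^ n - 1" for x by (simp add: q_def)
  have "(of_nat n :: 'a) \<noteq> 0"
  proof -
    have "\<not> p dvd 3" "\<not> p dvd p - 1" using p_ge by (auto dest: dvd_imp_le)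
    then have "\<not> p dvd n" using prime_p by (simp add: n_def prime_dvd_mult_iff)
    then show ?thesis by (simp add: of_nat_eq_0_iff_char_dvd char_p)
  qed
  moreover have "poly (pderiv q) x = of_nat n * x ^ (n - 1)" for x
    by (simp add: q_def pderiv_add pderiv_power pderiv_pCons)
  ultimately have "\<forall>x. poly q x = 0 \<longrightarrow> poly (pderiv q) x \<noteq> 0" using n by (auto simp: ev power_0_left)
  then have "card {x. poly q x = 0} = degree q"
    using deg n by (intro card_roots_separable[OF alg]) auto
  moreover have "scalings = {x. poly q x = 0}"
  proof -
    have "a ^ (3 * p) = a ^ 3 \<longleftrightarrow> a ^ n = 1" if "a \<noteq> 0" for a :: 'a
      using that unfolding n(1) power_add by simp
    moreover have "a \<noteq> 0" if "a ^ n = 1" for a :: 'a using that n(2) by (auto simp: power_0_left)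
    ultimately show ?thesis unfolding scalings_def ev using True by (simp only: right_minus_eq) blast
  qed
  ultimately show ?thesis using True deg by (simp add: n_def)
next
  case False
  have "scalings = {1, -1}"
    using False odd_p by (auto simp: scalings_def power2_eq_1_iff)
  moreover have "(1 :: 'a) \<noteq> -1"
    using two_nz by (metis add.right_inverse one_add_one)
  ultimately show ?thesis using False by simp
qed

lemma card_autos:
  "card autos = (if e \<noteq> 0 then 2 * p else if p mod 3 = 2 then 3 * (p - 1) * p * (p + 1) else 3 * (p - 1) * p)"
proof -
  have c1: "card fixing_pairs = card scalings * p"
    unfolding fixing_pairs_def by (simp add: card_image[OF inj_fixing] card_cartesian_product card_Frobenius_fixed)
  have c2: "card moving_pairs = card scalings * (p * p)"
    unfolding moving_pairs_def card_image[OF inj_moving] by (simp add: card_cartesian_product card_Frobenius_fixed)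
  have fin: "finite fixing_pairs" "finite moving_pairs"
    using c1 c2 p_ge by (auto intro!: card_ge_0_finite simp: card_scalings)
  have "card autos = card ((\<lambda>\<sigma>. (\<sigma> X, \<sigma> Y)) ` autos)" using inj_on_autos by (simp add: card_image)
  also have "(\<lambda>\<sigma>. (\<sigma> X, \<sigma> Y)) ` autos = fixing_pairs \<union> (if e = 0 \<and> p mod 3 = 2 then moving_pairs else {})"
  proof (intro equalityI subsetI)
    fix r assume "r \<in> (\<lambda>\<sigma>. (\<sigma> X, \<sigma> Y)) ` autos"
    then obtain \<sigma> where \<sigma>: "K_aut \<sigma>" "r = (\<sigma> X, \<sigma> Y)" by (auto simp: autos_def)
    show "r \<in> fixing_pairs \<union> (if e = 0 \<and> p mod 3 = 2 then moving_pairs else {})"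
      using auto_fixes_or_moves[OF \<sigma>(1)] unfolding \<sigma>(2)
    proof
      assume "(\<sigma> X, \<sigma> Y) \<in> fixing_pairs"
      then show "(\<sigma> X, \<sigma> Y) \<in> fixing_pairs \<union> (if e = 0 \<and> p mod 3 = 2 then moving_pairs else {})" by (rule UnI1)
    next
      assume m: "e = 0 \<and> p mod 3 = 2 \<and> (\<sigma> X, \<sigma> Y) \<in> moving_pairs"
      then have "(if e = 0 \<and> p mod 3 = 2 then moving_pairs else {}) = moving_pairs" by (intro if_P) blast
      then show "(\<sigma> X, \<sigma> Y) \<in> fixing_pairs \<union> (if e = 0 \<and> p mod 3 = 2 then moving_pairs else {})"
        using m by blast
    qed
  next
    fix r assume r: "r \<in> fixing_pairs \<union> (if e = 0 \<and> p mod 3 = 2 then moving_pairs else {})"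
    show "r \<in> (\<lambda>\<sigma>. (\<sigma> X, \<sigma> Y)) ` autos"
    proof (cases "r \<in> fixing_pairs")
      case True
      then show ?thesis using fixing_pairs_auto by (cases r) simp
    next
      case False
      then have r': "r \<in> (if e = 0 \<and> p mod 3 = 2 then moving_pairs else {})" using r by blast
      have c: "e = 0 \<and> p mod 3 = 2"
      proof (rule ccontr)
        assume "\<not> (e = 0 \<and> p mod 3 = 2)"
        then show False using r' by (simp only: if_False empty_iff)
      qed
      have "r \<in> moving_pairs" using r' unfolding if_P[OF c] .
      with c show ?thesis using moving_pairs_auto by (cases r) blast
    qed
  qed
  finally have card: "card autos = card (fixing_pairs \<union> (if e = 0 \<and> p mod 3 = 2 then moving_pairs else {}))" .
  show ?thesis
  proof (cases "e = 0 \<and> p mod 3 = 2")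
    case True
    \<comment> \<open>At infinity \<sigma>(X) has order -p in the first family and order 1 in the
      second.\<close>
    have "fixing_pairs \<inter> moving_pairs = {}"
    proof (rule ccontr)
      assume "fixing_pairs \<inter> moving_pairs \<noteq> {}"
      then obtain a c \<eta> where ac: "a \<noteq> 0" "c \<noteq> 0" "fls_const a * X = fls_const c * X / (Y - fls_const \<eta>) ^ ((p + 1) div 3)"
        by (auto simp: fixing_pairs_def moving_pairs_def scalings_def)
      have "fls_subdegree (fls_const a * X) = - int p" using ac(1) X_nz by (simp add: subdegree_X)
      moreover have "p mod 3 = 2" using True by blast
      ultimately show False using subdegree_moved_X[OF ac(2), of \<eta>] unfolding ac(3) by simp
    qed
    then have "card autos = card fixing_pairs + card moving_pairs"
      using card True fin by (simp add: card_Un_disjoint)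
    also have "\<dots> = 3 * (p - 1) * p + 3 * (p - 1) * (p * p)"
      unfolding c1 c2 card_scalings using True by simp
    \<comment> \<open>The factor p + 1 counts the possible images of infinity: infinity itself and
      the p values of \<eta>.\<close>
    also have "\<dots> = 3 * (p - 1) * p * (p + 1)" by (simp only: distrib_left mult_1_right mult.assoc add.commute)
    finally show ?thesis using True by simp
  next
    case False
    then show ?thesis using card c1 by (auto simp: card_scalings)
  qed
qed

end

section \<open>Transfer to the abstract function field\<close>

context AS_embedding
begin

abbreviation C :: "'a poly fract poly set" where "C \<equiv> {q. degree q < p}"
abbreviation R :: "'a poly fract poly ring" where "R \<equiv> AS_field p d e l"
abbreviation \<Phi> :: "'a poly fract poly \<Rightarrow> 'a fls" where "\<Phi> \<equiv> curve_eval X Y"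
abbreviation \<Psi> :: "'a fls \<Rightarrow> 'a poly fract poly" where "\<Psi> \<equiv> inv_into C \<Phi>"

lemma carrier_R: "carrier R = C" by (simp add: AS_field_def)

lemma R_add: "a \<oplus>\<^bsub>R\<^esub> b = a + b" and R_one: "\<one>\<^bsub>R\<^esub> = 1" by (simp_all add: AS_field_def)

lemma bij_\<Phi>: "bij_betw \<Phi> C F"
  unfolding bij_betw_def
proof
  show "inj_on \<Phi> C"
  proof (rule inj_onI)
    fix q r assume qr: "q \<in> C" "r \<in> C" "\<Phi> q = \<Phi> r"
    then have "\<Phi> (q - r) = 0" by (simp add: unital_hom_diff[OF hom_ev[OF nonconst_X]])
    moreover have "degree (q - r) < p" using qr degree_diff_less by auto
    ultimately show "q = r" using ev_inj by fastforce
  qed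
  show "\<Phi> ` C = F" using F_rep by (auto simp: F_def)
qed

lemma \<Phi>_F: "\<Phi> q \<in> F" by (simp add: F_def)
lemma \<Psi>_C: "z \<in> F \<Longrightarrow> \<Psi> z \<in> C"
  using bij_\<Phi> inv_into_into by (metis bij_betw_imp_surj_on)
lemma \<Phi>_\<Psi>: "z \<in> F \<Longrightarrow> \<Phi> (\<Psi> z) = z"
  using bij_\<Phi> by (metis bij_betw_inv_into_right)
lemma \<Psi>_\<Phi>: "q \<in> C \<Longrightarrow> \<Psi> (\<Phi> q) = q"
  using bij_\<Phi> by (metis bij_betw_inv_into_left)
lemma bij_\<Psi>: "bij_betw \<Psi> F C"
  by (rule bij_betw_inv_into[OF bij_\<Phi>])

lemma C_add: "q \<in> C \<Longrightarrow> r \<in> C \<Longrightarrow> q + r \<in> C" by (simp add: degree_add_less)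
lemma C_mult: "q \<otimes>\<^bsub>R\<^esub> r \<in> C" using degree_mod_less by (simp add: AS_field_def)
lemma C_Kemb: "Kemb c \<in> C" using p_ge by (simp add: Kemb_def)
lemma C_1: "1 \<in> C" using p_ge by simp

lemma \<Phi>_add: "\<Phi> (q + r) = \<Phi> q + \<Phi> r"
  using hom_ev[OF nonconst_X] by (simp add: unital_hom_def)
lemma \<Phi>_1: "\<Phi> 1 = 1"
  using hom_ev[OF nonconst_X] by (simp add: unital_hom_def)
lemma \<Phi>_mult: "\<Phi> (q \<otimes>\<^bsub>R\<^esub> r) = \<Phi> q * \<Phi> r"
  using hom_ev[OF nonconst_X] by (simp add: AS_field_def ev_mod[OF on_curve_XY] unital_hom_def)

lemma \<Psi>_add: "x \<in> F \<Longrightarrow> y \<in> F \<Longrightarrow> \<Psi> (x + y) = \<Psi> x + \<Psi> y"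
  using \<Psi>_\<Phi>[OF C_add[OF \<Psi>_C \<Psi>_C], of x y] by (simp only: \<Phi>_add \<Phi>_\<Psi>)
lemma \<Psi>_mult: "x \<in> F \<Longrightarrow> y \<in> F \<Longrightarrow> \<Psi> (x * y) = \<Psi> x \<otimes>\<^bsub>R\<^esub> \<Psi> y"
  using \<Psi>_\<Phi>[OF C_mult, of "\<Psi> x" "\<Psi> y"] by (simp only: \<Phi>_mult \<Phi>_\<Psi>)
lemma \<Psi>_1: "\<Psi> 1 = 1"
  using \<Psi>_\<Phi>[OF C_1] by (simp only: \<Phi>_1)
lemma \<Psi>_const: "\<Psi> (fls_const c) = Kemb c"
  using \<Psi>_\<Phi>[OF C_Kemb] by (simp only: ev_Kemb[OF nonconst_X])

text \<open>Preservation of 1 follows from that of the constants, as 1 is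
  \<open>Kemb 1\<close>.\<close>

lemma AutK_iff:
  "\<sigma> \<in> AutK R \<longleftrightarrow> \<sigma> \<in> extensional C \<and> bij_betw \<sigma> C C \<and>
    (\<forall>q\<in>C. \<forall>r\<in>C. \<sigma> (q + r) = \<sigma> q + \<sigma> r \<and> \<sigma> (q \<otimes>\<^bsub>R\<^esub> r) = \<sigma> q \<otimes>\<^bsub>R\<^esub> \<sigma> r) \<and> (\<forall>c. \<sigma> (Kemb c) = Kemb c)"
proof -
  have "Kemb 1 = (1 :: 'a poly fract poly)"
    unfolding Kemb_def one_pCons[symmetric] One_fract_def[symmetric] ..
  then have "\<sigma> 1 = 1" if "\<forall>c. \<sigma> (Kemb c) = Kemb c" using that by metis
  then show ?thesis
    unfolding AutK_def K_iso_def ring_iso_def ring_hom_def carrier_R R_add R_one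
    by (auto simp: bij_betw_def)
qed

lemma AutK_to_autos:
  assumes "\<sigma> \<in> AutK R" shows "restrict (\<Phi> \<circ> \<sigma> \<circ> \<Psi>) F \<in> autos"
proof -
  have \<sigma>: "bij_betw \<sigma> C C" "\<And>q r. q \<in> C \<Longrightarrow> r \<in> C \<Longrightarrow> \<sigma> (q + r) = \<sigma> q + \<sigma> r"
    "\<And>q r. q \<in> C \<Longrightarrow> r \<in> C \<Longrightarrow> \<sigma> (q \<otimes>\<^bsub>R\<^esub> r) = \<sigma> q \<otimes>\<^bsub>R\<^esub> \<sigma> r" "\<And>c. \<sigma> (Kemb c) = Kemb c"
    using assms unfolding AutK_iff by blast+
  have "bij_betw (\<Phi> \<circ> \<sigma> \<circ> \<Psi>) F F"
    by (intro bij_betw_trans[OF bij_\<Psi>] bij_betw_trans[OF \<sigma>(1)] bij_\<Phi>)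
  then have "bij_betw (restrict (\<Phi> \<circ> \<sigma> \<circ> \<Psi>) F) F F" by (simp only: bij_betw_restrict_eq)
  then show ?thesis
    by (simp add: autos_def K_aut_def F_add F_mult \<Psi>_add \<Psi>_mult \<Psi>_C[simplified] \<sigma>[simplified] \<Phi>_add \<Phi>_mult \<Psi>_const ev_Kemb[OF nonconst_X])
qed

lemma autos_to_AutK:
  assumes "\<tau> \<in> autos" shows "restrict (\<Psi> \<circ> \<tau> \<circ> \<Phi>) C \<in> AutK R"
proof -
  have aut: "K_aut \<tau>" using assms by (simp add: autos_def)
  have "bij_betw (\<Psi> \<circ> \<tau> \<circ> \<Phi>) C C"
    using aut by (intro bij_betw_trans[OF bij_\<Phi>] bij_betw_trans[OF _ bij_\<Psi>]) (simp add: K_aut_def)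
  then have "bij_betw (restrict (\<Psi> \<circ> \<tau> \<circ> \<Phi>) C) C C" by (simp only: bij_betw_restrict_eq)
  moreover define s where "s = restrict (\<Psi> \<circ> \<tau> \<circ> \<Phi>) C"
  moreover have sC: "s q = \<Psi> (\<tau> (\<Phi> q))" if "q \<in> C" for q
    unfolding s_def using that by (simp only: restrict_apply comp_def if_True)
  moreover have "s (q + r) = s q + s r" "s (q \<otimes>\<^bsub>R\<^esub> r) = s q \<otimes>\<^bsub>R\<^esub> s r" if "q \<in> C" "r \<in> C" for q r
    by (simp_all only: sC that C_add C_mult \<Phi>_add \<Phi>_mult aut_add[OF aut] aut_mult[OF aut] \<Phi>_F aut_F[OF aut] \<Psi>_add \<Psi>_mult)
  moreover have "s (Kemb c) = Kemb c" for c
    by (simp only: sC C_Kemb ev_Kemb[OF nonconst_X] aut_const[OF aut] \<Psi>_const)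
  ultimately show ?thesis unfolding AutK_iff using restrict_extensional by blast
qed

text \<open>Conjugation by \<Phi>; restricting to the carrier on either side keeps functions
  extensional, so the two conjugations are mutually inverse.\<close>

lemma card_AutK: "card (AutK R) = card autos"
proof (rule bij_betw_same_card)
  show "bij_betw (\<lambda>\<sigma>. restrict (\<Phi> \<circ> \<sigma> \<circ> \<Psi>) F) (AutK R) autos"
  proof (rule bij_betw_byWitness[where f' = "\<lambda>\<tau>. restrict (\<Psi> \<circ> \<tau> \<circ> \<Phi>) C"])
    show "\<forall>\<sigma>\<in>AutK R. restrict (\<Psi> \<circ> restrict (\<Phi> \<circ> \<sigma> \<circ> \<Psi>) F \<circ> \<Phi>) C = \<sigma>"
    proof
      fix \<sigma> assume "\<sigma> \<in> AutK R"
      then have s: "\<sigma> \<in> extensional C" "bij_betw \<sigma> C C" unfolding AutK_iff by blast+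
      have "\<sigma> q \<in> C" if "q \<in> C" for q using s(2) that by (metis bij_betw_apply)
      then show "restrict (\<Psi> \<circ> restrict (\<Phi> \<circ> \<sigma> \<circ> \<Psi>) F \<circ> \<Phi>) C = \<sigma>"
        by (intro extensionalityI[OF restrict_extensional s(1)]) (simp only: restrict_apply comp_def if_True \<Phi>_F \<Psi>_\<Phi>)
    qed
    show "\<forall>\<tau>\<in>autos. restrict (\<Phi> \<circ> restrict (\<Psi> \<circ> \<tau> \<circ> \<Phi>) C \<circ> \<Psi>) F = \<tau>"
    proof
      fix \<tau> assume t: "\<tau> \<in> autos"
      then have aut: "K_aut \<tau>" by (simp add: autos_def)
      show "restrict (\<Phi> \<circ> restrict (\<Psi> \<circ> \<tau> \<circ> \<Phi>) C \<circ> \<Psi>) F = \<tau>"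
      proof (rule extensionalityI[OF restrict_extensional])
        show "\<tau> \<in> extensional F" using t by (simp add: autos_def)
      qed (simp only: restrict_apply comp_def if_True \<Psi>_C \<Phi>_\<Psi> aut_F[OF aut])
    qed
  qed (use AutK_to_autos autos_to_AutK in auto)
qed

lemma place_image_\<Phi>:
  assumes "is_place R V" shows "place (\<Phi> ` V)"
proof -
  have sr: "subring V R" and ne: "V \<noteq> C" and K: "range Kemb \<subseteq> V"
    and val: "\<And>z. z \<in> C \<Longrightarrow> z \<notin> V \<Longrightarrow> \<exists>w\<in>V. z \<otimes>\<^bsub>R\<^esub> w = 1"
    using assms unfolding is_place_def carrier_R R_one by blast+
  have VC: "V \<subseteq> C" using subringE(1)[OF sr] by (simp only: carrier_R)
  have cl: "q + r \<in> V" "q \<otimes>\<^bsub>R\<^esub> r \<in> V" if "q \<in> V" "r \<in> V" for q r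
    using subringE(6,7)[OF sr] that by (simp_all only: R_add)
  have inj: "inj_on \<Phi> C" using bij_\<Phi> by (simp add: bij_betw_def)
  show ?thesis
    unfolding place_def
  proof (intro conjI allI ballI impI)
    show "\<Phi> ` V \<noteq> F"
      using ne VC inj bij_\<Phi> by (metis bij_betw_imp_surj_on inj_on_image_eq_iff subset_refl)
    show "fls_const c \<in> \<Phi> ` V" for c
      using K ev_Kemb[OF nonconst_X, of Y c] by (metis image_eqI rangeI subsetD)
    show "x + y \<in> \<Phi> ` V" "x * y \<in> \<Phi> ` V" if "x \<in> \<Phi> ` V" "y \<in> \<Phi> ` V" for x y
      using that cl by (auto simp flip: \<Phi>_add \<Phi>_mult)
    fix z assume z: "z \<in> F" "z \<notin> \<Phi> ` V"
    then have "\<Psi> z \<notin> V" using \<Phi>_\<Psi>[OF z(1)] by (metis image_eqI)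
    then obtain w where w: "w \<in> V" "\<Psi> z \<otimes>\<^bsub>R\<^esub> w = 1" using val \<Psi>_C[OF z(1)] by blast
    have "z * \<Phi> w = 1" using \<Phi>_mult[of "\<Psi> z" w] by (simp only: w(2) \<Phi>_1 \<Phi>_\<Psi>[OF z(1)])
    then have "inverse z = \<Phi> w" by (rule inverse_unique)
    then show "inverse z \<in> \<Phi> ` V" using w by blast
  qed (use \<Phi>_F in auto)
qed

lemma AutK_fixes_place:
  assumes \<sigma>: "\<sigma> \<in> AutK R" and V: "V \<subseteq> C" and fixed: "restrict (\<Phi> \<circ> \<sigma> \<circ> \<Psi>) F ` (\<Phi> ` V) = \<Phi> ` V"
  shows "\<sigma> ` V = V"
proof -
  have "bij_betw \<sigma> C C" using \<sigma> unfolding AutK_iff by blast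
  then have VC: "\<sigma> ` V \<subseteq> C" using V by (auto simp: bij_betw_def)
  have "restrict (\<Phi> \<circ> \<sigma> \<circ> \<Psi>) F ` (\<Phi> ` V) = \<Phi> ` (\<sigma> ` V)"
    unfolding image_image
    by (rule image_cong[OF refl]) (use V in \<open>auto simp: \<Phi>_F \<Psi>_\<Phi>[simplified]\<close>)
  then have "\<Phi> ` (\<sigma> ` V) = \<Phi> ` V" using fixed by simp
  then show ?thesis using VC V bij_\<Phi> inj_on_image_eq_iff[of \<Phi> C] by (simp only: bij_betw_def)
qed

end

section \<open>Existence of the expansion and reduction to normal form\<close>

lemma curves_isomorphic_same_image:
  assumes "AS_embedding p d e l X Y" "AS_embedding p d' e' l' X' Y'"
    and eq: "AS_embedding.F X Y = AS_embedding.F X' Y'"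
  shows "curves_isomorphic (AS_field p d e l) (AS_field p d' e' l')"
proof -
  interpret A: AS_embedding p d e l X Y by (rule assms)
  interpret B: AS_embedding p d' e' l' X' Y' by (rule assms)
  \<comment> \<open>Both function fields have the same image in the Laurent field: evaluate in one
    presentation and read off the representative in the other.\<close>
  let ?\<phi> = "B.\<Psi> \<circ> A.\<Phi>"
  have "bij_betw ?\<phi> A.C A.C"
    by (rule bij_betw_trans[OF A.bij_\<Phi>]) (use B.bij_\<Psi> eq in simp)
  moreover have "A.\<Phi> q \<in> B.F" for q using A.\<Phi>_F eq by simp
  moreover have "?\<phi> (Kemb c) = Kemb c" for c
    by (simp only: comp_def A.ev_Kemb[OF A.nonconst_X] B.\<Psi>_const)
  ultimately have "?\<phi> \<in> K_iso (AS_field p d e l) (AS_field p d' e' l')"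
    unfolding K_iso_def ring_iso_def ring_hom_def A.carrier_R B.carrier_R A.R_add B.R_add A.R_one B.R_one mem_Collect_eq
    by (simp only: comp_def A.\<Phi>_add A.\<Phi>_mult A.\<Phi>_1 B.\<Psi>_add B.\<Psi>_mult B.\<Psi>_1 bij_betw_def Pi_def mem_Collect_eq) blast
  then show ?thesis unfolding curves_isomorphic_def by blast
qed

text \<open>With a parameter s put Y = s^-3 and X = V s^-p. The equation becomes V^3 + e s^(2p) V =
  1 - s^(3p-3), whose simple root V = 1 modulo s is lifted by \<open>fps_hensel\<close>.\<close>

lemma normal_AS_exists:
  fixes e :: "'a::field"
  assumes alg: "alg_closed_field TYPE('a)" and pr: "Factorial_Ring.prime p" and p5: "p \<ge> 5" and ch: "CHAR('a) = p"
  obtains X Y where "normal_AS p e X Y"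
proof -
  have three: "(3 :: 'a) \<noteq> 0"
  proof -
    have "\<not> p dvd 3" using p5 by (auto dest: dvd_imp_le)
    then show ?thesis using of_nat_eq_0_iff_char_dvd[of 3, where 'a = 'a] by (simp add: ch)
  qed
  define P :: "'a fps poly" where "P = [:fps_X ^ (3 * p - 3) - 1, fps_const e * fps_X ^ (2 * p), 0, 1:]"
  have evP: "poly P u = u ^ 3 + fps_const e * fps_X ^ (2 * p) * u - (1 - fps_X ^ (3 * p - 3))" for u
    by (simp add: P_def power3_eq_cube algebra_simps)
  have "poly (pderiv P) u = 3 * u ^ 2 + fps_const e * fps_X ^ (2 * p)" for u
    by (simp add: P_def pderiv_pCons power2_eq_square algebra_simps)
  then obtain U where U: "U $ 0 = 1" "poly P U = 0"
    using fps_hensel[of P 1] three p5 by (auto simp: evP fps_power_zeroth power_0_left)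
  define s where "s = (fls_X :: 'a fls)"
  have s0: "s \<noteq> 0" "fls_subdegree s = 1" by (simp_all add: s_def)
  define V where "V = fps_to_fls U"
  have "U ^ 3 + fps_const e * fps_X ^ (2 * p) * U = 1 - fps_X ^ (3 * p - 3)" using U(2) by (simp add: evP)
  then have "fps_to_fls (U ^ 3 + fps_const e * fps_X ^ (2 * p) * U) = fps_to_fls (1 - fps_X ^ (3 * p - 3))" by simp
  then have VE: "V ^ 3 + fls_const e * s ^ (2 * p) * V = 1 - s ^ (3 * p - 3)"
    by (simp add: V_def s_def fps_to_fls_power fls_times_fps_to_fls)
  have V0: "V \<noteq> 0" "fls_subdegree V = 0"
    using U(1) by (auto simp: V_def fls_subdegree_fls_to_fps intro!: subdegreeI)
  define X where "X = V / s ^ p"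
  define Y where "Y = 1 / s ^ 3"
  have e1: "s ^ (3 * p) = s ^ (2 * p) * s ^ p" by (simp flip: power_add)
  have e2: "s ^ (3 * p) = s ^ (3 * p - 3) * s ^ 3" using p5 by (simp flip: power_add)
  have "X ^ 3 + fls_const e * X = V ^ 3 / s ^ (3 * p) + fls_const e * V * s ^ (2 * p) / s ^ (3 * p)"
  proof -
    have "X ^ 3 = V ^ 3 / s ^ (3 * p)" by (simp add: X_def power_divide mult.commute flip: power_mult)
    moreover have "fls_const e * X = fls_const e * V * s ^ (2 * p) / s ^ (3 * p)" unfolding e1 X_def by (simp add: s0)
    ultimately show ?thesis by simp
  qed
  also have "\<dots> = (V ^ 3 + fls_const e * s ^ (2 * p) * V) / s ^ (3 * p)"
    by (simp add: add_divide_distrib mult_ac)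
  also have "\<dots> = 1 / s ^ (3 * p) - s ^ (3 * p - 3) / s ^ (3 * p)"
    by (simp add: VE diff_divide_distrib)
  also have "s ^ (3 * p - 3) / s ^ (3 * p) = Y" by (simp add: e2 Y_def s0)
  also have "1 / s ^ (3 * p) = Y ^ p" by (simp add: Y_def power_divide flip: power_mult)
  finally have "Y ^ p - Y = X ^ 3 + fls_const 0 * X ^ 2 + fls_const e * X + fls_const 0" by simp
  moreover have "fls_subdegree X = - int p" "fls_subdegree Y = -3"
    using V0 by (simp_all add: X_def Y_def fls_divide_subdegree fls_subdegree_pow s0)
  ultimately have "normal_AS p e X Y"
    unfolding normal_AS_def by (intro AS_embedding.intro alg pr p5 ch)
  then show ?thesis using that by blast
qed

text \<open>Completing the cube removes d, and a root of \<mu> - \<mu>^p = l' absorbs the constant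
  term. Both pairs of coordinates generate the same field, so places and automorphisms inside the
  Laurent field are literally the same for both equations.\<close>

lemma AS_embedding_normalize:
  fixes d e l :: "'a::field"
  assumes alg: "alg_closed_field TYPE('a)" and pr: "Factorial_Ring.prime p" and p5: "p \<ge> 5" and ch: "CHAR('a) = p"
  obtains E X Y x y \<delta> where "normal_AS p E X Y" "AS_embedding p d e l x y" "AS_embedding.F x y = AS_embedding.F X Y"
    "X = x + fls_const \<delta>"
proof -
  define \<delta> where "\<delta> = d / 3"
  define E where "E = e - 3 * \<delta> ^ 2"
  define l' where "l' = 2 * \<delta> ^ 3 - e * \<delta> + l"
  obtain X Y where N: "normal_AS p E X Y" by (rule normal_AS_exists[OF assms])
  interpret N: normal_AS p E X Y by (rule N)
  have d: "d = 3 * \<delta>" using N.three_nz by (simp add: \<delta>_def)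
  have "degree ([:0, 1::'a:] ^ p + [:l', -1:]) = p"
    using p5 degree_add_eq_left[of "[:l', -1:]" "[:0, 1::'a:] ^ p"] by (simp add: degree_power_eq)
  then obtain \<mu> where "poly ([:0, 1:] ^ p + [:l', -1:]) \<mu> = 0"
    using alg p5 unfolding alg_closed_field_def by (metis gr0I not_numeral_le_zero)
  then have \<mu>: "\<mu> - \<mu> ^ p = l'" by (simp add: algebra_simps)
  define x where "x = X - fls_const \<delta>"
  define y where "y = Y - fls_const \<mu>"
  have "y ^ p = Y ^ p - fls_const (\<mu> ^ p)"
    using N.fls_freshman[of y "fls_const \<mu>"] by (simp add: y_def algebra_simps fls_const_power)
  then have "y ^ p - y = Y ^ p - Y + fls_const (\<mu> - \<mu> ^ p)" by (simp add: y_def flip: fls_minus_const)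
  also have "\<dots> = X ^ 3 + fls_const E * X + fls_const l'" by (simp add: \<mu> N.curve_eq')
  also have "\<dots> = x ^ 3 + fls_const d * x ^ 2 + fls_const e * x + fls_const l"
  proof -
    define D where "D = fls_const \<delta>"
    define e1 where "e1 = fls_const e"
    have three: "(3 :: 'a fls) = fls_const 3" "(2 :: 'a fls) = fls_const 2" by simp_all
    have 1: "fls_const E = e1 - 3 * D ^ 2"
      unfolding E_def D_def e1_def three by (simp only: fls_const_power[symmetric] fls_minus_const fls_const_mult_const)
    have 2: "fls_const l' = 2 * D ^ 3 - e1 * D + fls_const l"
      unfolding l'_def D_def e1_def three by (simp only: fls_const_power[symmetric] fls_minus_const fls_plus_const fls_const_mult_const)
    have 3: "fls_const d = 3 * D" unfolding d D_def three by (simp only: fls_const_mult_const)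
    show ?thesis unfolding 1 2 3 x_def D_def[symmetric] e1_def[symmetric]
      by (simp add: power2_eq_square power3_eq_cube algebra_simps)
  qed
  finally have eq: "y ^ p - y = x ^ 3 + fls_const d * x ^ 2 + fls_const e * x + fls_const l" .
  have "fls_subdegree x = - int p"
    using N.subdegree_X N.X_nz p5 by (cases "\<delta> = 0") (auto simp: x_def fls_subdegree_diff_eq1)
  moreover have "fls_subdegree y = -3" unfolding y_def by (rule N.subdegree_Y_minus)
  ultimately have A: "AS_embedding p d e l x y" by (intro AS_embedding.intro alg pr p5 ch eq)
  interpret A: AS_embedding p d e l x y by (rule A)
  have "x \<in> N.F" "y \<in> N.F" unfolding x_def y_def by (intro N.F_diff N.F_X N.F_Y N.F_const)+
  then have "A.F \<subseteq> N.F" by (intro A.F_least N.F_const N.F_add N.F_mult N.F_inverse)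
  moreover have "X \<in> A.F" "Y \<in> A.F"
    using A.F_add[OF A.F_X A.F_const, of \<delta>] A.F_add[OF A.F_Y A.F_const, of \<mu>] by (simp_all add: x_def y_def)
  then have "N.F \<subseteq> A.F" by (intro N.F_least A.F_const A.F_add A.F_mult A.F_inverse)
  ultimately have "A.F = N.F" by (rule equalityI)
  moreover have "X = x + fls_const \<delta>" by (simp add: x_def)
  ultimately show ?thesis by (rule that[OF N A])
qed

theorem theorem4p25:
  fixes g :: nat and d e l :: "'a::field"
  assumes "g > 2" and "prime (g + 1)" and "CHAR('a) = g + 1"
    and "alg_closed_field TYPE('a)"
  shows "(\<not> ((g + 1) mod 3 = 2 \<and> curves_isomorphic (AS_field (g + 1) d e l) (AS_field (g + 1) 0 0 0))
            \<longrightarrow> fixes_common_pole_xy (AS_field (g + 1) d e l))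
    \<and> ((g + 1) mod 3 = 2 \<longrightarrow> card (AutK (AS_field (g + 1) (0::'a) 0 0)) = 3 * g * (g + 1) * (g + 2))
    \<and> (g mod 3 = 0 \<longrightarrow> card (AutK (AS_field (g + 1) (0::'a) 0 0)) = 3 * g * (g + 1))
    \<and> (\<not> curves_isomorphic (AS_field (g + 1) d e l) (AS_field (g + 1) 0 0 0)
            \<longrightarrow> card (AutK (AS_field (g + 1) d e l)) \<in> {g + 1, 2 * (g + 1), 3 * (g + 1)})"
proof -
  define p where "p = g + 1"
  have pr: "Factorial_Ring.prime p" and ch: "CHAR('a) = p" and alg: "alg_closed_field TYPE('a)"
    using assms by (simp_all add: p_def)
  have p5: "p \<ge> 5"
  proof (rule ccontr)
    assume "\<not> p \<ge> 5"
    then have "p = 4" using assms(1) by (simp add: p_def)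
    moreover have "\<not> Factorial_Ring.prime (4 :: nat)" by (auto simp: prime_nat_iff intro!: exI[of _ 2])
    ultimately show False using pr by simp
  qed
  obtain E X Y x y \<delta> where N: "normal_AS p E X Y" and A: "AS_embedding p d e l x y"
    and F_eq: "AS_embedding.F x y = AS_embedding.F X Y" and X_eq: "X = x + fls_const \<delta>"
    by (rule AS_embedding_normalize[OF alg pr p5 ch])
  interpret N: normal_AS p E X Y by (rule N)
  interpret A: AS_embedding p d e l x y by (rule A)
  \<comment> \<open>In contraposition: a curve not isomorphic to Y^p - Y = X^3 has nonzero
    E.\<close>
  have iso: "curves_isomorphic (AS_field p d e l) (AS_field p 0 0 0)" if "E = 0"
    using curves_isomorphic_same_image[OF A _ F_eq] N.AS_embedding_axioms that by simp
  have place_eq: "A.place = N.place" and K_aut_eq: "A.K_aut = N.K_aut"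
    by (simp_all add: fun_eq_iff A.place_def N.place_def A.K_aut_def N.K_aut_def F_eq)
  have autos_eq: "A.autos = N.autos" by (simp add: A.autos_def N.autos_def F_eq K_aut_eq)
  have fixes_pole: "fixes_common_pole_xy (AS_field p d e l)" if n: "E \<noteq> 0 \<or> p mod 3 \<noteq> 2"
    unfolding fixes_common_pole_xy_def
  proof (intro ballI allI impI)
    fix \<sigma> V assume \<sigma>: "\<sigma> \<in> AutK A.R" and V: "is_place A.R V \<and> xfun \<notin> V \<and> yfun \<notin> V"
    have "subring V A.R" using V unfolding is_place_def by blast
    then have VC: "V \<subseteq> A.C" using subringE(1) by (metis A.carrier_R)
    have pl: "A.place (A.\<Phi> ` V)" using V by (intro A.place_image_\<Phi>) blast
    have "X \<notin> A.\<Phi> ` V"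
    proof
      assume "X \<in> A.\<Phi> ` V"
      then have "X - fls_const \<delta> \<in> A.\<Phi> ` V" by (intro A.V_diff[OF pl] A.V_const[OF pl])
      then obtain q where q: "q \<in> V" "A.\<Phi> q = x" by (auto simp: X_eq)
      have "xfun \<in> A.C" using p5 by (simp add: xfun_def)
      moreover have "A.\<Phi> q = A.\<Phi> xfun" using q(2) A.ev_xfun[OF A.nonconst_X, of y] by simp
      ultimately have "q = xfun"
        using q(1) VC by (intro inj_onD[OF bij_betw_imp_inj_on[OF A.bij_\<Phi>]]) auto
      then show False using q V by blast
    qed
    then have inf: "A.\<Phi> ` V = N.V_inf"
      using N.place_at_infinity_unique pl unfolding place_eq by blast
    let ?\<tau> = "restrict (A.\<Phi> \<circ> \<sigma> \<circ> A.\<Psi>) A.F"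
    have "N.K_aut ?\<tau>" using A.AutK_to_autos[OF \<sigma>] unfolding autos_eq N.autos_def by blast
    \<comment> \<open>Moving infinity would force E = 0 and p \<equiv> 2 modulo 3.\<close>
    then have "?\<tau> ` N.V_inf = N.V_inf" using N.aut_moving_infinity n by metis
    then show "\<sigma> ` V = V" using A.AutK_fixes_place[OF \<sigma> VC] unfolding inf by blast
  qed
  \<comment> \<open>Nonzero E leaves the scalings 1 and -1, so of the three listed orders it is 2p
    that occurs.\<close>
  have cardA: "card (AutK (AS_field p d e l)) = 2 * p" if "E \<noteq> 0"
    using that A.card_AutK N.card_autos autos_eq by simp
  obtain X0 Y0 where "normal_AS p (0 :: 'a) X0 Y0" by (rule normal_AS_exists[OF alg pr p5 ch])
  then interpret Z: normal_AS p "0 :: 'a" X0 Y0 .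
  have card0: "card (AutK (AS_field p (0 :: 'a) 0 0)) = (if p mod 3 = 2 then 3 * (p - 1) * p * (p + 1) else 3 * (p - 1) * p)"
    using Z.card_AutK Z.card_autos by simp
  have "g mod 3 = 0 \<Longrightarrow> p mod 3 \<noteq> 2" unfolding p_def by presburger
  then show ?thesis
    using fixes_pole iso cardA card0 unfolding p_def by (auto simp: add.commute)
qed

end
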